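(* Let $J$ be a 5-dimensional coordinate space with coordinates $(x,y,z,p,q)$, with contact form $\varpi=\mathrm{d}z-p\,\mathrm{d}x-q\,\mathrm{d}y$ and symmetric 4-tensor (structural tensor) \begin{align*} \Upsilon&=81\,\mathrm{d}p^4-216\,\mathrm{d}p^3\mathrm{d}x+216\,\mathrm{d}p^2\mathrm{d}q\,\mathrm{d}y+144\,\mathrm{d}p^2\mathrm{d}x^2+24\,\mathrm{d}p\,\mathrm{d}q^3\\ &\quad-288\,\mathrm{d}p\,\mathrm{d}q\,\mathrm{d}x\,\mathrm{d}y-384\,\mathrm{d}p\,\mathrm{d}y^3-48\,\mathrm{d}q^2\mathrm{d}y^2+512\,\mathrm{d}x\,\mathrm{d}y^3, \end{align*} which is the contact structure of type $G_2$ associated to the solution of Noth's equation parametrized by $(t,H)=\left(\frac{2s^{1/3}}{s+2},-\frac{4s^{2/3}}{s+2}\right)$. Then the symmetry algebra of $[\varpi,\Upsilon]$ is the split simple Lie algebra $\mathfrak{g}_2$ (of dimension 14), and it is spanned by the following 14 vector fields: \begin{align*} S^1&=-(-3qx-6y^2+\tfrac{9}{4}pq)\partial_x-(3z-3px-4qy+\tfrac{9}{8}p^2)\partial_y-(-8xy^2-3pqx-2q^2y+\tfrac{9}{4}p^2q)\partial_z\\ &\quad+8y^2\partial_p-(12py-q^2-16xy)\partial_q,\\ L^2&=-(-\tfrac{9}{2}px+\tfrac{27}{16}p^2+\tfrac{3}{2}z+2x^2)\partial_x-\tfrac14q^2\partial_y-(-\tfrac94p^2x+\tfrac98p^3+\tfrac16q^3+2xz)\partial_z\\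 &\quad-(2z-2px+\tfrac34p^2)\partial_p+(\tfrac32pq-2qx)\partial_q,\\ S^3&=-\tfrac32y\,\partial_x-\tfrac12q\,\partial_y-(2xy+\tfrac14q^2)\partial_z-2y\,\partial_p+(\tfrac32p-2x)\partial_q,\\ L^4&=\tfrac34\partial_x+x\,\partial_z+\partial_p,\quad S^5=\partial_y,\quad L^6=\partial_z,\quad S^7=y\,\partial_z+\partial_q,\quad L^8=\partial_x,\\ S^9&=\tfrac34q\,\partial_x+\tfrac34p\,\partial_y+(\tfrac34pq+2y^2)\partial_z+4y\,\partial_q,\\ L^{10}&=(\tfrac34qy+\tfrac{27}{32}p^2-\tfrac34z)\partial_x+\tfrac34py\,\partial_y+(\tfrac34pqy+\tfrac9{16}p^3+\tfrac23y^3)\partial_z+\tfrac34p^2\partial_p+2y^2\partial_q,\\ S^{11}&=(\tfrac38q^2+\tfrac94py)\partial_x+(\tfrac34pq+y^2)\partial_y+(\tfrac34pq^2+\tfrac98p^2y+3yz)\partial_z+3py\,\partial_p-(-3z+\tfrac98p^2-qy)\partial_q,\\ L^{12}&=(3zx+\tfrac18q^3-3qxy-2y^3-\tfrac{27}8p^2x+\tfrac{27}{16}p^3+\tfrac94pqy)\partial_x\\ &\quad+(3yz-3pxy+\tfrac38pq^2-2qy^2+\tfrac98p^2y)\partial_y\\ &\quad+(-\tfrac94p^3x-\tfrac83xy^3+3z^2+\tfrac38q^3p-q^2y^2+\tfrac94qyp^2+\tfrac{81}{64}p^4-3xpqy)\partial_z\\ &\quad+(3pz-3p^2x-\tfrac83y^3+\tfrac98p^3)\partial_p-(-3qz+\tfrac98p^2q-6py^2+q^2y+8xy^2)\partial_q,\\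 h_1&=-(\tfrac94p-\tfrac32x)\partial_x-\tfrac12y\,\partial_y-\tfrac98p^2\partial_z-\tfrac32p\,\partial_p+\tfrac12q\,\partial_q,\\ h_2&=\tfrac{\sqrt3}{2}(x\,\partial_x+y\,\partial_y+2z\,\partial_z+p\,\partial_p+q\,\partial_q). \end{align*}
   Context: Work over $K=\mathbb{R}$ or $\mathbb{C}$ (smooth, resp. holomorphic, vector fields on a connected open subset of $K^5$ with coordinates $(x,y,z,p,q)$). Products of 1-forms in $\Upsilon$ are symmetric products, $\mathrm{d}p^4=\mathrm{d}p\odot\mathrm{d}p\odot\mathrm{d}p\odot\mathrm{d}p$ etc. The symmetry algebra of $[\varpi,\Upsilon]$ is the Lie algebra, under the Lie bracket of vector fields, of all vector fields $X$ with $\mathcal{L}_X\varpi\equiv 0 \bmod \varpi$ and $\mathcal{L}_X\Upsilon\equiv 0\bmod \varpi,\Upsilon$; that is, $\mathcal{L}_X\varpi=\lambda\varpi$ and $\mathcal{L}_X\Upsilon=\phi\,\Upsilon+\varpi\odot\sigma$ for some functions $\lambda,\phi$ and some symmetric 3-tensor $\sigma$. Noth's equation is the ODE $10(H'')^3H^{(6)}-70(H'')^2H'''H^{(5)}-49(H'')^2(H'''')^2+280H''(H''')^2H''''-175(H''')^4=0$ for $H=H(t)$. A solution $H$ is associated with the 1-forms $\omega_2=\mathrm{d}p+(t^2H_t-2tH+2\int H\,\mathrm{d}t)\mathrm{d}x+(H-tH_t)\mathrm{d}y$, $\omega_3=\mathrm{d}q+(H-tH_t)\mathrm{d}x+H_t\,\mathrm{d}y$,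 $\omega_4=\mathrm{d}y-t\,\mathrm{d}x$. For the parametrized solution in the statement these are $\omega_2=\mathrm{d}p+\frac{4}{3(s-1)}\mathrm{d}x-\frac{2s^{2/3}}{s-1}\mathrm{d}y$, $\omega_3=\mathrm{d}q-\frac{2s^{2/3}}{s-1}\mathrm{d}x-\frac{s^{1/3}(s-4)}{s-1}\mathrm{d}y$, $\omega_4=\mathrm{d}y-\frac{2s^{1/3}}{s+2}\mathrm{d}x$, and the tensor $\Upsilon$ is obtained from them by eliminating the parameter $s$ (it vanishes on the locus $\omega_2=\omega_3=\omega_4=0$). *)

theory Defs
  imports "HOL-Analysis.Analysis" "HOL-Library.Function_Algebras"
begin

section \<open>The ground field\<close>

text \<open>
  A finite-dimensional real normed field is \<open>\<real>\<close> or \<open>\<complex>\<close>, so this class expresses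
  "K is the field of real or of complex numbers".
\<close>

class real_or_complex = real_normed_field + euclidean_space

instance real :: real_or_complex ..
instance complex :: real_or_complex ..


section \<open>Calculus on open subsets of \<open>K\<^sup>5\<close>\<close>

text \<open>
  The coordinates \<open>(x, y, z, p, q)\<close> of a point \<open>P\<close> are \<open>P $ 1, \<dots>, P $ 5\<close>; note that
  \<open>5 = 0\<close> in the index type, which is harmless.
  Derivatives are taken over K.  Hence \<open>smooth_on\<close> below means smooth if K is \<open>\<real>\<close>
  and holomorphic if K is \<open>\<complex>\<close>.
\<close>

definition partial :: "5 \<Rightarrow> ('k::real_or_complex ^ 5 \<Rightarrow> 'k) \<Rightarrow> 'k ^ 5 \<Rightarrow> 'k" where
  "partial i f P = deriv (\<lambda>h. f (P + axis i h)) 0"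

primrec C_k_on :: "nat \<Rightarrow> ('k::real_or_complex ^ 5) set \<Rightarrow> ('k ^ 5 \<Rightarrow> 'k) \<Rightarrow> bool" where
  "C_k_on 0 U f \<longleftrightarrow> continuous_on U f"
| "C_k_on (Suc n) U f \<longleftrightarrow> continuous_on U f \<and>
     (\<forall>i. (\<forall>P\<in>U. (\<lambda>h. f (P + axis i h)) field_differentiable at 0) \<and> C_k_on n U (partial i f))"

definition smooth_on :: "('k::real_or_complex ^ 5) set \<Rightarrow> ('k ^ 5 \<Rightarrow> 'k) \<Rightarrow> bool" where
  "smooth_on U f \<longleftrightarrow> (\<forall>n. C_k_on n U f)"

text \<open>
  A vector field on \<open>U\<close> is represented by the total function extending it by 0 outside \<open>U\<close>,
  so that equality of vector fields on \<open>U\<close> is equality of functions.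
\<close>

definition vector_field_on ::
    "('k::real_or_complex ^ 5) set \<Rightarrow> ('k ^ 5 \<Rightarrow> 'k ^ 5) \<Rightarrow> bool" where
  "vector_field_on U X \<longleftrightarrow> (\<forall>i. smooth_on U (\<lambda>P. X P $ i)) \<and> (\<forall>P. P \<notin> U \<longrightarrow> X P = 0)"

definition restrict_field ::
    "('k::real_or_complex ^ 5) set \<Rightarrow> ('k ^ 5 \<Rightarrow> 'k ^ 5) \<Rightarrow> 'k ^ 5 \<Rightarrow> 'k ^ 5" where
  "restrict_field U X P = (if P \<in> U then X P else 0)"

definition field_scale ::
    "'k::real_or_complex \<Rightarrow> ('k ^ 5 \<Rightarrow> 'k ^ 5) \<Rightarrow> 'k ^ 5 \<Rightarrow> 'k ^ 5" where
  "field_scale c X P = c *s X P"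

definition lie_bracket ::
    "('k::real_or_complex ^ 5) set \<Rightarrow> ('k ^ 5 \<Rightarrow> 'k ^ 5) \<Rightarrow> ('k ^ 5 \<Rightarrow> 'k ^ 5) \<Rightarrow> 'k ^ 5 \<Rightarrow> 'k ^ 5"
  where "lie_bracket U X Y = restrict_field U (\<lambda>P. \<chi> i.
     \<Sum>j\<in>UNIV. X P $ j * partial j (\<lambda>Q. Y Q $ i) P - Y P $ j * partial j (\<lambda>Q. X Q $ i) P)"

text \<open>
  A symmetric covariant \<open>n\<close>-tensor is identified with the homogeneous polynomial
  \<open>v \<mapsto> T(v, \<dots>, v)\<close> of degree \<open>n\<close> on each tangent space; \<open>T P v\<close> is its value at
  the point \<open>P\<close> and the tangent vector \<open>v\<close>.  The symmetric product then is the
  pointwise product.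
\<close>

definition symmetric_tensor_on ::
    "nat \<Rightarrow> ('k::real_or_complex ^ 5) set \<Rightarrow> ('k ^ 5 \<Rightarrow> 'k ^ 5 \<Rightarrow> 'k) \<Rightarrow> bool" where
  "symmetric_tensor_on n U T \<longleftrightarrow> (\<exists>c :: 5 list \<Rightarrow> 'k ^ 5 \<Rightarrow> 'k.
     (\<forall>is. length is = n \<longrightarrow> smooth_on U (c is)) \<and>
     (\<forall>P\<in>U. \<forall>v. T P v = (\<Sum>is | length is = n. c is P * (\<Prod>i\<leftarrow>is. v $ i))))"

text \<open>
  The multilinear formula
  \<open>(L\<^sub>X T)(v, \<dots>, v) = X(T(v, \<dots>, v)) + T(DX v, v, \<dots>, v) + \<dots> + T(v, \<dots>, v, DX v)\<close>,
  for \<open>v\<close> constant in the coordinates: its last terms add up to the derivative of the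
  polynomial \<open>T P\<close> at \<open>v\<close> in the direction \<open>DX v\<close>.
\<close>

definition lie_derivative ::
    "('k::real_or_complex ^ 5 \<Rightarrow> 'k ^ 5) \<Rightarrow> ('k ^ 5 \<Rightarrow> 'k ^ 5 \<Rightarrow> 'k) \<Rightarrow> 'k ^ 5 \<Rightarrow> 'k ^ 5 \<Rightarrow> 'k" where
  "lie_derivative X T P v =
     (\<Sum>i\<in>UNIV. X P $ i * partial i (\<lambda>Q. T Q v) P) +
     (\<Sum>i\<in>UNIV. (\<Sum>j\<in>UNIV. partial j (\<lambda>Q. X Q $ i) P * v $ j) * partial i (T P) v)"

definition symmetry_algebra ::
    "('k::real_or_complex ^ 5) set \<Rightarrow> ('k ^ 5 \<Rightarrow> 'k ^ 5 \<Rightarrow> 'k) \<Rightarrow> ('k ^ 5 \<Rightarrow> 'k ^ 5 \<Rightarrow> 'k)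
       \<Rightarrow> ('k ^ 5 \<Rightarrow> 'k ^ 5) set" where
  "symmetry_algebra U \<omega> \<Upsilon> = {X. vector_field_on U X \<and>
     (\<exists>l. smooth_on U l \<and> (\<forall>P\<in>U. \<forall>v. lie_derivative X \<omega> P v = l P * \<omega> P v)) \<and>
     (\<exists>\<phi> \<sigma>. smooth_on U \<phi> \<and> symmetric_tensor_on 3 U \<sigma> \<and>
        (\<forall>P\<in>U. \<forall>v. lie_derivative X \<Upsilon> P v = \<phi> P * \<Upsilon> P v + \<omega> P v * \<sigma> P v))}"


section \<open>Lie algebras and the split simple Lie algebra of type \<open>G\<^sub>2\<close>\<close>

locale lie_algebra = vector_space scale
  for scale :: "'k::field_char_0 \<Rightarrow> 'v::ab_group_add \<Rightarrow> 'v" +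
  fixes L :: "'v set" and br :: "'v \<Rightarrow> 'v \<Rightarrow> 'v"
  assumes subspace_L: "subspace L"
    and br_closed: "x \<in> L \<Longrightarrow> y \<in> L \<Longrightarrow> br x y \<in> L"
    and br_add_left: "x \<in> L \<Longrightarrow> y \<in> L \<Longrightarrow> w \<in> L \<Longrightarrow> br (x + y) w = br x w + br y w"
    and br_add_right: "x \<in> L \<Longrightarrow> y \<in> L \<Longrightarrow> w \<in> L \<Longrightarrow> br w (x + y) = br w x + br w y"
    and br_scale_left: "x \<in> L \<Longrightarrow> y \<in> L \<Longrightarrow> br (scale c x) y = scale c (br x y)"
    and br_scale_right: "x \<in> L \<Longrightarrow> y \<in> L \<Longrightarrow> br x (scale c y) = scale c (br x y)"
    and br_self: "x \<in> L \<Longrightarrow> br x x = 0"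
    and jacobi: "x \<in> L \<Longrightarrow> y \<in> L \<Longrightarrow> w \<in> L \<Longrightarrow>
      br x (br y w) + br y (br w x) + br w (br x y) = 0"
begin

definition subalgebra :: "'v set \<Rightarrow> bool" where
  "subalgebra M \<longleftrightarrow> subspace M \<and> M \<subseteq> L \<and> (\<forall>x\<in>M. \<forall>y\<in>M. br x y \<in> M)"

definition lie_ideal :: "'v set \<Rightarrow> bool" where
  "lie_ideal I \<longleftrightarrow> subspace I \<and> I \<subseteq> L \<and> (\<forall>x\<in>L. \<forall>y\<in>I. br x y \<in> I)"

definition simple :: bool where
  "simple \<longleftrightarrow> (\<exists>x\<in>L. \<exists>y\<in>L. br x y \<noteq> 0) \<and> (\<forall>I. lie_ideal I \<longrightarrow> I = {0} \<or> I = L)"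

definition finite_dimensional :: bool where
  "finite_dimensional \<longleftrightarrow> (\<exists>B. finite B \<and> span B = L)"

definition bracket_span :: "'v set \<Rightarrow> 'v set \<Rightarrow> 'v set" where
  "bracket_span A B = span {br x y | x y. x \<in> A \<and> y \<in> B}"

definition nilpotent :: "'v set \<Rightarrow> bool" where
  "nilpotent M \<longleftrightarrow> (\<exists>n. (bracket_span M ^^ n) M = {0})"

definition normalizer :: "'v set \<Rightarrow> 'v set" where
  "normalizer M = {x \<in> L. \<forall>m\<in>M. br x m \<in> M}"

definition cartan_subalgebra :: "'v set \<Rightarrow> bool" where
  "cartan_subalgebra H \<longleftrightarrow> subalgebra H \<and> nilpotent H \<and> normalizer H = H"

text \<open>Every \<open>ad h\<close> with \<open>h \<in> H\<close> is diagonalizable over the ground field.\<close>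

definition splitting :: "'v set \<Rightarrow> bool" where
  "splitting H \<longleftrightarrow> (\<forall>h\<in>H. span {v \<in> L. \<exists>c. br h v = scale c v} = L)"

text \<open>Linear functionals on \<open>H\<close> are extended by 0 outside \<open>H\<close>.\<close>

definition dual :: "'v set \<Rightarrow> ('v \<Rightarrow> 'k) set" where
  "dual H = {f. (\<forall>x\<in>H. \<forall>y\<in>H. f (x + y) = f x + f y) \<and>
     (\<forall>c. \<forall>x\<in>H. f (scale c x) = c * f x) \<and> (\<forall>x. x \<notin> H \<longrightarrow> f x = 0)}"

definition root_space :: "'v set \<Rightarrow> ('v \<Rightarrow> 'k) \<Rightarrow> 'v set" where
  "root_space H \<alpha> = {v \<in> L. \<forall>h\<in>H. br h v = scale (\<alpha> h) v}"

definition roots :: "'v set \<Rightarrow> ('v \<Rightarrow> 'k) set" where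
  "roots H = {\<alpha> \<in> dual H. (\<exists>h\<in>H. \<alpha> h \<noteq> 0) \<and> root_space H \<alpha> \<noteq> {0}}"

text \<open>
  The root system \<open>G\<^sub>2\<close> in terms of a short simple root \<open>\<alpha>\<close> and a long simple root \<open>\<beta>\<close>:
  the positive roots are \<open>\<alpha>, \<beta>, \<alpha>+\<beta>, 2\<alpha>+\<beta>, 3\<alpha>+\<beta>, 3\<alpha>+2\<beta>\<close>.
\<close>

definition roots_of_type_G2 :: "'v set \<Rightarrow> bool" where
  "roots_of_type_G2 H \<longleftrightarrow> (\<exists>\<alpha>\<in>dual H. \<exists>\<beta>\<in>dual H.
     dual H = {\<lambda>h. a * \<alpha> h + b * \<beta> h | a b. True} \<and>
     (\<forall>a b. (\<forall>h. a * \<alpha> h + b * \<beta> h = 0) \<longrightarrow> a = 0 \<and> b = 0) \<and>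
     roots H = {\<lambda>h. of_int m * \<alpha> h + of_int n * \<beta> h | m n :: int.
       (m, n) \<in> {(1, 0), (0, 1), (1, 1), (2, 1), (3, 1), (3, 2),
                  (-1, 0), (0, -1), (-1, -1), (-2, -1), (-3, -1), (-3, -2)}})"

definition split_simple_G2 :: bool where
  "split_simple_G2 \<longleftrightarrow> finite_dimensional \<and> simple \<and>
     (\<exists>H. cartan_subalgebra H \<and> splitting H \<and> roots_of_type_G2 H)"

end


section \<open>Contact form and structural tensor\<close>

definition dx :: "'k ^ 5 \<Rightarrow> 'k" where "dx v = v $ 1"
definition dy :: "'k ^ 5 \<Rightarrow> 'k" where "dy v = v $ 2"
definition dz :: "'k ^ 5 \<Rightarrow> 'k" where "dz v = v $ 3"
definition dp :: "'k ^ 5 \<Rightarrow> 'k" where "dp v = v $ 4"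
definition dq :: "'k ^ 5 \<Rightarrow> 'k" where "dq v = v $ 5"

definition contact_form :: "'k::real_or_complex ^ 5 \<Rightarrow> 'k ^ 5 \<Rightarrow> 'k" where
  "contact_form P v = dz v - P $ 4 * dx v - P $ 5 * dy v"

definition Upsilon :: "'k::real_or_complex ^ 5 \<Rightarrow> 'k ^ 5 \<Rightarrow> 'k" where
  "Upsilon P v = 81 * dp v ^ 4 - 216 * dp v ^ 3 * dx v + 216 * dp v ^ 2 * dq v * dy v
     + 144 * dp v ^ 2 * dx v ^ 2 + 24 * dp v * dq v ^ 3
     - 288 * dp v * dq v * dx v * dy v - 384 * dp v * dy v ^ 3
     - 48 * dq v ^ 2 * dy v ^ 2 + 512 * dx v * dy v ^ 3"


section \<open>Noth's equation\<close>

definition noth_solution_on :: "'k::real_or_complex set \<Rightarrow> ('k \<Rightarrow> 'k) \<Rightarrow> bool" where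
  "noth_solution_on T H \<longleftrightarrow>
     (\<forall>n. \<forall>t\<in>T. (deriv ^^ n) H field_differentiable at t) \<and>
     (\<forall>t\<in>T. let H2 = (deriv ^^ 2) H t; H3 = (deriv ^^ 3) H t; H4 = (deriv ^^ 4) H t;
                 H5 = (deriv ^^ 5) H t; H6 = (deriv ^^ 6) H t in
        10 * H2 ^ 3 * H6 - 70 * H2 ^ 2 * H3 * H5 - 49 * H2 ^ 2 * H4 ^ 2
          + 280 * H2 * H3 ^ 2 * H4 - 175 * H3 ^ 4 = 0)"

text \<open>In \<open>omega2\<close>, the argument \<open>I\<close> is the chosen antiderivative \<open>\<integral>H dt\<close>.\<close>

definition omega2 ::
    "('k::real_or_complex \<Rightarrow> 'k) \<Rightarrow> ('k \<Rightarrow> 'k) \<Rightarrow> 'k \<Rightarrow> 'k ^ 5 \<Rightarrow> 'k" where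
  "omega2 H I t v =
     dp v + (t ^ 2 * deriv H t - 2 * t * H t + 2 * I t) * dx v + (H t - t * deriv H t) * dy v"

definition omega3 :: "('k::real_or_complex \<Rightarrow> 'k) \<Rightarrow> 'k \<Rightarrow> 'k ^ 5 \<Rightarrow> 'k" where
  "omega3 H t v = dq v + (H t - t * deriv H t) * dx v + deriv H t * dy v"

definition omega4 :: "'k::real_or_complex \<Rightarrow> 'k ^ 5 \<Rightarrow> 'k" where
  "omega4 t v = dy v - t * dx v"

text \<open>
  The tensor \<open>\<Upsilon>\<close>, which does not involve the parameter \<open>t\<close>, vanishes on all vectors of
  the contact distribution on which \<open>\<omega>\<^sub>2\<close>, \<open>\<omega>\<^sub>3\<close> and \<open>\<omega>\<^sub>4\<close> vanish for some value of \<open>t\<close>.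
\<close>

definition vanishes_on_locus ::
    "'k::real_or_complex set \<Rightarrow> ('k \<Rightarrow> 'k) \<Rightarrow> ('k \<Rightarrow> 'k) \<Rightarrow> ('k ^ 5 \<Rightarrow> 'k ^ 5 \<Rightarrow> 'k) \<Rightarrow> bool" where
  "vanishes_on_locus T H I \<Upsilon> \<longleftrightarrow> (\<forall>t\<in>T. \<forall>P v. contact_form P v = 0 \<and>
     omega2 H I t v = 0 \<and> omega3 H t v = 0 \<and> omega4 t v = 0 \<longrightarrow> \<Upsilon> P v = 0)"


section \<open>The fourteen vector fields\<close>

abbreviation D_x :: "'k::real_or_complex ^ 5" where "D_x \<equiv> axis 1 1"
abbreviation D_y :: "'k::real_or_complex ^ 5" where "D_y \<equiv> axis 2 1"
abbreviation D_z :: "'k::real_or_complex ^ 5" where "D_z \<equiv> axis 3 1"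
abbreviation D_p :: "'k::real_or_complex ^ 5" where "D_p \<equiv> axis 4 1"
abbreviation D_q :: "'k::real_or_complex ^ 5" where "D_q \<equiv> axis 5 1"

definition S1 :: "'k::real_or_complex ^ 5 \<Rightarrow> 'k ^ 5" where
  "S1 P = (let x = P $ 1; y = P $ 2; z = P $ 3; p = P $ 4; q = P $ 5 in
     -(-3*q*x - 6*y^2 + 9/4*p*q) *s D_x
     - (3*z - 3*p*x - 4*q*y + 9/8*p^2) *s D_y
     - (-8*x*y^2 - 3*p*q*x - 2*q^2*y + 9/4*p^2*q) *s D_z
     + (8*y^2) *s D_p
     - (12*p*y - q^2 - 16*x*y) *s D_q)"

definition L2 :: "'k::real_or_complex ^ 5 \<Rightarrow> 'k ^ 5" where
  "L2 P = (let x = P $ 1; z = P $ 3; p = P $ 4; q = P $ 5 in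
     -(-9/2*p*x + 27/16*p^2 + 3/2*z + 2*x^2) *s D_x
     - (1/4*q^2) *s D_y
     - (-9/4*p^2*x + 9/8*p^3 + 1/6*q^3 + 2*x*z) *s D_z
     - (2*z - 2*p*x + 3/4*p^2) *s D_p
     + (3/2*p*q - 2*q*x) *s D_q)"

definition S3 :: "'k::real_or_complex ^ 5 \<Rightarrow> 'k ^ 5" where
  "S3 P = (let x = P $ 1; y = P $ 2; p = P $ 4; q = P $ 5 in
     -(3/2*y) *s D_x
     - (1/2*q) *s D_y
     - (2*x*y + 1/4*q^2) *s D_z
     - (2*y) *s D_p
     + (3/2*p - 2*x) *s D_q)"

definition L4 :: "'k::real_or_complex ^ 5 \<Rightarrow> 'k ^ 5" where
  "L4 P = (let x = P $ 1 in
     (3/4) *s D_x + x *s D_z + D_p)"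

definition S5 :: "'k::real_or_complex ^ 5 \<Rightarrow> 'k ^ 5" where
  "S5 P = D_y"

definition L6 :: "'k::real_or_complex ^ 5 \<Rightarrow> 'k ^ 5" where
  "L6 P = D_z"

definition S7 :: "'k::real_or_complex ^ 5 \<Rightarrow> 'k ^ 5" where
  "S7 P = (let y = P $ 2 in
     y *s D_z + D_q)"

definition L8 :: "'k::real_or_complex ^ 5 \<Rightarrow> 'k ^ 5" where
  "L8 P = D_x"

definition S9 :: "'k::real_or_complex ^ 5 \<Rightarrow> 'k ^ 5" where
  "S9 P = (let y = P $ 2; p = P $ 4; q = P $ 5 in
     (3/4*q) *s D_x
     + (3/4*p) *s D_y
     + (3/4*p*q + 2*y^2) *s D_z
     + (4*y) *s D_q)"

definition L10 :: "'k::real_or_complex ^ 5 \<Rightarrow> 'k ^ 5" where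
  "L10 P = (let y = P $ 2; z = P $ 3; p = P $ 4; q = P $ 5 in
     (3/4*q*y + 27/32*p^2 - 3/4*z) *s D_x
     + (3/4*p*y) *s D_y
     + (3/4*p*q*y + 9/16*p^3 + 2/3*y^3) *s D_z
     + (3/4*p^2) *s D_p
     + (2*y^2) *s D_q)"

definition S11 :: "'k::real_or_complex ^ 5 \<Rightarrow> 'k ^ 5" where
  "S11 P = (let y = P $ 2; z = P $ 3; p = P $ 4; q = P $ 5 in
     (3/8*q^2 + 9/4*p*y) *s D_x
     + (3/4*p*q + y^2) *s D_y
     + (3/4*p*q^2 + 9/8*p^2*y + 3*y*z) *s D_z
     + (3*p*y) *s D_p
     - (-3*z + 9/8*p^2 - q*y) *s D_q)"

definition L12 :: "'k::real_or_complex ^ 5 \<Rightarrow> 'k ^ 5" where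
  "L12 P = (let x = P $ 1; y = P $ 2; z = P $ 3; p = P $ 4; q = P $ 5 in
     (3*z*x + 1/8*q^3 - 3*q*x*y - 2*y^3 - 27/8*p^2*x + 27/16*p^3 + 9/4*p*q*y) *s D_x
     + (3*y*z - 3*p*x*y + 3/8*p*q^2 - 2*q*y^2 + 9/8*p^2*y) *s D_y
     + (-9/4*p^3*x - 8/3*x*y^3 + 3*z^2 + 3/8*q^3*p - q^2*y^2 + 9/4*q*y*p^2 + 81/64*p^4 - 3*x*p*q*y) *s D_z
     + (3*p*z - 3*p^2*x - 8/3*y^3 + 9/8*p^3) *s D_p
     - (-3*q*z + 9/8*p^2*q - 6*p*y^2 + q^2*y + 8*x*y^2) *s D_q)"

definition h1 :: "'k::real_or_complex ^ 5 \<Rightarrow> 'k ^ 5" where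
  "h1 P = (let x = P $ 1; y = P $ 2; p = P $ 4; q = P $ 5 in
     -(9/4*p - 3/2*x) *s D_x
     - (1/2*y) *s D_y
     - (9/8*p^2) *s D_z
     - (3/2*p) *s D_p
     + (1/2*q) *s D_q)"

definition h2 :: "'k::real_or_complex ^ 5 \<Rightarrow> 'k ^ 5" where
  "h2 P = (let x = P $ 1; y = P $ 2; z = P $ 3; p = P $ 4; q = P $ 5 in
     of_real (sqrt 3 / 2) *s (x *s D_x + y *s D_y
     + (2*z) *s D_z + p *s D_p + q *s D_q))"

end

theory Submission
  imports Defs
begin

text \<open>
  A vector field \<open>X\<close> preserving the contact structure is determined by its Hamiltonian \<open>f = \<varpi>(X)\<close>, and
  the bracket of fields becomes the Lagrange bracket of Hamiltonians.  In a frame \<open>a, b, c, d\<close> of the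
  contact distribution with \<open>[a, d] = 4\<partial>\<^sub>z\<close>, \<open>[b, c] = - \<partial>\<^sub>z\<close> adapted to \<open>\<Upsilon>\<close>, preservation of \<open>\<Upsilon>\<close> becomes
  seven constant-coefficient linear equations of second order for \<open>f\<close>.  Their prolongation expresses all
  derivatives of the 14 functions \<open>f\<close>; \<open>af, bf, cf, df\<close>; \<open>\<partial>\<^sub>zf, acf, bdf, adf\<close>; \<open>\<partial>\<^sub>z\<close> of \<open>af, bf, cf, df\<close>;
  \<open>\<partial>\<^sub>z\<^sup>2f\<close> linearly by functions further down the list, and those of \<open>\<partial>\<^sub>z\<^sup>2f\<close> vanish.  On a
  connected set, subtracting suitable multiples of the 14 given polynomial Hamiltonians therefore makes
  these functions vanish group by group, starting from the last.  The table of brackets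
  exhibits \<open>h1, h2\<close> as spanning a Cartan subalgebra and the other fields as root vectors for \<open>G\<^sub>2\<close>;
  simplicity follows since brackets with root vectors lead from each root vector to all the others
  and to the Cartan subalgebra.
\<close>

section \<open>Partial derivatives\<close>

text \<open>Why there are seven equations: a contact field acts on the contact distribution by a
  conformally symplectic linear map, given by the ten symmetrized second frame derivatives of f and
  by \<open>fr_z f\<close>. The elements of this 11-dimensional Lie algebra that preserve the
  discriminant of binary cubics up to scale form a copy of gl_2, acting on cubics; its codimension
  is 7. The frame and the z-derivative span a Heisenberg algebra, so the system has constant
  coefficients, and the z-derivative maps solutions to solutions. If a, b, c, d count 1 and z counts
  2, then the five groups of functions have weights 0 to 4 and sizes 1, 4, 4, 4, 1: this is the
  contact grading of the 14-dimensional algebra. Commutators of the frame provide the integrability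
  conditions, which relate each group to the next and stop the process at weight 5.\<close>

lemma axis_add: "axis i (a + b) = axis i a + axis i (b::'k::real_or_complex)"
  by (simp add: vec_eq_iff axis_def)

lemma norm_axis_eq: "norm (axis i (a::'k::real_or_complex) :: 'k ^ 5) = norm a"
proof -
  have "norm (axis i a :: 'k ^ 5) \<le> (\<Sum>j\<in>UNIV. norm ((axis i a :: 'k ^ 5) $ j))"
    unfolding norm_vec_def by (rule L2_set_le_sum) simp
  also have "\<dots> = (\<Sum>j\<in>UNIV. if j = i then norm a else 0)"
    by (rule sum.cong) (auto simp: axis_def)
  finally have "norm (axis i a :: 'k ^ 5) \<le> norm a" by simp
  moreover have "norm a \<le> norm (axis i a :: 'k ^ 5)"
    using Finite_Cartesian_Product.norm_nth_le[of "axis i a :: 'k ^ 5" i] by simp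
  ultimately show ?thesis by simp
qed

lemma continuous_axis_shift:
  "continuous_on UNIV (\<lambda>h::'k::real_or_complex. P + axis i h :: 'k ^ 5)"
proof -
  have "continuous_on UNIV (\<lambda>h::'k. (\<chi> j. P $ j + (if j = i then h else 0)) :: 'k ^ 5)"
  proof (rule continuous_on_vec_lambda)
    show "continuous_on UNIV (\<lambda>h. P $ j + (if j = i then h else 0))" for j
      by (cases "j = i") (auto intro!: continuous_intros)
  qed
  moreover have "(\<lambda>h::'k. (\<chi> j. P $ j + (if j = i then h else 0)) :: 'k ^ 5) = (\<lambda>h. P + axis i h)"
    by (auto simp: fun_eq_iff vec_eq_iff axis_def)
  ultimately show ?thesis by metis
qed

text \<open>\<open>partial\<close> is built on \<open>deriv\<close>, which has a value even where no
  derivative exists. The rules of calculus are therefore proved for a relation that includes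
  existence, and carried over to \<open>partial\<close> afterwards.\<close>

definition has_partial ::
    "('k::real_or_complex ^ 5 \<Rightarrow> 'k) \<Rightarrow> 5 \<Rightarrow> 'k \<Rightarrow> 'k ^ 5 \<Rightarrow> bool" where
  "has_partial f i D P \<longleftrightarrow> ((\<lambda>h. f (P + axis i h)) has_field_derivative D) (at 0)"

lemma has_partial_imp_partial: "has_partial f i D P \<Longrightarrow> partial i f P = D"
  by (simp add: has_partial_def partial_def DERIV_imp_deriv)

lemma has_partial_const: "has_partial (\<lambda>Q. c) i 0 P"
  by (simp add: has_partial_def)

lemma has_partial_coord: "has_partial (\<lambda>Q. Q $ j) i (if i = j then 1 else 0) P"
  by (auto simp: has_partial_def axis_def intro!: derivative_eq_intros)

lemma has_partial_add:
  "has_partial f i D P \<Longrightarrow> has_partial g i E P \<Longrightarrow> has_partial (\<lambda>Q. f Q + g Q) i (D + E) P"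
  unfolding has_partial_def by (rule DERIV_add)

lemma has_partial_diff:
  "has_partial f i D P \<Longrightarrow> has_partial g i E P \<Longrightarrow> has_partial (\<lambda>Q. f Q - g Q) i (D - E) P"
  unfolding has_partial_def by (rule DERIV_diff)

lemma has_partial_minus:
  "has_partial f i D P \<Longrightarrow> has_partial (\<lambda>Q. - f Q) i (- D) P"
  unfolding has_partial_def by (rule DERIV_minus)

lemma axis_0 [simp]: "axis i (0::'k::real_or_complex) = 0"
  by (simp add: vec_eq_iff axis_def)

lemma has_partial_mult:
  assumes "has_partial f i D P" "has_partial g i E P"
  shows "has_partial (\<lambda>Q. f Q * g Q) i (D * g P + E * f P) P"
  using DERIV_mult[OF assms[unfolded has_partial_def]] by (simp add: has_partial_def)

lemma has_partial_power:
  assumes "has_partial f i D P"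
  shows "has_partial (\<lambda>Q. f Q ^ n) i (of_nat n * (D * f P ^ (n - Suc 0))) P"
  using DERIV_power[OF assms[unfolded has_partial_def], of n] by (simp add: has_partial_def)

lemmas has_partial_intros =
  has_partial_const has_partial_coord has_partial_add has_partial_diff has_partial_minus
  has_partial_mult has_partial_power

lemma eventually_axis_shift:
  assumes "open U" "P \<in> (U :: ('k::real_or_complex ^ 5) set)"
  shows "\<forall>\<^sub>F h in nhds 0. P + axis i h \<in> U"
proof -
  have "open ((\<lambda>h. P + axis i h) -` U)"
    using continuous_axis_shift[of P i] assms(1) continuous_on_open_vimage[of UNIV "\<lambda>h. P + axis i h"]
    by simp
  then show ?thesis
    using assms(2) by (auto simp: eventually_nhds intro!: exI[of _ "(\<lambda>h. P + axis i h) -` U"])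
qed

lemma has_partial_cong:
  assumes "open U" "P \<in> U" "\<And>Q. Q \<in> U \<Longrightarrow> f Q = g Q"
  shows "has_partial f i D P \<longleftrightarrow> has_partial g i D P"
  unfolding has_partial_def
  by (rule DERIV_cong_ev) (auto intro: eventually_mono[OF eventually_axis_shift[OF assms(1,2)]] assms(3))

lemma partial_cong:
  assumes "open U" "P \<in> U" "\<And>Q. Q \<in> U \<Longrightarrow> f Q = g Q"
  shows "partial i f P = partial i g P"
  unfolding partial_def
  by (rule deriv_cong_ev) (auto intro: eventually_mono[OF eventually_axis_shift[OF assms(1,2)]] assms(3))

lemma has_partial_iff:
  "(\<lambda>h. f (P + axis i h)) field_differentiable at 0 \<longleftrightarrow> has_partial f i (partial i f P) P"
  unfolding has_partial_def partial_def by (rule DERIV_deriv_iff_field_differentiable[symmetric])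

section \<open>Smooth functions\<close>

lemma C_k_on_cong:
  assumes "open U" "\<And>Q. Q \<in> U \<Longrightarrow> f Q = g Q"
  shows "C_k_on n U f \<longleftrightarrow> C_k_on n U g"
  using assms(2)
proof (induction n arbitrary: f g)
  case 0
  then show ?case by (simp cong: continuous_on_cong)
next
  case (Suc n)
  have "partial i f P = partial i g P" if "P \<in> U" for i P
    using partial_cong[OF assms(1) that] Suc.prems by blast
  moreover have "has_partial f i D P \<longleftrightarrow> has_partial g i D P" if "P \<in> U" for i P D
    using has_partial_cong[OF assms(1) that] Suc.prems by blast
  moreover have "C_k_on n U (partial i f) \<longleftrightarrow> C_k_on n U (partial i g)" for i
    using calculation(1) by (rule Suc.IH)
  moreover have "continuous_on U f \<longleftrightarrow> continuous_on U g"
    using Suc.prems by (simp cong: continuous_on_cong)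
  ultimately show ?case by (auto simp: has_partial_iff)
qed

lemma smooth_on_cong:
  assumes "open U" "\<And>Q. Q \<in> U \<Longrightarrow> f Q = g Q"
  shows "smooth_on U f \<longleftrightarrow> smooth_on U g"
  using C_k_on_cong[OF assms] by (simp add: smooth_on_def)

lemma C_k_on_Suc_D: "C_k_on (Suc n) U f \<Longrightarrow> C_k_on n U f"
  by (induction n arbitrary: f) auto

lemma C_k_on_has_partial:
  "C_k_on (Suc n) U f \<Longrightarrow> P \<in> U \<Longrightarrow> has_partial f i (partial i f P) P"
  by (simp add: has_partial_iff)

text \<open>The induction step of all closure properties. The candidates \<open>f'\<close> need to
  agree with the partial derivatives on \<open>U\<close> only, where the rules of calculus apply;
  openness makes smoothness insensitive to values outside.\<close>

lemma C_k_on_SucI: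
  assumes "open U" "continuous_on U f"
    and "\<And>i P. P \<in> U \<Longrightarrow> has_partial f i (f' i P) P" "\<And>i. C_k_on n U (f' i)"
  shows "C_k_on (Suc n) U f"
proof -
  have *: "partial i f P = f' i P" if "P \<in> U" for i P
    using assms(3)[OF that] by (rule has_partial_imp_partial)
  then have "C_k_on n U (partial i f)" for i
    using assms(4) C_k_on_cong[OF assms(1), of "partial i f" "f' i"] by auto
  with * assms show ?thesis by (auto simp: has_partial_iff)
qed

lemma C_k_on_const: "open U \<Longrightarrow> C_k_on n U (\<lambda>Q. c)"
proof (induction n arbitrary: c)
  case (Suc n)
  show ?case
    by (rule C_k_on_SucI[where f' = "\<lambda>i P. 0"])
       (use Suc in \<open>auto intro: has_partial_const\<close>)
qed auto

lemma C_k_on_coord: "open U \<Longrightarrow> C_k_on n U (\<lambda>Q. Q $ j)"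
proof (cases n)
  case (Suc m)
  assume "open U"
  then show ?thesis unfolding Suc
    by (intro C_k_on_SucI[where f' = "\<lambda>i P. if i = j then 1 else 0"])
       (use \<open>open U\<close> has_partial_coord in \<open>auto simp only: intro: C_k_on_const intro!: continuous_intros\<close>)
qed (auto intro!: continuous_intros)

lemma C_k_on_add: "open U \<Longrightarrow> C_k_on n U f \<Longrightarrow> C_k_on n U g \<Longrightarrow> C_k_on n U (\<lambda>Q. f Q + g Q)"
proof (induction n arbitrary: f g)
  case (Suc n)
  show ?case
    by (rule C_k_on_SucI[where f' = "\<lambda>i P. partial i f P + partial i g P"])
       (use Suc in \<open>auto intro!: has_partial_add C_k_on_has_partial[where n=n] continuous_intros\<close>)
qed (auto intro!: continuous_intros)

lemma C_k_on_mult: "open U \<Longrightarrow> C_k_on n U f \<Longrightarrow> C_k_on n U g \<Longrightarrow> C_k_on n U (\<lambda>Q. f Q * g Q)"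
proof (induction n arbitrary: f g)
  case (Suc n)
  have "C_k_on n U f" "C_k_on n U g"
    using Suc.prems C_k_on_Suc_D by blast+
  show ?case
    by (rule C_k_on_SucI[where f' = "\<lambda>i P. partial i f P * g P + partial i g P * f P"])
       (use Suc \<open>C_k_on n U f\<close> \<open>C_k_on n U g\<close> in
         \<open>auto intro!: has_partial_mult C_k_on_has_partial[where n=n] C_k_on_add continuous_intros\<close>)
qed (auto intro!: continuous_intros)

lemma smooth_const: "open U \<Longrightarrow> smooth_on U (\<lambda>Q. c)"
  and smooth_coord: "open U \<Longrightarrow> smooth_on U (\<lambda>Q. Q $ j)"
  and smooth_add: "open U \<Longrightarrow> smooth_on U f \<Longrightarrow> smooth_on U g \<Longrightarrow> smooth_on U (\<lambda>Q. f Q + g Q)"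
  and smooth_mult: "open U \<Longrightarrow> smooth_on U f \<Longrightarrow> smooth_on U g \<Longrightarrow> smooth_on U (\<lambda>Q. f Q * g Q)"
  by (auto simp: smooth_on_def C_k_on_const C_k_on_coord C_k_on_add C_k_on_mult)

lemma smooth_minus: "open U \<Longrightarrow> smooth_on U f \<Longrightarrow> smooth_on U (\<lambda>Q. - f Q)"
  using smooth_mult[OF _ smooth_const, of U f "-1"] by simp

lemma smooth_diff: "open U \<Longrightarrow> smooth_on U f \<Longrightarrow> smooth_on U g \<Longrightarrow> smooth_on U (\<lambda>Q. f Q - g Q)"
  using smooth_add[OF _ _ smooth_minus, of U f g] by simp

lemma smooth_power: "open U \<Longrightarrow> smooth_on U f \<Longrightarrow> smooth_on U (\<lambda>Q. f Q ^ n)"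
  by (induction n) (auto intro: smooth_const smooth_mult)

lemma smooth_partial: "smooth_on U f \<Longrightarrow> smooth_on U (partial i f)"
  by (metis C_k_on.simps(2) smooth_on_def)

lemma smooth_sum:
  "open U \<Longrightarrow> (\<And>j. j \<in> J \<Longrightarrow> smooth_on U (f j)) \<Longrightarrow> smooth_on U (\<lambda>Q. \<Sum>j\<in>J. f j Q)"
  by (induction J rule: infinite_finite_induct) (auto intro: smooth_const smooth_add)

lemmas smooth_intros =
  smooth_const smooth_coord smooth_add smooth_diff smooth_minus smooth_mult smooth_power
  smooth_partial smooth_sum

lemma smooth_has_partial: "smooth_on U f \<Longrightarrow> P \<in> U \<Longrightarrow> has_partial f i (partial i f P) P"
  unfolding smooth_on_def by (metis C_k_on_has_partial)

lemma smooth_continuous: "smooth_on U f \<Longrightarrow> continuous_on U f"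
  unfolding smooth_on_def by (metis C_k_on.simps(1))

lemma partial_const: "partial i (\<lambda>Q. c) P = 0"
  by (rule has_partial_imp_partial[OF has_partial_const])

lemma partial_coord: "partial i (\<lambda>Q. Q $ j) P = (if i = j then 1 else 0)"
  by (rule has_partial_imp_partial[OF has_partial_coord])

lemma
  assumes "smooth_on U f" "smooth_on U g" "P \<in> U"
  shows partial_add: "partial i (\<lambda>Q. f Q + g Q) P = partial i f P + partial i g P"
    and partial_diff: "partial i (\<lambda>Q. f Q - g Q) P = partial i f P - partial i g P"
    and partial_mult: "partial i (\<lambda>Q. f Q * g Q) P = partial i f P * g P + f P * partial i g P"
proof -
  note d = smooth_has_partial[OF assms(1,3), of i] smooth_has_partial[OF assms(2,3), of i]
  show "partial i (\<lambda>Q. f Q + g Q) P = partial i f P + partial i g P"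
    by (rule has_partial_imp_partial[OF has_partial_add[OF d]])
  show "partial i (\<lambda>Q. f Q - g Q) P = partial i f P - partial i g P"
    by (rule has_partial_imp_partial[OF has_partial_diff[OF d]])
  show "partial i (\<lambda>Q. f Q * g Q) P = partial i f P * g P + f P * partial i g P"
    using has_partial_imp_partial[OF has_partial_mult[OF d]] by (simp add: mult.commute)
qed

lemma partial_minus:
  "smooth_on U f \<Longrightarrow> P \<in> U \<Longrightarrow> partial i (\<lambda>Q. - f Q) P = - partial i f P"
  by (auto intro!: has_partial_imp_partial has_partial_minus smooth_has_partial)

lemma partial_cmult:
  "smooth_on U f \<Longrightarrow> P \<in> U \<Longrightarrow> partial i (\<lambda>Q. c * f Q) P = c * partial i f P"
  using has_partial_mult[OF has_partial_const smooth_has_partial, of U f P c i]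
  by (auto dest: has_partial_imp_partial)

lemma partial_sum:
  assumes "open U" "\<And>j. j \<in> J \<Longrightarrow> smooth_on U (f j)" "P \<in> U"
  shows "partial i (\<lambda>Q. \<Sum>j\<in>J. f j Q) P = (\<Sum>j\<in>J. partial i (f j) P)"
  using assms(2)
proof (induction J rule: infinite_finite_induct)
  case (insert j J)
  then have "smooth_on U (\<lambda>Q. \<Sum>j\<in>J. f j Q)" by (auto intro: smooth_sum assms(1))
  with insert assms(3) show ?case by (simp add: partial_add[of U "f j"])
qed (auto simp: partial_const)

lemma smooth_on_subset:
  assumes "smooth_on U f" "V \<subseteq> U"
  shows "smooth_on V f"
proof -
  have "C_k_on n U f \<Longrightarrow> C_k_on n V f" for n
    by (induction n arbitrary: f) (use assms(2) continuous_on_subset in \<open>fastforce+\<close>)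
  with assms(1) show ?thesis by (auto simp: smooth_on_def)
qed

text \<open>Partial derivatives are taken at parameter 0. Moving the base point gives the derivative
  at every point of a segment along an axis, which the mean value inequality requires.\<close>

lemma smooth_DERIV:
  assumes "smooth_on U f" "P + axis i h \<in> U"
  shows "((\<lambda>h. f (P + axis i h)) has_field_derivative partial i f (P + axis i h)) (at h)"
proof -
  have "((\<lambda>k. f (P + axis i (k + h))) has_field_derivative partial i f (P + axis i h)) (at 0)"
    using smooth_has_partial[OF assms, of i]
    by (simp add: has_partial_def axis_add algebra_simps)
  then show ?thesis
    using DERIV_shift[of "\<lambda>k. f (P + axis i k)" _ 0 h] by simp
qed

text \<open>The second difference of \<open>f\<close> over a small parallelogram is approximated by either
  mixed derivative, by two applications of the mean value inequality.\<close>

lemma second_difference_bound: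
  fixes f :: "'k::real_or_complex ^ 5 \<Rightarrow> 'k"
  assumes f: "smooth_on U f" and e: "e \<ge> 0"
    and near: "\<And>a b. norm a \<le> d \<Longrightarrow> norm b \<le> d \<Longrightarrow> P + axis i a + axis j b \<in> U \<and>
        norm (partial j (partial i f) (P + axis i a + axis j b) - l) \<le> e"
    and h: "norm h \<le> d"
  shows "norm (f (P + axis i h + axis j h) - f (P + axis i h) - f (P + axis j h) + f P - h * h * l)
    \<le> e * norm h * norm h"
proof -
  have d: "d \<ge> 0" using h norm_ge_zero order_trans by blast
  let ?B = "cball (0::'k) d"
  \<comment> \<open>First mean value step, along axis j with a fixed: subtracting
    \<open>b * l\<close> turns closeness of the mixed derivative to \<open>l\<close> into smallness
    of a derivative.\<close>
  have inner: "norm ((partial i f (P + axis i a + axis j h) - h * l) - (partial i f (P + axis i a) - 0 * l))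
      \<le> e * norm (h - 0)" if "norm a \<le> d" for a
  proof -
    have "norm ((partial i f (P + axis i a + axis j h) - h * l)
        - (partial i f (P + axis i a + axis j 0) - 0 * l)) \<le> e * norm (h - 0)"
    proof (rule field_differentiable_bound[where S = ?B and
          f' = "\<lambda>b. partial j (partial i f) (P + axis i a + axis j b) - l"])
      fix b :: 'k assume "b \<in> ?B"
      then have "P + axis i a + axis j b \<in> U" using near that by auto
      from smooth_DERIV[OF smooth_partial[OF f] this]
      show "((\<lambda>b. partial i f (P + axis i a + axis j b) - b * l) has_field_derivative
          partial j (partial i f) (P + axis i a + axis j b) - l) (at b within ?B)"
        by (auto intro!: derivative_eq_intros intro: has_field_derivative_at_within)
      show "norm (partial j (partial i f) (P + axis i a + axis j b) - l) \<le> e"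
        using near that \<open>b \<in> ?B\<close> by auto
    qed (use h d in auto)
    then show ?thesis by simp
  qed
  \<comment> \<open>Second mean value step, along axis i: the derivative of this difference is the
    quantity just bounded.\<close>
  have "norm ((f (P + axis i h + axis j h) - f (P + axis i h) - h * (h * l)) -
      (f (P + axis i 0 + axis j h) - f (P + axis i 0) - 0 * (h * l))) \<le> (e * norm h) * norm (h - 0)"
  proof (rule field_differentiable_bound[where S = ?B and
        f' = "\<lambda>a. partial i f (P + axis i a + axis j h) - partial i f (P + axis i a) - h * l"])
    fix a :: 'k assume "a \<in> ?B"
    then have a: "norm a \<le> d" by simp
    have "P + axis i a + axis j h \<in> U" "P + axis i a + axis j 0 \<in> U"
      using near[OF a h] near[OF a, of 0] d by auto
    then have "(P + axis j h) + axis i a \<in> U" "P + axis i a \<in> U" by (simp_all add: add_ac)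
    from smooth_DERIV[OF f this(1)] smooth_DERIV[OF f this(2)]
    show "((\<lambda>a. f (P + axis i a + axis j h) - f (P + axis i a) - a * (h * l)) has_field_derivative
        partial i f (P + axis i a + axis j h) - partial i f (P + axis i a) - h * l) (at a within ?B)"
      by (auto intro!: derivative_eq_intros intro: has_field_derivative_at_within simp: add_ac)
    show "norm (partial i f (P + axis i a + axis j h) - partial i f (P + axis i a) - h * l) \<le> e * norm h"
      using inner[OF a] by (simp add: algebra_simps)
  qed (use h d in auto)
  then show ?thesis by (simp add: algebra_simps)
qed

text \<open>Smoothness supplies derivatives along the axes and their continuity. The second
  difference is symmetric in the two directions and approximates both mixed derivatives times
  \<open>h * h\<close>, so these cannot differ.\<close>

lemma partial_commute:
  fixes f :: "'k::real_or_complex ^ 5 \<Rightarrow> 'k"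
  assumes U: "open U" and f: "smooth_on U f" and P: "P \<in> U"
  shows "partial i (partial j f) P = partial j (partial i f) P"
proof (rule ccontr)
  let ?l = "partial j (partial i f) P" and ?m = "partial i (partial j f) P"
  assume "?m \<noteq> ?l"
  \<comment> \<open>A quarter of the gap: the two estimates together bound the gap by
    \<open>2 * e\<close>, half of itself.\<close>
  define e where "e = norm (?l - ?m) / 4"
  have e: "e > 0" using \<open>?m \<noteq> ?l\<close> by (simp add: e_def)
  let ?near = "\<lambda>Q. Q \<in> U \<and> norm (partial j (partial i f) Q - ?l) \<le> e \<and>
      norm (partial i (partial j f) Q - ?m) \<le> e"
  have cont: "continuous (at P) g" if "smooth_on U g" for g
    using smooth_continuous[OF that] U P continuous_on_eq_continuous_at by blast
  have lim: "\<forall>\<^sub>F Q in nhds P. norm (g Q - g P) \<le> e" if "smooth_on U g" for g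
    using cont[OF that] e tendstoD[of g "g P" "nhds P" e]
    by (auto simp: continuous_at tendsto_at_iff_tendsto_nhds dist_norm
        elim!: eventually_mono intro: less_imp_le)
  have "\<forall>\<^sub>F Q in nhds P. ?near Q"
    using lim[OF smooth_partial[OF smooth_partial[OF f]], of j i]
      lim[OF smooth_partial[OF smooth_partial[OF f]], of i j] eventually_nhds_in_open[OF U P]
    by eventually_elim auto
  then obtain r where r: "r > 0" "\<And>Q. dist Q P < r \<Longrightarrow> ?near Q"
    by (auto simp: eventually_nhds_metric)
  \<comment> \<open>Two increments of norm at most r/3 move the point by less than r.\<close>
  define d where "d = r / 3"
  have near: "?near (P + axis i a + axis j b)" if "norm a \<le> d" "norm b \<le> d" for a b
  proof (rule r(2))
    have "norm (axis i a + axis j b :: 'k ^ 5) \<le> norm a + norm b"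
      using norm_triangle_ineq[of "axis i a" "axis j b"] by (simp add: norm_axis_eq)
    then show "dist (P + axis i a + axis j b) P < r"
      using that r(1) by (simp add: dist_norm d_def add.assoc)
  qed
  have d: "d > 0" using r(1) by (simp add: d_def)
  define h :: 'k where "h = of_real d"
  have h: "norm h \<le> d" "norm h > 0" using d by (auto simp: h_def)
  let ?D = "f (P + axis i h + axis j h) - f (P + axis i h) - f (P + axis j h) + f P"
  have 1: "norm (?D - h * h * ?l) \<le> e * norm h * norm h"
    by (rule second_difference_bound[OF f _ _ h(1)]) (use e near in auto)
  have "norm (f (P + axis j h + axis i h) - f (P + axis j h) - f (P + axis i h) + f P - h * h * ?m)
      \<le> e * norm h * norm h"
    by (rule second_difference_bound[OF f _ _ h(1)])
       (use e near in \<open>auto simp: add.commute add.left_commute\<close>)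
  then have 2: "norm (?D - h * h * ?m) \<le> e * norm h * norm h"
    by (simp add: algebra_simps)
  have "norm (h * h * (?l - ?m)) = norm ((?D - h * h * ?m) - (?D - h * h * ?l))"
    by (simp add: algebra_simps)
  also have "\<dots> \<le> 2 * e * (norm h * norm h)"
    using 1 2 norm_triangle_ineq4[of "?D - h * h * ?m" "?D - h * h * ?l"] by simp
  finally have "(norm h * norm h) * norm (?l - ?m) \<le> (norm h * norm h) * (2 * e)"
    by (simp add: norm_mult mult_ac)
  then have "norm (?l - ?m) \<le> 2 * e"
    using h(2) by (simp add: mult_le_cancel_left_pos)
  then show False using e by (simp add: e_def)
qed

text \<open>Inside a ball one passes from P to Q by changing one coordinate at a time; f is constant
  along each of these axis segments. Connectedness then turns local constancy into
  constancy.\<close>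

lemma constant_if_partials_zero:
  fixes f :: "'k::real_or_complex ^ 5 \<Rightarrow> 'k"
  assumes U: "open U" "connected U" and f: "smooth_on U f"
    and zero: "\<And>i P. P \<in> U \<Longrightarrow> partial i f P = 0"
  shows "\<exists>c. \<forall>P\<in>U. f P = c"
proof -
  have loc: "\<forall>\<^sub>F Q in at P within U. f P = f Q" if "P \<in> U" for P
  proof -
    from U(1) that obtain e where e: "e > 0" "ball P e \<subseteq> U" by (meson openE)
    have "f Q = f P" if Q: "dist P Q < e" for Q
    proof -
      let ?R = "\<lambda>A. (\<chi> i. if i \<in> A then Q $ i else P $ i) :: 'k ^ 5"
      have "f (?R A) = f P" for A :: "5 set"
      proof (induction A rule: infinite_finite_induct)
        case (insert j A)
        let ?S = "cball (0::'k) (norm (Q $ j - P $ j))"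
        have R: "?R (insert j A) = ?R A + axis j (Q $ j - P $ j)"
          using insert(2) by (auto simp: vec_eq_iff axis_def)
        \<comment> \<open>In every coordinate the point is at most as far from P as Q is, so it
          stays in the ball.\<close>
        have inU: "?R A + axis j h \<in> U" if "h \<in> ?S" for h
        proof -
          have "norm (?R A + axis j h - P) \<le> norm (Q - P)"
            unfolding norm_vec_def
            by (rule L2_set_mono) (use that insert(2) in \<open>auto simp: axis_def\<close>)
          with Q e(2) show ?thesis by (auto simp: dist_norm norm_minus_commute)
        qed
        have "norm (f (?R A + axis j (Q $ j - P $ j)) - f (?R A + axis j 0))
            \<le> 0 * norm ((Q $ j - P $ j) - 0)"
          by (rule field_differentiable_bound[where S = ?S and f' = "\<lambda>h. 0"])
             (use inU smooth_DERIV[OF f inU] zero[OF inU] in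
               \<open>auto intro: has_field_derivative_at_within\<close>)
        with R insert show ?case by simp
      qed auto
      from this[of UNIV] show ?thesis by simp
    qed
    with e(1) show ?thesis
      unfolding eventually_at by (metis dist_commute)
  qed
  show ?thesis
  proof (cases "U = {}")
    case False
    then obtain P0 where "P0 \<in> U" by blast
    then show ?thesis
      using connected_local_const[OF U(2), of _ P0 f] loc by metis
  qed auto
qed

section \<open>The Lie algebra of vector fields\<close>

lemma vector_space_field_scale: "vector_space (field_scale :: 'k::real_or_complex \<Rightarrow> ('k ^ 5 \<Rightarrow> 'k ^ 5) \<Rightarrow> _)"
  by unfold_locales
     (auto simp: field_scale_def fun_eq_iff vec_eq_iff algebra_simps vector_smult_assoc)

interpretation field_vs: vector_space "field_scale :: 'k::real_or_complex \<Rightarrow> ('k ^ 5 \<Rightarrow> 'k ^ 5) \<Rightarrow> _"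
  by (rule vector_space_field_scale)

definition dir_deriv ::
    "('k::real_or_complex ^ 5 \<Rightarrow> 'k ^ 5) \<Rightarrow> ('k ^ 5 \<Rightarrow> 'k) \<Rightarrow> 'k ^ 5 \<Rightarrow> 'k" where
  "dir_deriv X f P = (\<Sum>j\<in>UNIV. X P $ j * partial j f P)"

lemma vector_field_on_smooth: "vector_field_on U X \<Longrightarrow> smooth_on U (\<lambda>P. X P $ i)"
  by (simp add: vector_field_on_def)

lemma smooth_dir_deriv:
  "open U \<Longrightarrow> vector_field_on U X \<Longrightarrow> smooth_on U f \<Longrightarrow> smooth_on U (dir_deriv X f)"
  unfolding dir_deriv_def by (intro smooth_intros vector_field_on_smooth) auto

lemma lie_bracket_nth:
  "P \<in> U \<Longrightarrow> lie_bracket U X Y P $ i = dir_deriv X (\<lambda>Q. Y Q $ i) P - dir_deriv Y (\<lambda>Q. X Q $ i) P"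
  by (simp add: lie_bracket_def restrict_field_def dir_deriv_def sum_subtractf)

lemma lie_bracket_outside: "P \<notin> U \<Longrightarrow> lie_bracket U X Y P = 0"
  by (simp add: lie_bracket_def restrict_field_def)

lemma vector_field_eqI:
  assumes "vector_field_on U X" "vector_field_on U Y" "\<And>P i. P \<in> U \<Longrightarrow> X P $ i = Y P $ i"
  shows "X = Y"
proof
  fix P show "X P = Y P"
    using assms by (cases "P \<in> U") (auto simp: vector_field_on_def vec_eq_iff)
qed

lemma vector_field_on_bracket:
  assumes "open U" "vector_field_on U X" "vector_field_on U Y"
  shows "vector_field_on U (lie_bracket U X Y)"
proof -
  have "smooth_on U (\<lambda>P. lie_bracket U X Y P $ i)" for i
    using smooth_on_cong[OF assms(1), of "\<lambda>P. lie_bracket U X Y P $ i"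
        "\<lambda>P. dir_deriv X (\<lambda>Q. Y Q $ i) P - dir_deriv Y (\<lambda>Q. X Q $ i) P"] assms
    by (simp add: lie_bracket_nth smooth_diff smooth_dir_deriv vector_field_on_smooth)
  then show ?thesis
    by (auto simp: vector_field_on_def lie_bracket_outside)
qed

lemma vector_field_on_add:
  "open U \<Longrightarrow> vector_field_on U X \<Longrightarrow> vector_field_on U Y \<Longrightarrow> vector_field_on U (X + Y)"
  by (auto simp: vector_field_on_def intro!: smooth_intros)

lemma vector_field_on_scale:
  "open U \<Longrightarrow> vector_field_on U X \<Longrightarrow> vector_field_on U (field_scale c X)"
  by (auto simp: vector_field_on_def field_scale_def intro!: smooth_intros)

lemma vector_field_on_zero: "open U \<Longrightarrow> vector_field_on U 0"
  by (auto simp: vector_field_on_def intro!: smooth_intros)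

lemma vector_field_on_restrict:
  assumes "open U" "\<And>i. smooth_on U (\<lambda>P. X P $ i)"
  shows "vector_field_on U (restrict_field U X)"
proof -
  have "smooth_on U (\<lambda>P. restrict_field U X P $ i)" for i
    using smooth_on_cong[OF assms(1), of "\<lambda>P. restrict_field U X P $ i" "\<lambda>P. X P $ i"] assms(2)
    by (simp add: restrict_field_def)
  then show ?thesis by (simp add: vector_field_on_def restrict_field_def)
qed

lemma dir_deriv_add_right:
  "smooth_on U f \<Longrightarrow> smooth_on U g \<Longrightarrow> P \<in> U \<Longrightarrow>
    dir_deriv X (\<lambda>Q. f Q + g Q) P = dir_deriv X f P + dir_deriv X g P"
  by (simp add: dir_deriv_def partial_add algebra_simps sum.distrib)

lemma dir_deriv_diff_right:
  "smooth_on U f \<Longrightarrow> smooth_on U g \<Longrightarrow> P \<in> U \<Longrightarrow>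
    dir_deriv X (\<lambda>Q. f Q - g Q) P = dir_deriv X f P - dir_deriv X g P"
  by (simp add: dir_deriv_def partial_diff algebra_simps sum_subtractf)

lemma dir_deriv_cmult_right:
  "smooth_on U f \<Longrightarrow> P \<in> U \<Longrightarrow> dir_deriv X (\<lambda>Q. c * f Q) P = c * dir_deriv X f P"
  by (simp add: dir_deriv_def partial_cmult algebra_simps sum_distrib_left)

lemma dir_deriv_add_left: "dir_deriv (X + Y) f P = dir_deriv X f P + dir_deriv Y f P"
  by (simp add: dir_deriv_def algebra_simps sum.distrib)

lemma dir_deriv_scale_left: "dir_deriv (field_scale c X) f P = c * dir_deriv X f P"
  by (simp add: dir_deriv_def field_scale_def algebra_simps sum_distrib_left)

lemma dir_deriv_cong:
  "open U \<Longrightarrow> P \<in> U \<Longrightarrow> (\<And>Q. Q \<in> U \<Longrightarrow> f Q = g Q) \<Longrightarrow> dir_deriv X f P = dir_deriv X g P"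
  using partial_cong[of U P f g] by (simp add: dir_deriv_def)

lemma lie_bracket_add_left:
  assumes "open U" "vector_field_on U X" "vector_field_on U Y" "vector_field_on U Z"
  shows "lie_bracket U (X + Y) Z = lie_bracket U X Z + lie_bracket U Y Z"
  by (rule vector_field_eqI[of U])
     (use assms in \<open>auto intro!: vector_field_on_bracket vector_field_on_add
       simp: lie_bracket_nth dir_deriv_add_left dir_deriv_add_right[of U] vector_field_on_smooth\<close>)

lemma lie_bracket_scale_left:
  assumes "open U" "vector_field_on U X" "vector_field_on U Y"
  shows "lie_bracket U (field_scale c X) Y = field_scale c (lie_bracket U X Y)"
proof (rule vector_field_eqI[of U])
  fix P i assume "P \<in> U"
  moreover have "(\<lambda>Q. field_scale c X Q $ i) = (\<lambda>Q. c * X Q $ i)"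
    by (simp add: field_scale_def)
  moreover have "field_scale c (lie_bracket U X Y) P $ i = c * lie_bracket U X Y P $ i"
    by (simp add: field_scale_def)
  ultimately show "lie_bracket U (field_scale c X) Y P $ i = field_scale c (lie_bracket U X Y) P $ i"
    using assms by (simp add: lie_bracket_nth dir_deriv_scale_left dir_deriv_cmult_right[of U]
        vector_field_on_smooth right_diff_distrib)
qed (use assms in \<open>auto intro!: vector_field_on_bracket vector_field_on_scale\<close>)

lemma lie_bracket_antisym: "lie_bracket U Y X = - lie_bracket U X Y"
proof
  fix P show "lie_bracket U Y X P = (- lie_bracket U X Y) P"
    by (cases "P \<in> U") (auto simp: vec_eq_iff lie_bracket_nth lie_bracket_outside)
qed

text \<open>The second-order terms of the two iterated derivatives coincide because partial
  derivatives commute; the first-order terms are the components of the bracket.\<close>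

lemma dir_deriv_bracket:
  fixes f :: "'k::real_or_complex ^ 5 \<Rightarrow> 'k"
  assumes U: "open U" and X: "vector_field_on U X" and Y: "vector_field_on U Y"
    and f: "smooth_on U f" and P: "P \<in> U"
  shows "dir_deriv (lie_bracket U X Y) f P
    = dir_deriv X (dir_deriv Y f) P - dir_deriv Y (dir_deriv X f) P"
proof -
  have *: "dir_deriv A (dir_deriv B f) P = (\<Sum>j\<in>UNIV. dir_deriv A (\<lambda>Q. B Q $ j) P * partial j f P) +
      (\<Sum>j\<in>UNIV. \<Sum>i\<in>UNIV. A P $ i * B P $ j * partial i (partial j f) P)"
    if B: "vector_field_on U B" for A B
  proof -
    have "partial i (\<lambda>Q. dir_deriv B f Q) P = (\<Sum>j\<in>UNIV. partial i (\<lambda>Q. B Q $ j) P * partial j f P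
        + B P $ j * partial i (partial j f) P)" for i
      unfolding dir_deriv_def using U P f B
      by (simp add: partial_sum[of U] partial_mult[of U] smooth_intros vector_field_on_smooth)
    then have "dir_deriv A (dir_deriv B f) P = (\<Sum>i\<in>UNIV. \<Sum>j\<in>UNIV.
        A P $ i * partial i (\<lambda>Q. B Q $ j) P * partial j f P
        + A P $ i * B P $ j * partial i (partial j f) P)"
      by (simp add: dir_deriv_def[of A] sum_distrib_left algebra_simps)
    also have "\<dots> = (\<Sum>j\<in>UNIV. \<Sum>i\<in>UNIV. A P $ i * partial i (\<lambda>Q. B Q $ j) P * partial j f P
        + A P $ i * B P $ j * partial i (partial j f) P)"
      by (rule sum.swap)
    finally show ?thesis by (simp add: sum.distrib dir_deriv_def sum_distrib_right)
  qed
  have "(\<Sum>j\<in>UNIV. \<Sum>i\<in>UNIV. Y P $ i * X P $ j * partial i (partial j f) P)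
      = (\<Sum>j\<in>UNIV. \<Sum>i\<in>UNIV. X P $ i * Y P $ j * partial i (partial j f) P)"
    by (subst sum.swap) (simp add: partial_commute[OF U f P] mult_ac)
  then show ?thesis
    unfolding *[OF X] *[OF Y]
    using P by (simp add: dir_deriv_def[of "lie_bracket U X Y"] lie_bracket_nth sum_subtractf algebra_simps)
qed

text \<open>Each component of a nested bracket is a signed sum of four iterated directional
  derivatives of components. In the cyclic sum the twelve terms cancel in pairs.\<close>

lemma lie_bracket_jacobi:
  assumes U: "open U" and X: "vector_field_on U X" and Y: "vector_field_on U Y" and Z: "vector_field_on U Z"
  shows "lie_bracket U X (lie_bracket U Y Z) + lie_bracket U Y (lie_bracket U Z X)
    + lie_bracket U Z (lie_bracket U X Y) = 0"
proof (rule vector_field_eqI[of U])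
  fix P i assume P: "P \<in> U"
  have *: "lie_bracket U A (lie_bracket U B C) P $ i =
     dir_deriv A (dir_deriv B (\<lambda>Q. C Q $ i)) P - dir_deriv A (dir_deriv C (\<lambda>Q. B Q $ i)) P
     - dir_deriv B (dir_deriv C (\<lambda>Q. A Q $ i)) P + dir_deriv C (dir_deriv B (\<lambda>Q. A Q $ i)) P"
    if A: "vector_field_on U A" and B: "vector_field_on U B" and C: "vector_field_on U C" for A B C
  proof -
    have "dir_deriv A (\<lambda>Q. lie_bracket U B C Q $ i) P =
        dir_deriv A (\<lambda>Q. dir_deriv B (\<lambda>R. C R $ i) Q - dir_deriv C (\<lambda>R. B R $ i) Q) P"
      by (rule dir_deriv_cong[OF U P]) (simp add: lie_bracket_nth)
    also have "\<dots> = dir_deriv A (dir_deriv B (\<lambda>Q. C Q $ i)) P - dir_deriv A (dir_deriv C (\<lambda>Q. B Q $ i)) P"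
      using U P B C by (simp add: dir_deriv_diff_right[of U] smooth_dir_deriv vector_field_on_smooth)
    finally show ?thesis
      using P U A B C by (simp add: lie_bracket_nth dir_deriv_bracket vector_field_on_smooth)
  qed
  show "(lie_bracket U X (lie_bracket U Y Z) + lie_bracket U Y (lie_bracket U Z X)
    + lie_bracket U Z (lie_bracket U X Y)) P $ i = 0 P $ i"
    using * X Y Z by simp
qed (use assms in \<open>auto intro!: vector_field_on_bracket vector_field_on_add vector_field_on_zero\<close>)

lemma lie_bracket_add_right:
  assumes "open U" "vector_field_on U X" "vector_field_on U Y" "vector_field_on U Z"
  shows "lie_bracket U Z (X + Y) = lie_bracket U Z X + lie_bracket U Z Y"
  using lie_bracket_add_left[OF assms] lie_bracket_antisym[of U Z] by simp

lemma lie_bracket_scale_right: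
  assumes "open U" "vector_field_on U X" "vector_field_on U Y"
  shows "lie_bracket U X (field_scale c Y) = field_scale c (lie_bracket U X Y)"
  using lie_bracket_scale_left[OF assms(1,3,2)] lie_bracket_antisym[of U X]
  by (simp add: field_vs.scale_minus_right)

lemma lie_algebra_of_fields:
  assumes U: "open U" and L: "\<And>X. X \<in> L \<Longrightarrow> vector_field_on U X"
    and sub: "module.subspace field_scale L"
    and cl: "\<And>X Y. X \<in> L \<Longrightarrow> Y \<in> L \<Longrightarrow> lie_bracket U X Y \<in> L"
  shows "lie_algebra field_scale L (lie_bracket U)"
proof (intro_locales, unfold_locales)
  fix X Y assume "X \<in> L" "Y \<in> L"
  show "lie_bracket U X Y \<in> L" using cl \<open>X \<in> L\<close> \<open>Y \<in> L\<close> .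
next
  fix X assume "X \<in> L"
  show "lie_bracket U X X = 0"
    by (auto simp: lie_bracket_def restrict_field_def fun_eq_iff vec_eq_iff)
qed (use assms in \<open>auto intro!: lie_bracket_add_left lie_bracket_add_right lie_bracket_scale_left
    lie_bracket_scale_right lie_bracket_jacobi\<close>)

section \<open>Contact Hamiltonians\<close>

lemma exhaust_5: "i = 1 \<or> i = 2 \<or> i = 3 \<or> i = 4 \<or> i = 5" for i :: 5
proof (induct i)
  case (of_int z)
  then have "z = 0 \<or> z = 1 \<or> z = 2 \<or> z = 3 \<or> z = 4" by fastforce
  then show ?case by auto
qed

lemma forall_5: "(\<forall>i::5. P i) \<longleftrightarrow> P 1 \<and> P 2 \<and> P 3 \<and> P 4 \<and> P 5"
  by (metis exhaust_5)

lemma UNIV_5: "(UNIV :: 5 set) = {1, 2, 3, 4, 5}"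
  using exhaust_5 by auto

lemma sum_5: "sum f (UNIV :: 5 set) = f 1 + f 2 + f 3 + f 4 + f 5"
  unfolding UNIV_5 by (simp add: add_ac)

text \<open>
  The operators \<open>fr_d\<close>, \<open>fr_b\<close>, \<open>fr_c\<close> are the derivatives along
  \<open>\<partial>\<^sub>x + p \<partial>\<^sub>z\<close>, \<open>\<partial>\<^sub>y + q \<partial>\<^sub>z\<close>, \<open>\<partial>\<^sub>q\<close>; together with
  \<open>fr_a = 3 fr_d + 4 \<partial>\<^sub>p\<close> they form the frame of the contact distribution in which
  \<open>\<Upsilon>\<close> is 16 times the discriminant of a binary cubic.
\<close>

definition fr_d :: "('k::real_or_complex ^ 5 \<Rightarrow> 'k) \<Rightarrow> 'k ^ 5 \<Rightarrow> 'k" where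
  "fr_d f = (\<lambda>P. partial 1 f P + P $ 4 * partial 3 f P)"
definition fr_b :: "('k::real_or_complex ^ 5 \<Rightarrow> 'k) \<Rightarrow> 'k ^ 5 \<Rightarrow> 'k" where
  "fr_b f = (\<lambda>P. partial 2 f P + P $ 5 * partial 3 f P)"
definition fr_c :: "('k::real_or_complex ^ 5 \<Rightarrow> 'k) \<Rightarrow> 'k ^ 5 \<Rightarrow> 'k" where
  "fr_c f = partial 5 f"
definition fr_z :: "('k::real_or_complex ^ 5 \<Rightarrow> 'k) \<Rightarrow> 'k ^ 5 \<Rightarrow> 'k" where
  "fr_z f = partial 3 f"
definition fr_a :: "('k::real_or_complex ^ 5 \<Rightarrow> 'k) \<Rightarrow> 'k ^ 5 \<Rightarrow> 'k" where
  "fr_a f = (\<lambda>P. 3 * fr_d f P + 4 * partial 4 f P)"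

lemmas fr_defs = fr_a_def fr_b_def fr_c_def fr_d_def fr_z_def

lemma smooth_fr:
  assumes "open U" "smooth_on U f"
  shows "smooth_on U (fr_a f)" "smooth_on U (fr_b f)" "smooth_on U (fr_c f)"
    "smooth_on U (fr_d f)" "smooth_on U (fr_z f)"
  unfolding fr_defs by (intro smooth_intros assms)+

lemma fr_cong:
  assumes "open U" "P \<in> U" "\<And>Q. Q \<in> U \<Longrightarrow> f Q = g Q"
  shows "fr_a f P = fr_a g P" "fr_b f P = fr_b g P" "fr_c f P = fr_c g P"
    "fr_d f P = fr_d g P" "fr_z f P = fr_z g P"
  unfolding fr_defs using partial_cong[OF assms] by simp_all

lemma fr_add:
  assumes "smooth_on U f" "smooth_on U g" "P \<in> U"
  shows "fr_a (\<lambda>Q. f Q + g Q) P = fr_a f P + fr_a g P"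
    "fr_b (\<lambda>Q. f Q + g Q) P = fr_b f P + fr_b g P"
    "fr_c (\<lambda>Q. f Q + g Q) P = fr_c f P + fr_c g P"
    "fr_d (\<lambda>Q. f Q + g Q) P = fr_d f P + fr_d g P"
    "fr_z (\<lambda>Q. f Q + g Q) P = fr_z f P + fr_z g P"
  unfolding fr_defs partial_add[OF assms] by (simp_all add: algebra_simps)

lemma fr_cmult:
  assumes "smooth_on U f" "P \<in> U"
  shows "fr_a (\<lambda>Q. c * f Q) P = c * fr_a f P"
    "fr_b (\<lambda>Q. c * f Q) P = c * fr_b f P"
    "fr_c (\<lambda>Q. c * f Q) P = c * fr_c f P"
    "fr_d (\<lambda>Q. c * f Q) P = c * fr_d f P"
    "fr_z (\<lambda>Q. c * f Q) P = c * fr_z f P"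
  unfolding fr_defs partial_cmult[OF assms] by (simp_all add: algebra_simps)

lemma partial_fr:
  assumes U: "open U" and f: "smooth_on U f" and P: "P \<in> U"
  shows "partial i (fr_d f) P = partial i (partial 1 f) P +
      (if i = 4 then partial 3 f P else 0) + P $ 4 * partial i (partial 3 f) P"
    and "partial i (fr_b f) P = partial i (partial 2 f) P +
      (if i = 5 then partial 3 f P else 0) + P $ 5 * partial i (partial 3 f) P"
    and "partial i (fr_a f) P = 3 * partial i (fr_d f) P + 4 * partial i (partial 4 f) P"
proof -
  note s = smooth_intros U f smooth_fr
  show "partial i (fr_d f) P = partial i (partial 1 f) P +
      (if i = 4 then partial 3 f P else 0) + P $ 4 * partial i (partial 3 f) P"
    unfolding fr_d_def using P by (simp add: partial_add[of U] partial_mult[of U] partial_coord s)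
  show "partial i (fr_b f) P = partial i (partial 2 f) P +
      (if i = 5 then partial 3 f P else 0) + P $ 5 * partial i (partial 3 f) P"
    unfolding fr_b_def using P by (simp add: partial_add[of U] partial_mult[of U] partial_coord s)
  show "partial i (fr_a f) P = 3 * partial i (fr_d f) P + 4 * partial i (partial 4 f) P"
    unfolding fr_a_def using P by (simp add: partial_add[of U] partial_cmult[of U] s)
qed

lemma fr_commute:
  assumes U: "open U" and f: "smooth_on U f" and P: "P \<in> U"
  shows "fr_b (fr_a f) P = fr_a (fr_b f) P"
    "fr_c (fr_a f) P = fr_a (fr_c f) P"
    "fr_d (fr_a f) P = fr_a (fr_d f) P - 4 * fr_z f P"
    "fr_c (fr_b f) P = fr_b (fr_c f) P + fr_z f P"
    "fr_d (fr_b f) P = fr_b (fr_d f) P"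
    "fr_d (fr_c f) P = fr_c (fr_d f) P"
    "fr_a (fr_z f) P = fr_z (fr_a f) P"
    "fr_b (fr_z f) P = fr_z (fr_b f) P"
    "fr_c (fr_z f) P = fr_z (fr_c f) P"
    "fr_d (fr_z f) P = fr_z (fr_d f) P"
  using partial_commute[OF assms, of 2 1] partial_commute[OF assms, of 3 1]
    partial_commute[OF assms, of 4 1] partial_commute[OF assms, of 5 1]
    partial_commute[OF assms, of 3 2] partial_commute[OF assms, of 4 2]
    partial_commute[OF assms, of 5 2] partial_commute[OF assms, of 4 3]
    partial_commute[OF assms, of 5 3] partial_commute[OF assms, of 5 4]
  by (simp_all add: fr_a_def[of "fr_b f"] fr_a_def[of "fr_c f"] fr_a_def[of "fr_d f"] fr_a_def[of "fr_z f"]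
    fr_b_def[of "fr_a f"] fr_b_def[of "fr_c f"] fr_b_def[of "fr_d f"] fr_b_def[of "fr_z f"]
    fr_d_def[of "fr_a f"] fr_d_def[of "fr_b f"] fr_d_def[of "fr_c f"] fr_d_def[of "fr_z f"]
    fr_a_def[of "partial 5 f"] fr_a_def[of "partial 3 f"] fr_b_def[of "partial 5 f"]
    fr_b_def[of "partial 3 f"] fr_d_def[of "partial 5 f"] fr_d_def[of "partial 3 f"]
    fr_d_def[of "fr_d f"] fr_c_def fr_z_def partial_fr[OF assms] algebra_simps)

definition ham :: "('k::real_or_complex ^ 5 \<Rightarrow> 'k) \<Rightarrow> 'k ^ 5 \<Rightarrow> 'k ^ 5" where
  "ham f P = - partial 4 f P *s D_x - partial 5 f P *s D_y
     + (f P - P $ 4 * partial 4 f P - P $ 5 * partial 5 f P) *s D_z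
     + fr_d f P *s D_p + fr_b f P *s D_q"

text \<open>The x-component is minus the p-derivative; solving \<open>fr_a_def\<close> for it lets
  later computations use frame operators alone.\<close>

lemma ham_nth:
  "ham f P $ 1 = 3/4 * fr_d f P - 1/4 * fr_a f P" "ham f P $ 2 = - fr_c f P"
  "ham f P $ 3 = f P - P $ 4 * partial 4 f P - P $ 5 * partial 5 f P"
  "ham f P $ 4 = fr_d f P" "ham f P $ 5 = fr_b f P"
  by (simp_all add: ham_def axis_def fr_a_def fr_c_def field_simps)

lemma contact_form_ham: "contact_form P (ham f P) = f P"
  by (simp add: contact_form_def dx_def dy_def dz_def ham_def axis_def algebra_simps)

lemma smooth_ham:
  assumes "open U" "smooth_on U f"
  shows "smooth_on U (\<lambda>P. ham f P $ i)"
proof -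
  have "\<forall>i. smooth_on U (\<lambda>P. ham f P $ i)"
    unfolding forall_5 ham_nth by (intro conjI smooth_intros smooth_fr assms)
  then show ?thesis by blast
qed

lemma has_partial_eq_rhs: "has_partial f i D P \<Longrightarrow> D = E \<Longrightarrow> has_partial f i E P"
  by simp

lemma partial_contact_form:
  "partial i (\<lambda>Q. contact_form Q v) P = - (if i = 4 then v $ 1 else 0) - (if i = 5 then v $ 2 else 0)"
  "partial i (contact_form P) v
    = (if i = 3 then 1 else 0) - (if i = 1 then P $ 4 else 0) - (if i = 2 then P $ 5 else 0)"
proof -
  have "has_partial (\<lambda>Q. v $ 3 - Q $ 4 * v $ 1 - Q $ 5 * v $ 2) i
      (- (if i = 4 then v $ 1 else 0) - (if i = 5 then v $ 2 else 0)) P"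
    by (rule has_partial_eq_rhs, (rule has_partial_intros)+) simp
  then show "partial i (\<lambda>Q. contact_form Q v) P
      = - (if i = 4 then v $ 1 else 0) - (if i = 5 then v $ 2 else 0)"
    by (simp add: contact_form_def dx_def dy_def dz_def has_partial_imp_partial)
  have "has_partial (\<lambda>w. w $ 3 - P $ 4 * w $ 1 - P $ 5 * w $ 2) i
      ((if i = 3 then 1 else 0) - (if i = 1 then P $ 4 else 0) - (if i = 2 then P $ 5 else 0)) v"
    by (rule has_partial_eq_rhs, (rule has_partial_intros)+) simp
  moreover have "contact_form P = (\<lambda>w. w $ 3 - P $ 4 * w $ 1 - P $ 5 * w $ 2)"
    by (auto simp: fun_eq_iff contact_form_def dx_def dy_def dz_def)
  ultimately show "partial i (contact_form P) v
      = (if i = 3 then 1 else 0) - (if i = 1 then P $ 4 else 0) - (if i = 2 then P $ 5 else 0)"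
    by (simp add: has_partial_imp_partial)
qed

lemma lie_derivative_contact_form:
  "lie_derivative X contact_form P v = (\<Sum>j\<in>UNIV. v $ j * (partial j (\<lambda>Q. X Q $ 3) P
      - P $ 4 * partial j (\<lambda>Q. X Q $ 1) P - P $ 5 * partial j (\<lambda>Q. X Q $ 2) P))
     - X P $ 4 * v $ 1 - X P $ 5 * v $ 2"
  unfolding lie_derivative_def partial_contact_form by (simp add: sum_5 algebra_simps)

lemma partial_contact_component:
  assumes U: "open U" and X: "\<And>i. smooth_on U (\<lambda>P. X P $ i)" and P: "P \<in> U"
  shows "partial j (\<lambda>Q. contact_form Q (X Q)) P = partial j (\<lambda>Q. X Q $ 3) P
      - P $ 4 * partial j (\<lambda>Q. X Q $ 1) P - P $ 5 * partial j (\<lambda>Q. X Q $ 2) P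
      - (if j = 4 then X P $ 1 else 0) - (if j = 5 then X P $ 2 else 0)"
  unfolding contact_form_def dx_def dy_def dz_def using U X P
  by (simp add: partial_diff[of U] partial_mult[of U] partial_coord smooth_intros)

lemma smooth_contact_component:
  assumes U: "open U" and X: "\<And>i. smooth_on U (\<lambda>P. X P $ i)"
  shows "smooth_on U (\<lambda>Q. contact_form Q (X Q))"
  unfolding contact_form_def dx_def dy_def dz_def by (intro smooth_intros U X)

text \<open>Coefficients of the invariance condition are compared: those of dp and dq give the first
  two components of X, that of dz identifies l with the z-derivative of the Hamiltonian, those of dx
  and dy give the last two components. The third follows from the Hamiltonian itself.\<close>

lemma preserves_contact_imp_ham:
  assumes U: "open U" and X: "\<And>i. smooth_on U (\<lambda>P. X P $ i)" and P: "P \<in> U"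
    and l: "\<And>v. lie_derivative X contact_form P v = l * contact_form P v"
  shows "X P = ham (\<lambda>Q. contact_form Q (X Q)) P"
proof -
  let ?f = "\<lambda>Q. contact_form Q (X Q)"
  have j: "partial j ?f P + (if j = 4 then X P $ 1 else 0) + (if j = 5 then X P $ 2 else 0)
     - (if j = 1 then X P $ 4 else 0) - (if j = 2 then X P $ 5 else 0)
     = l * ((if j = 3 then 1 else 0) - (if j = 1 then P $ 4 else 0) - (if j = 2 then P $ 5 else 0))" for j
    using l[of "axis j 1"] exhaust_5[of j] unfolding partial_contact_component[OF U X P]
    by (auto simp: lie_derivative_contact_form
        sum_5 axis_def contact_form_def dx_def dy_def dz_def algebra_simps)
  have "partial 4 ?f P = - X P $ 1" "partial 5 ?f P = - X P $ 2"
    using j[of 4] j[of 5] by (simp_all add: eq_neg_iff_add_eq_0)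
  moreover have "partial 3 ?f P = l" "fr_d ?f P = X P $ 4" "fr_b ?f P = X P $ 5"
    using j[of 1] j[of 2] j[of 3] by (simp_all add: fr_defs algebra_simps)
  moreover have "?f P = X P $ 3 - P $ 4 * X P $ 1 - P $ 5 * X P $ 2"
    by (simp add: contact_form_def dx_def dy_def dz_def)
  ultimately show ?thesis
    by (simp add: vec_eq_iff forall_5 ham_def axis_def)
qed

lemma ham_preserves_contact:
  assumes U: "open U" and f: "smooth_on U f" and P: "P \<in> U"
    and X: "\<And>Q. Q \<in> U \<Longrightarrow> X Q = ham f Q"
  shows "lie_derivative X contact_form P v = fr_z f P * contact_form P v"
proof -
  have sX: "smooth_on U (\<lambda>P. X P $ i)" for i
    using smooth_ham[OF U f, of i] smooth_on_cong[OF U, of "\<lambda>P. X P $ i" "\<lambda>P. ham f P $ i"] X by simp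
  have "partial j (\<lambda>Q. contact_form Q (X Q)) P = partial j f P" for j
    by (rule partial_cong[OF U P]) (simp add: X contact_form_ham)
  note * = this[unfolded partial_contact_component[OF U sX P]]
  have "partial j (\<lambda>Q. X Q $ 3) P - P $ 4 * partial j (\<lambda>Q. X Q $ 1) P - P $ 5 * partial j (\<lambda>Q. X Q $ 2) P
     = partial j f P + (if j = 4 then X P $ 1 else 0) + (if j = 5 then X P $ 2 else 0)" for j
    using *[of j] by (auto simp: algebra_simps split: if_splits)
  then show ?thesis
    unfolding lie_derivative_contact_form
    by (simp add: sum_5 X[OF P] ham_def axis_def contact_form_def dx_def dy_def dz_def fr_defs algebra_simps)
qed

section \<open>The determining equations\<close>

lemma Upsilon_eq:
  "Upsilon P = (\<lambda>v. 81 * v$4^4 - 216 * v$4^3 * v$1 + 216 * v$4^2 * v$5 * v$2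
     + 144 * v$4^2 * v$1^2 + 24 * v$4 * v$5^3 - 288 * v$4 * v$5 * v$1 * v$2 - 384 * v$4 * v$2^3
     - 48 * v$5^2 * v$2^2 + 512 * v$1 * v$2^3)"
  by (simp add: fun_eq_iff Upsilon_def dx_def dy_def dp_def dq_def)

lemma partial_Upsilon:
  "partial 1 (Upsilon P) v = - 216 * v$4^3 + 288 * v$4^2 * v$1 - 288 * v$4 * v$5 * v$2 + 512 * v$2^3"
  "partial 2 (Upsilon P) v = 216 * v$4^2 * v$5 - 288 * v$4 * v$5 * v$1 - 1152 * v$4 * v$2^2
     - 96 * v$5^2 * v$2 + 1536 * v$1 * v$2^2"
  "partial 3 (Upsilon P) v = 0"
  "partial 4 (Upsilon P) v = 324 * v$4^3 - 648 * v$4^2 * v$1 + 432 * v$4 * v$5 * v$2 + 288 * v$4 * v$1^2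
     + 24 * v$5^3 - 288 * v$5 * v$1 * v$2 - 384 * v$2^3"
  "partial 5 (Upsilon P) v = 216 * v$4^2 * v$2 + 72 * v$4 * v$5^2 - 288 * v$4 * v$1 * v$2
     - 96 * v$5 * v$2^2"
  unfolding Upsilon_eq
  by (rule has_partial_imp_partial, rule has_partial_eq_rhs, (rule has_partial_intros)+,
      simp add: algebra_simps power2_eq_square power3_eq_cube)+

text \<open>\<open>Upsilon\<close> has constant coefficients, so only the Jacobian of X
  contributes.\<close>

lemma lie_derivative_Upsilon:
  "lie_derivative X Upsilon P v =
     (\<Sum>i\<in>UNIV. (\<Sum>j\<in>UNIV. partial j (\<lambda>Q. X Q $ i) P * v $ j) * partial i (Upsilon P) v)"
proof -
  have "partial i (\<lambda>Q. Upsilon Q v) P = 0" for i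
    unfolding Upsilon_def by (rule partial_const)
  then show ?thesis by (simp add: lie_derivative_def)
qed

text \<open>
  In the frame, \<open>\<Upsilon>\<close> is \<open>16 cubic_disc\<close>, and \<open>variation\<close> is its derivative along the linear vector
  field by which a Hamiltonian field with the given second frame derivatives acts on the contact
  distribution.
\<close>

definition cubic_disc :: "'k::comm_ring_1 \<Rightarrow> 'k \<Rightarrow> 'k \<Rightarrow> 'k \<Rightarrow> 'k" where
  "cubic_disc \<alpha> \<beta> \<gamma> \<delta> =
     144*\<alpha>^2*\<delta>^2 - 72*\<alpha>*\<beta>*\<gamma>*\<delta> + 6*\<alpha>*\<gamma>^3 + 32*\<beta>^3*\<delta> - 3*\<beta>^2*\<gamma>^2"

definition variation ::
    "'k::comm_ring_1 \<Rightarrow> 'k \<Rightarrow> 'k \<Rightarrow> 'k \<Rightarrow> 'k \<Rightarrow> 'k \<Rightarrow> 'k \<Rightarrow> 'k \<Rightarrow> 'k \<Rightarrow> 'k \<Rightarrow> 'k \<Rightarrow> 'k \<Rightarrow> 'k \<Rightarrow> 'k \<Rightarrow> 'k \<Rightarrow> 'k"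
  where "variation ad bd cd dd aa ab ac z bc cc bb \<alpha> \<beta> \<gamma> \<delta> =
     4 * (288*\<alpha>*\<delta>^2 - 72*\<beta>*\<gamma>*\<delta> + 6*\<gamma>^3) * (\<alpha> * ad + \<beta> * bd + \<gamma> * cd + \<delta> * dd)
     - 4 * (288*\<alpha>^2*\<delta> - 72*\<alpha>*\<beta>*\<gamma> + 32*\<beta>^3) * (\<alpha> * aa + \<beta> * ab + \<gamma> * ac + \<delta> * (ad - 4 * z))
     - 16 * (-72*\<alpha>*\<gamma>*\<delta> + 96*\<beta>^2*\<delta> - 6*\<beta>*\<gamma>^2) * (\<alpha> * ac + \<beta> * bc + \<gamma> * cc + \<delta> * cd)
     + 16 * (-72*\<alpha>*\<beta>*\<delta> + 18*\<alpha>*\<gamma>^2 - 6*\<beta>^2*\<gamma>) * (\<alpha> * ab + \<beta> * bb + \<gamma> * (bc + z) + \<delta> * bd)"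

text \<open>The vector v is a horizontal part with frame coordinates
  \<open>\<alpha> \<beta> \<gamma> \<delta>\<close> plus \<open>contact_form P v\<close> times the
  z-direction. The horizontal part yields \<open>variation\<close>; the rest is a multiple of the
  contact form and will serve as the tensor \<open>\<sigma>\<close>.\<close>

lemma lie_derivative_Upsilon_ham:
  fixes f :: "'k::real_or_complex ^ 5 \<Rightarrow> 'k"
  assumes U: "open U" and f: "smooth_on U f" and P: "P \<in> U"
    and X: "\<forall>Q\<in>U. X Q = ham f Q"
    and v: "v $ 1 = 3 * \<alpha> + \<delta>" "v $ 2 = \<beta>" "v $ 4 = 4 * \<alpha>" "v $ 5 = \<gamma>"
  shows "lie_derivative X Upsilon P v =
     variation (fr_a (fr_d f) P) (fr_b (fr_d f) P) (fr_c (fr_d f) P) (fr_d (fr_d f) P) (fr_a (fr_a f) P) (fr_a (fr_b f) P) (fr_a (fr_c f) P) (fr_z f P) (fr_b (fr_c f) P) (fr_c (fr_c f) P) (fr_b (fr_b f) P) \<alpha> \<beta> \<gamma> \<delta>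
     + contact_form P v * (\<Sum>i\<in>UNIV. partial 3 (\<lambda>Q. X Q $ i) P * partial i (Upsilon P) v)"
proof -
  let ?w = "contact_form P v"
  let ?D = "\<lambda>g. \<alpha> * fr_a g P + \<beta> * fr_b g P + \<gamma> * fr_c g P + \<delta> * fr_d g P"
  have v3: "v $ 3 = P $ 4 * v $ 1 + P $ 5 * v $ 2 + ?w"
    by (simp add: contact_form_def dx_def dy_def dz_def)
  \<comment> \<open>The same splitting for the derivative of a function along v; \<open>?D\<close>
    is its horizontal part.\<close>
  have hor: "(\<Sum>j\<in>UNIV. partial j g P * v $ j) = ?D g + ?w * partial 3 g P" for g
    by (simp add: sum_5 v3 v fr_defs algebra_simps)
  have comp: "partial j (\<lambda>Q. X Q $ i) P = partial j g P"
    if "\<And>Q. ham f Q $ i = g Q" for i j g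
    by (rule partial_cong[OF U P]) (simp add: X[rule_format] that)
  have lin: "?D g = c * ?D h + c' * ?D h'"
    if "\<And>j. partial j g P = c * partial j h P + c' * partial j h' P" for g h h' c c'
    by (simp add: fr_defs that algebra_simps)
  have D1: "?D (\<lambda>Q. X Q $ 1) = 3/4 * ?D (fr_d f) - 1/4 * ?D (fr_a f)"
  proof -
    have "partial j (\<lambda>Q. X Q $ 1) P = 3/4 * partial j (fr_d f) P - 1/4 * partial j (fr_a f) P" for j
    proof -
      have "smooth_on U (\<lambda>Q. 3/4 * fr_d f Q)" "smooth_on U (\<lambda>Q. 1/4 * fr_a f Q)"
        by (intro smooth_intros smooth_fr U f)+
      from partial_diff[OF this P, of j] show ?thesis
        unfolding comp[OF ham_nth(1)] partial_cmult[OF smooth_fr(4)[OF U f] P]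
          partial_cmult[OF smooth_fr(1)[OF U f] P] .
    qed
    then show ?thesis
      using lin[of "\<lambda>Q. X Q $ 1" "3/4" "fr_d f" "-1/4" "fr_a f"] by simp
  qed
  have "partial j (\<lambda>Q. X Q $ 2) P = - partial j (fr_c f) P" for j
    using comp[OF ham_nth(2), of j] P smooth_fr[OF U f] by (simp add: partial_minus[of U])
  then have D2: "?D (\<lambda>Q. X Q $ 2) = - ?D (fr_c f)"
    using lin[of "\<lambda>Q. X Q $ 2" "-1" "fr_c f" 0 "fr_c f"] by simp
  have D4: "?D (\<lambda>Q. X Q $ 4) = ?D (fr_d f)" and D5: "?D (\<lambda>Q. X Q $ 5) = ?D (fr_b f)"
    using comp[OF ham_nth(4)] lin[of "\<lambda>Q. X Q $ 4" 1 "fr_d f" 0 "fr_d f"]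
      comp[OF ham_nth(5)] lin[of "\<lambda>Q. X Q $ 5" 1 "fr_b f" 0 "fr_b f"] by simp_all
  have *: "lie_derivative X Upsilon P v =
     (3/4 * ?D (fr_d f) - 1/4 * ?D (fr_a f)) * partial 1 (Upsilon P) v
     - ?D (fr_c f) * partial 2 (Upsilon P) v + ?D (fr_d f) * partial 4 (Upsilon P) v
     + ?D (fr_b f) * partial 5 (Upsilon P) v
     + ?w * (\<Sum>i\<in>UNIV. partial 3 (\<lambda>Q. X Q $ i) P * partial i (Upsilon P) v)"
    unfolding lie_derivative_Upsilon hor
    unfolding sum_5 partial_Upsilon(3) D1 D2 D4 D5
    by (simp add: algebra_simps)
  \<comment> \<open>Here a, b, c, d stand for the horizontal derivatives of \<open>fr_a f\<close>,
    \<open>fr_b f\<close>, \<open>fr_c f\<close>, \<open>fr_d f\<close>. The identity rewrites the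
    gradient of the quartic in frame coordinates; \<open>fr_commute\<close> then puts the second
    derivatives into the order used by \<open>variation\<close>.\<close>
  have ring: "(3/4 * d - 1/4 * a) * (- 216 * (4*\<alpha>)^3 + 288 * (4*\<alpha>)^2 * (3*\<alpha>+\<delta>) - 288 * (4*\<alpha>) * \<gamma> * \<beta> + 512 * \<beta>^3)
     - c * (216 * (4*\<alpha>)^2 * \<gamma> - 288 * (4*\<alpha>) * \<gamma> * (3*\<alpha>+\<delta>) - 1152 * (4*\<alpha>) * \<beta>^2 - 96 * \<gamma>^2 * \<beta> + 1536 * (3*\<alpha>+\<delta>) * \<beta>^2)
     + d * (324 * (4*\<alpha>)^3 - 648 * (4*\<alpha>)^2 * (3*\<alpha>+\<delta>) + 432 * (4*\<alpha>) * \<gamma> * \<beta> + 288 * (4*\<alpha>) * (3*\<alpha>+\<delta>)^2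
         + 24 * \<gamma>^3 - 288 * \<gamma> * (3*\<alpha>+\<delta>) * \<beta> - 384 * \<beta>^3)
     + b * (216 * (4*\<alpha>)^2 * \<beta> + 72 * (4*\<alpha>) * \<gamma>^2 - 288 * (4*\<alpha>) * (3*\<alpha>+\<delta>) * \<beta> - 96 * \<gamma> * \<beta>^2) =
     4 * (288*\<alpha>*\<delta>^2 - 72*\<beta>*\<gamma>*\<delta> + 6*\<gamma>^3) * d - 4 * (288*\<alpha>^2*\<delta> - 72*\<alpha>*\<beta>*\<gamma> + 32*\<beta>^3) * a
     - 16 * (-72*\<alpha>*\<gamma>*\<delta> + 96*\<beta>^2*\<delta> - 6*\<beta>*\<gamma>^2) * c
     + 16 * (-72*\<alpha>*\<beta>*\<delta> + 18*\<alpha>*\<gamma>^2 - 6*\<beta>^2*\<gamma>) * b" for a b c d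
    by (simp add: field_simps power2_eq_square power3_eq_cube)
  show ?thesis
    unfolding * partial_Upsilon(1,2,4,5) v fr_commute[OF U f P] ring variation_def ..
qed

text \<open>Both sides are quartic in the frame coordinates, so test vectors give linear conditions
  on the twelve unknowns. The eight chosen ones have entries 0, 1, -1 and are enough: they give the
  seven equations and the eighth relation \<open>\<phi> = 2 * z\<close>, half of whose multiple is
  the sum of \<open>e3\<close> and \<open>e4\<close>.\<close>

lemma determining_equations_aux:
  fixes aa ab ac ad bb bc bd cc cd dd z \<phi> :: "'k::field_char_0"
  assumes h: "\<And>\<alpha> \<beta> \<gamma> \<delta>. 
     variation ad bd cd dd aa ab ac z bc cc bb \<alpha> \<beta> \<gamma> \<delta>
     = \<phi> * (16 * cubic_disc \<alpha> \<beta> \<gamma> \<delta>)"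
  shows "aa = 0" "ab = 0" "dd = 0" "cd = 0" "3 * bb = - 4 * ac" "4 * cc = - bd" "12 * bc = - ad - 4 * z"
proof -
  define E where "E \<alpha> \<beta> \<gamma> \<delta> = 
     (variation ad bd cd dd aa ab ac z bc cc bb \<alpha> \<beta> \<gamma> \<delta> - \<phi> * (16 * cubic_disc \<alpha> \<beta> \<gamma> \<delta>)) / 16"
    for \<alpha> \<beta> \<gamma> \<delta>
  have E: "E \<alpha> \<beta> \<gamma> \<delta> = 0" for \<alpha> \<beta> \<gamma> \<delta>
    unfolding E_def using h[of \<alpha> \<beta> \<gamma> \<delta>] by simp
  have "E (0) (-1) (0) (0) = (-8)*ab"
    unfolding E_def variation_def cubic_disc_def by (simp add: field_simps)
  then have e1: "(-8)*ab = 0" by (simp only: E)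
  have "E (-1) (-1) (0) (0) = (-8)*aa + (-8)*ab"
    unfolding E_def variation_def cubic_disc_def by (simp add: field_simps)
  then have e2: "(-8)*aa + (-8)*ab = 0" by (simp only: E)
  have "E (-1) (0) (0) (-1) = (-72)*aa + (72)*dd + (288)*z + (-144)*\<phi>"
    unfolding E_def variation_def cubic_disc_def by (simp add: field_simps)
  then have e3: "(-72)*aa + (72)*dd + (288)*z + (-144)*\<phi> = 0" by (simp only: E)
  have "E (-1) (0) (0) (1) = (72)*aa + (-72)*dd + (288)*z + (-144)*\<phi>"
    unfolding E_def variation_def cubic_disc_def by (simp add: field_simps)
  then have e4: "(72)*aa + (-72)*dd + (288)*z + (-144)*\<phi> = 0" by (simp only: E)
  have "E (0) (0) (-1) (0) = (3/2)*cd"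
    unfolding E_def variation_def cubic_disc_def by (simp add: field_simps)
  then have e5: "(3/2)*cd = 0" by (simp only: E)
  have "E (-1) (0) (-1) (0) = (18)*ab + (3/2)*ad + (18)*bc + (3/2)*cd + (18)*z + (-6)*\<phi>"
    unfolding E_def variation_def cubic_disc_def by (simp add: field_simps)
  then have e6: "(18)*ab + (3/2)*ad + (18)*bc + (3/2)*cd + (18)*z + (-6)*\<phi> = 0" by (simp only: E)
  have "E (0) (-1) (-1) (0) = (-8)*ab + (-8)*ac + (-6)*bb + (3/2)*bd + (6)*cc + (3/2)*cd + (-6)*z + (3)*\<phi>"
    unfolding E_def variation_def cubic_disc_def by (simp add: field_simps)
  then have e7: "(-8)*ab + (-8)*ac + (-6)*bb + (3/2)*bd + (6)*cc + (3/2)*cd + (-6)*z + (3)*\<phi> = 0" by (simp only: E)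
  have "E (-1) (-1) (-1) (0) = (10)*aa + (22)*ab + (16)*ac + (3/2)*ad + (12)*bb + (18)*bc + (3/2)*bd + (6)*cc + (3/2)*cd + (12)*z + (-3)*\<phi>"
    unfolding E_def variation_def cubic_disc_def by (simp add: field_simps)
  then have e8: "(10)*aa + (22)*ab + (16)*ac + (3/2)*ad + (12)*bb + (18)*bc + (3/2)*bd + (6)*cc + (3/2)*cd + (12)*z + (-3)*\<phi> = 0" by (simp only: E)
  show "aa = 0"
    using e1 e2 by algebra
  show "ab = 0"
    using e1 by algebra
  show "dd = 0"
    using e1 e2 e3 e4 by algebra
  show "cd = 0"
    using e5 by algebra
  show "3 * bb = - 4 * ac"
    using e1 e5 e2 e6 e7 e8 by algebra
  show "4 * cc = - bd"
    using e1 e5 e2 e6 e3 e4 e7 e8 by algebra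
  show "12 * bc = - ad - 4 * z"
    using e1 e5 e6 e3 e4 by algebra
qed

definition det_eqs :: "('k::real_or_complex ^ 5) set \<Rightarrow> ('k ^ 5 \<Rightarrow> 'k) \<Rightarrow> bool" where
  "det_eqs U f \<longleftrightarrow> smooth_on U f \<and> (\<forall>P\<in>U. fr_a (fr_a f) P = 0 \<and> fr_a (fr_b f) P = 0 \<and>
     fr_d (fr_d f) P = 0 \<and> fr_c (fr_d f) P = 0 \<and> 3 * fr_b (fr_b f) P = - 4 * fr_a (fr_c f) P \<and>
     4 * fr_c (fr_c f) P = - fr_b (fr_d f) P \<and>
     12 * fr_b (fr_c f) P = - fr_a (fr_d f) P - 4 * fr_z f P)"

text \<open>The vector is alpha a + beta b + gamma c + delta d modulo the z-direction. The
  polynomial \<open>cubic_disc\<close> is -3 times the classical discriminant of the cubic (alpha/2)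
  X^3 + beta X^2 Y + gamma X Y^2 + (8 delta/3) Y^3.\<close>

lemma Upsilon_frame:
  fixes v :: "'k::real_or_complex ^ 5"
  assumes v: "v $ 1 = 3 * \<alpha> + \<delta>" "v $ 2 = \<beta>" "v $ 4 = 4 * \<alpha>" "v $ 5 = \<gamma>"
  shows "Upsilon P v = 16 * cubic_disc \<alpha> \<beta> \<gamma> \<delta>"
  unfolding Upsilon_eq v cubic_disc_def by algebra

lemma symmetry_imp_ham:
  assumes U: "open U" and X: "X \<in> symmetry_algebra U contact_form Upsilon"
  defines "f \<equiv> \<lambda>P. contact_form P (X P)"
  shows "det_eqs U f" "\<And>P. P \<in> U \<Longrightarrow> X P = ham f P"
proof -
  from X obtain l \<phi> \<sigma> where sX: "\<And>i. smooth_on U (\<lambda>P. X P $ i)"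
    and l: "\<And>P v. P \<in> U \<Longrightarrow> lie_derivative X contact_form P v = l P * contact_form P v"
    and \<phi>: "\<And>P v. P \<in> U \<Longrightarrow> lie_derivative X Upsilon P v = \<phi> P * Upsilon P v + contact_form P v * \<sigma> P v"
    unfolding symmetry_algebra_def vector_field_on_def by blast
  have f: "smooth_on U f"
    unfolding f_def by (rule smooth_contact_component[OF U sX])
  show ham: "X P = ham f P" if "P \<in> U" for P
    unfolding f_def by (rule preserves_contact_imp_ham[OF U sX that l[OF that]])
  have "fr_a (fr_a f) P = 0 \<and> fr_a (fr_b f) P = 0 \<and>
     fr_d (fr_d f) P = 0 \<and> fr_c (fr_d f) P = 0 \<and> 3 * fr_b (fr_b f) P = - 4 * fr_a (fr_c f) P \<and>
     4 * fr_c (fr_c f) P = - fr_b (fr_d f) P \<and>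
     12 * fr_b (fr_c f) P = - fr_a (fr_d f) P - 4 * fr_z f P" if P: "P \<in> U" for P
  proof -
    \<comment> \<open>An arbitrary horizontal vector at P: its z-component is chosen to annihilate
      the contact form, which removes \<open>\<sigma>\<close> from the condition.\<close>
    let ?v = "\<lambda>\<alpha> \<beta> \<gamma> \<delta>. (3 * \<alpha> + \<delta>) *s D_x + \<beta> *s D_y
      + (P $ 4 * (3 * \<alpha> + \<delta>) + P $ 5 * \<beta>) *s D_z + (4 * \<alpha>) *s D_p + \<gamma> *s D_q"
    have v: "?v \<alpha> \<beta> \<gamma> \<delta> $ 1 = 3 * \<alpha> + \<delta>" "?v \<alpha> \<beta> \<gamma> \<delta> $ 2 = \<beta>"
      "?v \<alpha> \<beta> \<gamma> \<delta> $ 4 = 4 * \<alpha>" "?v \<alpha> \<beta> \<gamma> \<delta> $ 5 = \<gamma>" for \<alpha> \<beta> \<gamma> \<delta>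
      by (simp_all add: axis_def)
    have w: "contact_form P (?v \<alpha> \<beta> \<gamma> \<delta>) = 0" for \<alpha> \<beta> \<gamma> \<delta>
      by (simp add: contact_form_def dx_def dy_def dz_def axis_def)
    have ham': "\<forall>P\<in>U. X P = ham f P" using ham by blast
    show ?thesis
      using determining_equations_aux[of "fr_a (fr_d f) P" "fr_b (fr_d f) P" "fr_c (fr_d f) P"
        "fr_d (fr_d f) P" "fr_a (fr_a f) P" "fr_a (fr_b f) P" "fr_a (fr_c f) P" "fr_z f P"
        "fr_b (fr_c f) P" "fr_c (fr_c f) P" "fr_b (fr_b f) P" "\<phi> P",
        OF \<phi>[OF P, of "?v \<alpha> \<beta> \<gamma> \<delta>" for \<alpha> \<beta> \<gamma> \<delta>, unfolded lie_derivative_Upsilon_ham[OF U f P ham' v]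
          Upsilon_frame[OF v] w mult_zero_left add_0_right]] by blast
  qed
  with f show "det_eqs U f" by (simp add: det_eqs_def)
qed

section \<open>Smooth symmetric tensors of degree 3\<close>

lemma symmetric_tensor_scalar:
  "smooth_on U c \<Longrightarrow> symmetric_tensor_on 0 U (\<lambda>P v. c P)"
  unfolding symmetric_tensor_on_def by (intro exI[of _ "\<lambda>is. c"]) auto

text \<open>The coefficients in \<open>symmetric_tensor_on\<close> need not be symmetric in the
  indices. So the new factor can be put at the head of the list, with coefficient 0 for lists that
  start otherwise.\<close>

lemma symmetric_tensor_Suc:
  assumes U: "open U" and T: "symmetric_tensor_on n U T"
  shows "symmetric_tensor_on (Suc n) U (\<lambda>P v. v $ i * T P v)"
proof -
  from T obtain c where c: "\<And>is. length is = n \<Longrightarrow> smooth_on U (c is)"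
    and T: "\<And>P v. P \<in> U \<Longrightarrow> T P v = (\<Sum>is | length is = n. c is P * (\<Prod>i\<leftarrow>is. v $ i))"
    unfolding symmetric_tensor_on_def by blast
  let ?c = "\<lambda>js P. if hd js = i then c (tl js) P else 0"
  have "smooth_on U (?c js)" if "length js = Suc n" for js
    by (cases "hd js = i") (use that c U in \<open>auto intro: smooth_const\<close>)
  moreover have "v $ i * T P v = (\<Sum>js | length js = Suc n. ?c js P * (\<Prod>k\<leftarrow>js. v $ k))"
    if "P \<in> U" for P v
  proof -
    have "(\<Sum>js | length js = Suc n. ?c js P * (\<Prod>k\<leftarrow>js. v $ k))
       = (\<Sum>js \<in> Cons i ` {is. length is = n}. ?c js P * (\<Prod>k\<leftarrow>js. v $ k))"
    proof (rule sum.mono_neutral_right)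
      show "finite {js :: 5 list. length js = Suc n}"
        using finite_lists_length_eq[of "UNIV :: 5 set" "Suc n"] by simp
      show "\<forall>js\<in>{js. length js = Suc n} - Cons i ` {is. length is = n}. ?c js P * (\<Prod>k\<leftarrow>js. v $ k) = 0"
        by (auto simp: length_Suc_conv)
    qed auto
    also have "\<dots> = (\<Sum>is | length is = n. v $ i * (c is P * (\<Prod>k\<leftarrow>is. v $ k)))"
      by (subst sum.reindex) (auto simp: mult_ac)
    finally show ?thesis using T[OF that] by (simp add: sum_distrib_left)
  qed
  ultimately show ?thesis unfolding symmetric_tensor_on_def by (intro exI[of _ ?c]) blast
qed

lemma symmetric_tensor_add:
  assumes "open U" "symmetric_tensor_on n U S" "symmetric_tensor_on n U T"
  shows "symmetric_tensor_on n U (\<lambda>P v. S P v + T P v)"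
proof -
  from assms(2) obtain c where
      "\<And>is. length is = n \<Longrightarrow> smooth_on U (c is)"
      "\<And>P v. P \<in> U \<Longrightarrow> S P v = (\<Sum>is | length is = n. c is P * (\<Prod>i\<leftarrow>is. v $ i))"
    unfolding symmetric_tensor_on_def by blast
  moreover from assms(3) obtain d where
      "\<And>is. length is = n \<Longrightarrow> smooth_on U (d is)"
      "\<And>P v. P \<in> U \<Longrightarrow> T P v = (\<Sum>is | length is = n. d is P * (\<Prod>i\<leftarrow>is. v $ i))"
    unfolding symmetric_tensor_on_def by blast
  ultimately show ?thesis using assms(1)
    unfolding symmetric_tensor_on_def
    by (intro exI[of _ "\<lambda>is P. c is P + d is P"]) (auto intro: smooth_add simp: sum.distrib distrib_right)
qed

lemma symmetric_tensor_cubic: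
  assumes "open U" "smooth_on U c"
  shows "symmetric_tensor_on 3 U (\<lambda>P v. v $ i * (v $ j * (v $ k * c P)))"
  unfolding numeral_3_eq_3
  by (intro symmetric_tensor_Suc symmetric_tensor_scalar assms)

text \<open>This provides the tensor \<open>\<sigma>\<close> of \<open>symmetry_algebra\<close>: the
  gradient of a quartic consists of cubics, written out here as sixteen monomials.\<close>

lemma symmetric_tensor_partial_Upsilon:
  assumes U: "open U" and c: "\<And>i. smooth_on U (c i)"
  shows "symmetric_tensor_on 3 U (\<lambda>P v. \<Sum>i\<in>UNIV. c i P * partial i (Upsilon P) v)"
proof -
  have eq: "(\<lambda>P v. \<Sum>i\<in>UNIV. c i P * partial i (Upsilon P) v) = (\<lambda>P v.
     v$4 * (v$4 * (v$4 * (- 216 * c 1 P + 324 * c 4 P)))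
     + v$4 * (v$4 * (v$1 * (288 * c 1 P - 648 * c 4 P)))
     + v$4 * (v$5 * (v$2 * (- 288 * c 1 P + 432 * c 4 P)))
     + v$2 * (v$2 * (v$2 * (512 * c 1 P - 384 * c 4 P)))
     + v$4 * (v$4 * (v$5 * (216 * c 2 P)))
     + v$4 * (v$5 * (v$1 * (- 288 * c 2 P)))
     + v$4 * (v$2 * (v$2 * (- 1152 * c 2 P)))
     + v$5 * (v$5 * (v$2 * (- 96 * c 2 P)))
     + v$1 * (v$2 * (v$2 * (1536 * c 2 P)))
     + v$4 * (v$1 * (v$1 * (288 * c 4 P)))
     + v$5 * (v$5 * (v$5 * (24 * c 4 P)))
     + v$5 * (v$1 * (v$2 * (- 288 * c 4 P)))
     + v$4 * (v$4 * (v$2 * (216 * c 5 P)))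
     + v$4 * (v$5 * (v$5 * (72 * c 5 P)))
     + v$4 * (v$1 * (v$2 * (- 288 * c 5 P)))
     + v$5 * (v$2 * (v$2 * (- 96 * c 5 P))))"
    unfolding sum_5 partial_Upsilon by (intro ext) algebra
  show ?thesis
    unfolding eq by (intro symmetric_tensor_add symmetric_tensor_cubic smooth_intros U c)
qed

lemma ham_in_symmetry_algebra:
  assumes U: "open U" and X: "vector_field_on U X" and f: "det_eqs U f"
    and ham: "\<And>P. P \<in> U \<Longrightarrow> X P = ham f P"
  shows "X \<in> symmetry_algebra U contact_form Upsilon"
proof -
  have sf: "smooth_on U f" using f by (simp add: det_eqs_def)
  let ?\<sigma> = "\<lambda>P v. \<Sum>i\<in>UNIV. partial 3 (\<lambda>Q. X Q $ i) P * partial i (Upsilon P) v"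
  \<comment> \<open>The factor is \<open>2 * fr_z f P\<close>: a field scaling the contact form by z
    acts on the distribution with scalar part z/2, and \<open>Upsilon\<close> has degree 4
    there.\<close>
  have "lie_derivative X Upsilon P v = 2 * fr_z f P * Upsilon P v + contact_form P v * ?\<sigma> P v"
    if P: "P \<in> U" for P v
  proof -
    \<comment> \<open>Inversion of dx = 3 alpha + delta, dp = 4 alpha.\<close>
    define \<alpha> \<delta> where "\<alpha> = v $ 4 / 4" and "\<delta> = v $ 1 - 3 * (v $ 4 / 4)"
    have v: "v $ 1 = 3 * \<alpha> + \<delta>" "v $ 2 = v $ 2" "v $ 4 = 4 * \<alpha>" "v $ 5 = v $ 5"
      by (simp_all add: \<alpha>_def \<delta>_def)
    define ac bd ad z where defs: "ac = fr_a (fr_c f) P" "bd = fr_b (fr_d f) P" "ad = fr_a (fr_d f) P"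
      "z = fr_z f P"
    have e: "fr_a (fr_a f) P = 0" "fr_a (fr_b f) P = 0" "fr_d (fr_d f) P = 0" "fr_c (fr_d f) P = 0"
      "fr_b (fr_b f) P = - 4/3 * ac" "fr_c (fr_c f) P = - 1/4 * bd"
      "fr_b (fr_c f) P = - 1/12 * ad - 1/3 * z"
      using f P unfolding det_eqs_def defs by (simp_all add: field_simps)
    have ring: "variation ad bd 0 0 0 0 ac z (- 1/12 * ad - 1/3 * z) (- 1/4 * bd) (- 4/3 * ac) \<alpha> \<beta> \<gamma> \<delta>
        = 2 * z * (16 * cubic_disc \<alpha> \<beta> \<gamma> \<delta>)" for \<beta> \<gamma>
      by (simp add: variation_def cubic_disc_def field_simps power2_eq_square power3_eq_cube)
    have ham': "\<forall>P\<in>U. X P = ham f P" using ham by blast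
    show ?thesis
      unfolding lie_derivative_Upsilon_ham[OF U sf P ham' v] Upsilon_frame[OF v] e
        defs[symmetric] ring ..
  qed
  moreover have "symmetric_tensor_on 3 U ?\<sigma>"
    using X by (intro symmetric_tensor_partial_Upsilon U smooth_intros) (simp add: vector_field_on_def)
  moreover have "smooth_on U (\<lambda>P. 2 * fr_z f P)"
    by (intro smooth_intros smooth_fr U sf)
  moreover have "smooth_on U (fr_z f)" by (intro smooth_fr U sf)
  moreover have "lie_derivative X contact_form P v = fr_z f P * contact_form P v" if "P \<in> U" for P v
    by (rule ham_preserves_contact[OF U sf that ham])
  ultimately show ?thesis
    using X unfolding symmetry_algebra_def
    by (intro CollectI conjI exI[of _ "fr_z f"] exI[of _ "\<lambda>P. 2 * fr_z f P"] exI[of _ ?\<sigma>]) auto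
qed

section \<open>Prolongation of the determining equations\<close>

text \<open>The tool for differentiating an equation that holds on all of \<open>U\<close>.
  Right-hand sides of two terms cover every equation of the prolongation; \<open>c' = 0\<close>
  handles those with one.\<close>

lemma fr_lin:
  assumes U: "open U" and h: "smooth_on U h" "smooth_on U h'" and P: "P \<in> U"
    and g: "\<forall>Q\<in>U. g Q = c * h Q + c' * h' Q"
  shows "fr_a g P = c * fr_a h P + c' * fr_a h' P"
    "fr_b g P = c * fr_b h P + c' * fr_b h' P"
    "fr_c g P = c * fr_c h P + c' * fr_c h' P"
    "fr_d g P = c * fr_d h P + c' * fr_d h' P"
    "fr_z g P = c * fr_z h P + c' * fr_z h' P"
proof -
  have s: "smooth_on U (\<lambda>Q. c * h Q)" "smooth_on U (\<lambda>Q. c' * h' Q)"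
    by (intro smooth_intros U h)+
  have g: "\<And>Q. Q \<in> U \<Longrightarrow> g Q = c * h Q + c' * h' Q" using g by blast
  show "fr_a g P = c * fr_a h P + c' * fr_a h' P"
    "fr_b g P = c * fr_b h P + c' * fr_b h' P"
    "fr_c g P = c * fr_c h P + c' * fr_c h' P"
    "fr_d g P = c * fr_d h P + c' * fr_d h' P"
    "fr_z g P = c * fr_z h P + c' * fr_z h' P"
    using fr_cong[of U P g "\<lambda>Q. c * h Q + c' * h' Q"] U P g
      fr_add[OF s P] fr_cmult[OF h(1) P] fr_cmult[OF h(2) P] by simp_all
qed

lemma fr_zero:
  assumes "open U" "P \<in> U" "\<forall>Q\<in>U. g Q = 0"
  shows "fr_a g P = 0" "fr_b g P = 0" "fr_c g P = 0" "fr_d g P = 0" "fr_z g P = 0"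
  using fr_lin[of U "\<lambda>Q. 0" "\<lambda>Q. 0" P g 0 0] assms smooth_const[OF assms(1), of 0] by auto

lemma constant_if_fr_zero:
  fixes f :: "'k::real_or_complex ^ 5 \<Rightarrow> 'k"
  assumes U: "open U" "connected U" and f: "smooth_on U f"
    and zero: "\<And>P. P \<in> U \<Longrightarrow> fr_a f P = 0 \<and> fr_b f P = 0 \<and> fr_c f P = 0 \<and> fr_d f P = 0 \<and> fr_z f P = 0"
  shows "\<exists>c. \<forall>P\<in>U. f P = c"
proof (rule constant_if_partials_zero[OF U f])
  fix i P assume P: "P \<in> U"
  have "partial 3 f P = 0" using zero[OF P] by (simp add: fr_z_def)
  moreover have "4 * partial 4 f P = 0"
    using zero[OF P] unfolding fr_a_def by (metis add_0_left mult_zero_right)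
  ultimately have "partial 1 f P = 0 \<and> partial 2 f P = 0 \<and> partial 3 f P = 0 \<and>
      partial 4 f P = 0 \<and> partial 5 f P = 0"
    using zero[OF P] by (simp add: fr_b_def fr_c_def fr_d_def)
  then show "partial i f P = 0" using exhaust_5[of i] by auto
qed

lemma det_eqs_smooth: "det_eqs U f \<Longrightarrow> smooth_on U f"
  by (simp add: det_eqs_def)

lemma det_eqs_lin:
  assumes U: "open U" and f: "det_eqs U f" and g: "det_eqs U g"
  shows "det_eqs U (\<lambda>P. c * f P + c' * g P)"
proof -
  let ?h = "\<lambda>P. c * f P + c' * g P"
  note sf = det_eqs_smooth[OF f] and sg = det_eqs_smooth[OF g]
  note s = smooth_fr[OF U sf] smooth_fr[OF U sg]
  have h: "\<forall>Q\<in>U. ?h Q = c * f Q + c' * g Q" by simp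
  note one = fr_lin[OF U sf sg _ h]
  have 1: "\<forall>Q\<in>U. fr_a ?h Q = c * fr_a f Q + c' * fr_a g Q" using one(1) by blast
  have 2: "\<forall>Q\<in>U. fr_b ?h Q = c * fr_b f Q + c' * fr_b g Q" using one(2) by blast
  have 3: "\<forall>Q\<in>U. fr_c ?h Q = c * fr_c f Q + c' * fr_c g Q" using one(3) by blast
  have 4: "\<forall>Q\<in>U. fr_d ?h Q = c * fr_d f Q + c' * fr_d g Q" using one(4) by blast
  have *: "fr_a (fr_a ?h) P = c * fr_a (fr_a f) P + c' * fr_a (fr_a g) P"
    "fr_a (fr_b ?h) P = c * fr_a (fr_b f) P + c' * fr_a (fr_b g) P"
    "fr_d (fr_d ?h) P = c * fr_d (fr_d f) P + c' * fr_d (fr_d g) P"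
    "fr_c (fr_d ?h) P = c * fr_c (fr_d f) P + c' * fr_c (fr_d g) P"
    "fr_b (fr_b ?h) P = c * fr_b (fr_b f) P + c' * fr_b (fr_b g) P"
    "fr_a (fr_c ?h) P = c * fr_a (fr_c f) P + c' * fr_a (fr_c g) P"
    "fr_c (fr_c ?h) P = c * fr_c (fr_c f) P + c' * fr_c (fr_c g) P"
    "fr_b (fr_d ?h) P = c * fr_b (fr_d f) P + c' * fr_b (fr_d g) P"
    "fr_b (fr_c ?h) P = c * fr_b (fr_c f) P + c' * fr_b (fr_c g) P"
    "fr_a (fr_d ?h) P = c * fr_a (fr_d f) P + c' * fr_a (fr_d g) P" if "P \<in> U" for P
    by (intro fr_lin[OF U s(1,6) that 1] fr_lin[OF U s(2,7) that 2] fr_lin[OF U s(3,8) that 3]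
        fr_lin[OF U s(4,9) that 4])+
  have "fr_a (fr_a ?h) P = 0 \<and> fr_a (fr_b ?h) P = 0 \<and>
     fr_d (fr_d ?h) P = 0 \<and> fr_c (fr_d ?h) P = 0 \<and> 3 * fr_b (fr_b ?h) P = - 4 * fr_a (fr_c ?h) P \<and>
     4 * fr_c (fr_c ?h) P = - fr_b (fr_d ?h) P \<and>
     12 * fr_b (fr_c ?h) P = - fr_a (fr_d ?h) P - 4 * fr_z ?h P" if P: "P \<in> U" for P
  proof -
    from f P have F: "fr_a (fr_a f) P = 0" "fr_a (fr_b f) P = 0" "fr_d (fr_d f) P = 0" "fr_c (fr_d f) P = 0"
      "3 * fr_b (fr_b f) P = - 4 * fr_a (fr_c f) P" "4 * fr_c (fr_c f) P = - fr_b (fr_d f) P"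
      "12 * fr_b (fr_c f) P = - fr_a (fr_d f) P - 4 * fr_z f P" by (simp_all add: det_eqs_def)
    from g P have G: "fr_a (fr_a g) P = 0" "fr_a (fr_b g) P = 0" "fr_d (fr_d g) P = 0" "fr_c (fr_d g) P = 0"
      "3 * fr_b (fr_b g) P = - 4 * fr_a (fr_c g) P" "4 * fr_c (fr_c g) P = - fr_b (fr_d g) P"
      "12 * fr_b (fr_c g) P = - fr_a (fr_d g) P - 4 * fr_z g P" by (simp_all add: det_eqs_def)
    have r: "k * (c * s + c' * t) = c * (k * s) + c' * (k * t)" for k s t
      by (simp add: algebra_simps)
    show ?thesis
      unfolding *[OF P] one(5)[OF P] F(1-4) G(1-4) r F(5-7) G(5-7)
      by (simp add: algebra_simps)
  qed
  moreover have "smooth_on U ?h" by (intro smooth_intros U sf sg)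
  ultimately show ?thesis by (simp add: det_eqs_def)
qed

context
  fixes U and f :: "'k::real_or_complex ^ 5 \<Rightarrow> 'k"
  assumes U: "open U" and f: "det_eqs U f"
begin

private lemma
  assumes "P \<in> U"
  shows aa: "fr_a (fr_a f) P = 0" and ab: "fr_a (fr_b f) P = 0"
    and dd: "fr_d (fr_d f) P = 0" and cd: "fr_c (fr_d f) P = 0"
    and bb: "fr_b (fr_b f) P = - 4/3 * fr_a (fr_c f) P"
    and cc: "fr_c (fr_c f) P = - 1/4 * fr_b (fr_d f) P"
    and bc: "fr_b (fr_c f) P = - 1/12 * fr_a (fr_d f) P + - 1/3 * fr_z f P"
proof -
  have e: "3 * fr_b (fr_b f) P = - 4 * fr_a (fr_c f) P" "4 * fr_c (fr_c f) P = - fr_b (fr_d f) P"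
    "12 * fr_b (fr_c f) P = - fr_a (fr_d f) P - 4 * fr_z f P"
    using f assms by (simp_all add: det_eqs_def)
  have "3 * fr_b (fr_b f) P = 3 * (- 4/3 * fr_a (fr_c f) P)"
    "4 * fr_c (fr_c f) P = 4 * (- 1/4 * fr_b (fr_d f) P)"
    "12 * fr_b (fr_c f) P = 12 * (- 1/12 * fr_a (fr_d f) P + - 1/3 * fr_z f P)"
    unfolding e by (simp_all add: algebra_simps)
  then show "fr_b (fr_b f) P = - 4/3 * fr_a (fr_c f) P" "fr_c (fr_c f) P = - 1/4 * fr_b (fr_d f) P"
    "fr_b (fr_c f) P = - 1/12 * fr_a (fr_d f) P + - 1/3 * fr_z f P"
    unfolding mult_cancel_left by simp_all
qed (use f assms in \<open>simp_all add: det_eqs_def\<close>)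

private lemmas sf = det_eqs_smooth[OF f]
private lemmas s1 = smooth_fr[OF U sf]
private lemmas com = fr_commute[OF U]

text \<open>Each operator is moved inwards until it meets a second derivative that the equations
  kill or express. Every exchange within the pairs a, d and b, c leaves a z-derivative, and these
  remainders form the right-hand sides.\<close>

lemma third_derivatives:
  assumes P: "P \<in> U"
  shows "fr_a (fr_a (fr_c f)) P = 0" "fr_b (fr_a (fr_c f)) P = - fr_z (fr_a f) P"
    "fr_c (fr_a (fr_c f)) P = - fr_z (fr_b f) P" "fr_d (fr_a (fr_c f)) P = - 4 * fr_z (fr_c f) P"
    "fr_a (fr_b (fr_d f)) P = 4 * fr_z (fr_b f) P" "fr_b (fr_b (fr_d f)) P = 16/3 * fr_z (fr_c f) P"
    "fr_c (fr_b (fr_d f)) P = fr_z (fr_d f) P" "fr_d (fr_b (fr_d f)) P = 0"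
    "fr_a (fr_a (fr_d f)) P = 8 * fr_z (fr_a f) P" "fr_b (fr_a (fr_d f)) P = 4 * fr_z (fr_b f) P"
    "fr_c (fr_a (fr_d f)) P = 0" "fr_d (fr_a (fr_d f)) P = - 4 * fr_z (fr_d f) P"
proof -
  note sa = s1(1) and sb = s1(2) and sc = s1(3) and sd = s1(4) and sz = s1(5)
  note z = fr_zero[OF U P]
  have "fr_a (fr_a (fr_c f)) P = fr_a (fr_c (fr_a f)) P"
    by (rule fr_cong(1)[OF U P]) (simp add: com(2)[OF sf])
  also have "\<dots> = fr_c (fr_a (fr_a f)) P" using com(2)[OF sa P] by simp
  also have "\<dots> = 0" by (rule z(3)) (simp add: aa)
  finally show "fr_a (fr_a (fr_c f)) P = 0" .
  have "fr_a (fr_a (fr_d f)) P = 1 * fr_a (fr_d (fr_a f)) P + 4 * fr_a (fr_z f) P"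
    by (rule fr_lin(1)[OF U _ sz P]) (auto simp: com(3)[OF sf] intro: smooth_fr U sa)
  moreover have "fr_a (fr_d (fr_a f)) P = fr_d (fr_a (fr_a f)) P + 4 * fr_z (fr_a f) P"
    using com(3)[OF sa P] by simp
  moreover have "fr_d (fr_a (fr_a f)) P = 0" by (rule z(4)) (simp add: aa)
  ultimately show aad: "fr_a (fr_a (fr_d f)) P = 8 * fr_z (fr_a f) P"
    using com(7)[OF sf P] by simp
  have "fr_b (fr_a (fr_c f)) P = fr_a (fr_b (fr_c f)) P" using com(1)[OF sc P] .
  also have "\<dots> = - 1/12 * fr_a (fr_a (fr_d f)) P + - 1/3 * fr_a (fr_z f) P"
    by (rule fr_lin(1)[OF U _ sz P]) (auto simp: bc intro: smooth_fr U sd)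
  finally show "fr_b (fr_a (fr_c f)) P = - fr_z (fr_a f) P"
    using aad com(7)[OF sf P] by (simp add: field_simps)
  have abd: "fr_a (fr_b (fr_d f)) P = 4 * fr_z (fr_b f) P"
  proof -
    have "fr_a (fr_b (fr_d f)) P = fr_a (fr_d (fr_b f)) P"
      by (rule fr_cong(1)[OF U P]) (simp add: com(5)[OF sf])
    also have "\<dots> = fr_d (fr_a (fr_b f)) P + 4 * fr_z (fr_b f) P"
      using com(3)[OF sb P] by simp
    also have "fr_d (fr_a (fr_b f)) P = 0" by (rule z(4)) (simp add: ab)
    finally show ?thesis by simp
  qed
  then show "fr_a (fr_b (fr_d f)) P = 4 * fr_z (fr_b f) P" .
  then show "fr_b (fr_a (fr_d f)) P = 4 * fr_z (fr_b f) P" using com(1)[OF sd P] by simp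
  have "fr_c (fr_a (fr_c f)) P = fr_a (fr_c (fr_c f)) P" using com(2)[OF sc P] .
  also have "\<dots> = - 1/4 * fr_a (fr_b (fr_d f)) P + 0 * fr_a f P"
    by (rule fr_lin(1)[OF U _ sf P]) (auto simp: cc intro: smooth_fr U sd)
  finally show "fr_c (fr_a (fr_c f)) P = - fr_z (fr_b f) P" using abd by simp
  have "fr_a (fr_d (fr_c f)) P = 0" by (rule z(1)) (simp add: com(6)[OF sf] cd)
  then show dac: "fr_d (fr_a (fr_c f)) P = - 4 * fr_z (fr_c f) P"
    using com(3)[OF sc P] by simp
  have "fr_b (fr_b (fr_d f)) P = fr_b (fr_d (fr_b f)) P"
    by (rule fr_cong(2)[OF U P]) (simp add: com(5)[OF sf])
  also have "\<dots> = fr_d (fr_b (fr_b f)) P" using com(5)[OF sb P] by simp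
  also have "\<dots> = - 4/3 * fr_d (fr_a (fr_c f)) P + 0 * fr_d f P"
    by (rule fr_lin(4)[OF U _ sf P]) (auto simp: bb intro: smooth_fr U sc)
  finally show "fr_b (fr_b (fr_d f)) P = 16/3 * fr_z (fr_c f) P" using dac by simp
  have "fr_b (fr_c (fr_d f)) P = 0" by (rule z(2)) (simp add: cd)
  then show "fr_c (fr_b (fr_d f)) P = fr_z (fr_d f) P" using com(4)[OF sd P] by simp
  have "fr_b (fr_d (fr_d f)) P = 0" by (rule z(2)) (simp add: dd)
  then show "fr_d (fr_b (fr_d f)) P = 0" using com(5)[OF sd P] by simp
  have "fr_a (fr_c (fr_d f)) P = 0" by (rule z(1)) (simp add: cd)
  then show "fr_c (fr_a (fr_d f)) P = 0" using com(2)[OF sd P] by simp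
  have "fr_a (fr_d (fr_d f)) P = 0" by (rule z(1)) (simp add: dd)
  then show "fr_d (fr_a (fr_d f)) P = - 4 * fr_z (fr_d f) P" using com(3)[OF sd P] by simp
qed

lemma fr_fr_z:
  assumes P: "P \<in> U"
  shows "fr_a (fr_a (fr_z f)) P = fr_z (fr_a (fr_a f)) P" "fr_a (fr_b (fr_z f)) P = fr_z (fr_a (fr_b f)) P"
    "fr_a (fr_c (fr_z f)) P = fr_z (fr_a (fr_c f)) P" "fr_a (fr_d (fr_z f)) P = fr_z (fr_a (fr_d f)) P"
    "fr_b (fr_b (fr_z f)) P = fr_z (fr_b (fr_b f)) P" "fr_b (fr_c (fr_z f)) P = fr_z (fr_b (fr_c f)) P"
    "fr_b (fr_d (fr_z f)) P = fr_z (fr_b (fr_d f)) P" "fr_c (fr_c (fr_z f)) P = fr_z (fr_c (fr_c f)) P"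
    "fr_c (fr_d (fr_z f)) P = fr_z (fr_c (fr_d f)) P" "fr_d (fr_d (fr_z f)) P = fr_z (fr_d (fr_d f)) P"
  using fr_cong[OF U P com(7)[OF sf]] fr_cong[OF U P com(8)[OF sf]] fr_cong[OF U P com(9)[OF sf]]
    fr_cong[OF U P com(10)[OF sf]] com(7-10)[OF s1(1) P] com(7-10)[OF s1(2) P] com(7-10)[OF s1(3) P]
    com(7-10)[OF s1(4) P]
  by simp_all

text \<open>\<open>fr_z\<close> commutes with the whole frame and the equations have constant
  coefficients. All consequences drawn for f thus hold for its z-derivative too.\<close>

lemma det_eqs_fr_z: "det_eqs U (fr_z f)"
proof -
  have "fr_a (fr_a (fr_z f)) P = 0 \<and> fr_a (fr_b (fr_z f)) P = 0 \<and>
     fr_d (fr_d (fr_z f)) P = 0 \<and> fr_c (fr_d (fr_z f)) P = 0 \<and>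
     3 * fr_b (fr_b (fr_z f)) P = - 4 * fr_a (fr_c (fr_z f)) P \<and>
     4 * fr_c (fr_c (fr_z f)) P = - fr_b (fr_d (fr_z f)) P \<and>
     12 * fr_b (fr_c (fr_z f)) P = - fr_a (fr_d (fr_z f)) P - 4 * fr_z (fr_z f) P" if P: "P \<in> U" for P
  proof -
    have "fr_z (fr_a (fr_a f)) P = 0" "fr_z (fr_a (fr_b f)) P = 0"
      "fr_z (fr_d (fr_d f)) P = 0" "fr_z (fr_c (fr_d f)) P = 0"
      by (rule fr_zero(5)[OF U P], simp add: aa ab cd dd)+
    moreover have "fr_z (fr_b (fr_b f)) P = - 4/3 * fr_z (fr_a (fr_c f)) P + 0 * fr_z f P"
      by (rule fr_lin(5)[OF U _ sf P]) (auto simp: bb intro: smooth_fr U s1)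
    moreover have "fr_z (fr_c (fr_c f)) P = - 1/4 * fr_z (fr_b (fr_d f)) P + 0 * fr_z f P"
      by (rule fr_lin(5)[OF U _ sf P]) (auto simp: cc intro: smooth_fr U s1)
    moreover have "fr_z (fr_b (fr_c f)) P = - 1/12 * fr_z (fr_a (fr_d f)) P + - 1/3 * fr_z (fr_z f) P"
      by (rule fr_lin(5)[OF U _ s1(5) P]) (auto simp: bc intro: smooth_fr U s1)
    ultimately show ?thesis by (simp add: fr_fr_z[OF P])
  qed
  then show ?thesis using s1(5) by (simp add: det_eqs_def)
qed

text \<open>The commutators of the frame, applied to the second derivatives of \<open>f\<close>, yield further
  equations, of fourth order.\<close>

lemma fourth_derivatives:
  assumes P: "P \<in> U"
  shows "fr_z (fr_a (fr_c f)) P = 0" "fr_z (fr_b (fr_d f)) P = 0"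
    "fr_z (fr_a (fr_d f)) P = 2 * fr_z (fr_z f) P"
proof -
  note s2a = smooth_fr[OF U s1(3)] and s2d = smooth_fr[OF U s1(4)]
  \<comment> \<open>With Z the left-hand side of the claim, the commutator of b and c on
    \<open>fr_a (fr_c f)\<close> gives -Z = 4/3 Z + Z.\<close>
  have "fr_c (fr_b (fr_a (fr_c f))) P = - 1 * fr_c (fr_z (fr_a f)) P + 0 * fr_c f P"
    by (rule fr_lin(3)[OF U _ sf P]) (auto simp: third_derivatives(2) intro: smooth_fr U s1)
  moreover have "fr_c (fr_z (fr_a f)) P = fr_z (fr_a (fr_c f)) P"
    using com(9)[OF s1(1) P] fr_cong(5)[OF U P com(2)[OF sf]] by simp
  moreover have "fr_b (fr_c (fr_a (fr_c f))) P = - 1 * fr_b (fr_z (fr_b f)) P + 0 * fr_b f P"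
    by (rule fr_lin(2)[OF U _ sf P]) (auto simp: third_derivatives(3) intro: smooth_fr U s1)
  moreover have "fr_b (fr_z (fr_b f)) P = fr_z (fr_b (fr_b f)) P"
    using com(8)[OF s1(2) P] .
  moreover have "fr_z (fr_b (fr_b f)) P = - 4/3 * fr_z (fr_a (fr_c f)) P + 0 * fr_z f P"
    by (rule fr_lin(5)[OF U _ sf P]) (auto simp: bb intro: smooth_fr U s1)
  moreover have "fr_c (fr_b (fr_a (fr_c f))) P = fr_b (fr_c (fr_a (fr_c f))) P + fr_z (fr_a (fr_c f)) P"
    by (rule com(4)[OF s2a(1) P])
  ultimately show "fr_z (fr_a (fr_c f)) P = 0" by (simp add: field_simps)
  \<comment> \<open>The same commutator on \<open>fr_b (fr_d f)\<close> gives -4/3 Z = Z + Z for Z =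
    \<open>fr_z (fr_b (fr_d f)) P\<close>.\<close>
  have "fr_b (fr_c (fr_b (fr_d f))) P = 1 * fr_b (fr_z (fr_d f)) P + 0 * fr_b f P"
    by (rule fr_lin(2)[OF U _ sf P]) (auto simp: third_derivatives(7) intro: smooth_fr U s1)
  moreover have "fr_b (fr_z (fr_d f)) P = fr_z (fr_b (fr_d f)) P"
    using com(8)[OF s1(4) P] .
  moreover have "fr_c (fr_b (fr_b (fr_d f))) P = 16/3 * fr_c (fr_z (fr_c f)) P + 0 * fr_c f P"
    by (rule fr_lin(3)[OF U _ sf P]) (auto simp: third_derivatives(6) intro: smooth_fr U s1)
  moreover have "fr_c (fr_z (fr_c f)) P = fr_z (fr_c (fr_c f)) P"
    using com(9)[OF s1(3) P] .
  moreover have "fr_z (fr_c (fr_c f)) P = - 1/4 * fr_z (fr_b (fr_d f)) P + 0 * fr_z f P"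
    by (rule fr_lin(5)[OF U _ sf P]) (auto simp: cc intro: smooth_fr U s1)
  moreover have "fr_c (fr_b (fr_b (fr_d f))) P = fr_b (fr_c (fr_b (fr_d f))) P + fr_z (fr_b (fr_d f)) P"
    by (rule com(4)[OF s2d(2) P])
  ultimately show "fr_z (fr_b (fr_d f)) P = 0" by (simp add: field_simps)
  \<comment> \<open>The commutator of a and d on \<open>fr_a (fr_d f)\<close> gives 8 (Z - 4 W) = -4
    Z - 4 Z, where Z = \<open>fr_z (fr_a (fr_d f)) P\<close> and W =
    \<open>fr_z (fr_z f) P\<close>.\<close>
  have "fr_a (fr_d (fr_a (fr_d f))) P = - 4 * fr_a (fr_z (fr_d f)) P + 0 * fr_a f P"
    by (rule fr_lin(1)[OF U _ sf P]) (auto simp: third_derivatives(12) intro: smooth_fr U s1)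
  moreover have "fr_a (fr_z (fr_d f)) P = fr_z (fr_a (fr_d f)) P"
    using com(7)[OF s1(4) P] .
  moreover have "fr_d (fr_a (fr_a (fr_d f))) P = 8 * fr_d (fr_z (fr_a f)) P + 0 * fr_d f P"
    by (rule fr_lin(4)[OF U _ sf P]) (auto simp: third_derivatives(9) intro: smooth_fr U s1)
  moreover have "fr_d (fr_z (fr_a f)) P = fr_z (fr_d (fr_a f)) P"
    using com(10)[OF s1(1) P] .
  moreover have "fr_z (fr_d (fr_a f)) P = 1 * fr_z (fr_a (fr_d f)) P + - 4 * fr_z (fr_z f) P"
    by (rule fr_lin(5)[OF U _ s1(5) P]) (auto simp: com(3)[OF sf] intro: smooth_fr U s1)
  moreover have "fr_d (fr_a (fr_a (fr_d f))) P = fr_a (fr_d (fr_a (fr_d f))) P - 4 * fr_z (fr_a (fr_d f)) P"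
    by (rule com(3)[OF s2d(1) P])
  ultimately have "16 * fr_z (fr_a (fr_d f)) P = 16 * (2 * fr_z (fr_z f) P)"
    by algebra
  then show "fr_z (fr_a (fr_d f)) P = 2 * fr_z (fr_z f) P" by simp
qed

end

text \<open>For \<open>fr_z f\<close> in place of f, the derivatives ac and bd vanish identically by
  \<open>fourth_derivatives\<close>. Differentiating them once more and comparing with
  \<open>third_derivatives\<close> kills the first four expressions.\<close>

lemma fifth_derivatives:
  assumes U: "open U" and f: "det_eqs U f" and P: "P \<in> U"
  shows "fr_a (fr_z (fr_z f)) P = 0" "fr_b (fr_z (fr_z f)) P = 0" "fr_c (fr_z (fr_z f)) P = 0"
    "fr_d (fr_z (fr_z f)) P = 0" "fr_z (fr_z (fr_z f)) P = 0"
proof -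
  let ?g = "fr_z f"
  note g = det_eqs_fr_z[OF U f]
  note sg = det_eqs_smooth[OF g]
  have ac: "\<forall>Q\<in>U. fr_a (fr_c ?g) Q = 0" and bd: "\<forall>Q\<in>U. fr_b (fr_d ?g) Q = 0"
    using fr_fr_z(3,7)[OF U f] fourth_derivatives(1,2)[OF U f] by auto
  have 1: "fr_a (fr_z ?g) Q = 0" "fr_b (fr_z ?g) Q = 0" "fr_c (fr_z ?g) Q = 0"
    "fr_d (fr_z ?g) Q = 0" if Q: "Q \<in> U" for Q
    using third_derivatives(2,3,4,7)[OF U g Q] fr_zero[OF U Q ac] fr_zero[OF U Q bd]
      fr_commute(7-10)[OF U sg Q] by simp_all
  then have "\<forall>Q\<in>U. fr_a (fr_z ?g) Q = 0" "\<forall>Q\<in>U. fr_d (fr_z ?g) Q = 0" by auto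
  \<comment> \<open>The last one is a quarter of the commutator of a and d on
    \<open>fr_z ?g\<close>, whose a- and d-derivatives vanish.\<close>
  from fr_zero(4)[OF U P this(1)] fr_zero(1)[OF U P this(2)]
  have "fr_z (fr_z ?g) P = 0"
    using fr_commute(3)[OF U smooth_fr(5)[OF U sg] P] by simp
  with 1[OF P] show "fr_a (fr_z (fr_z f)) P = 0" "fr_b (fr_z (fr_z f)) P = 0" "fr_c (fr_z (fr_z f)) P = 0"
    "fr_d (fr_z (fr_z f)) P = 0" "fr_z (fr_z (fr_z f)) P = 0" by simp_all
qed

section \<open>The Hamiltonians of the fourteen fields\<close>

lemma
  assumes "smooth_on U f" "smooth_on U g" "P \<in> U"
  shows fr_diff: "fr_a (\<lambda>Q. f Q - g Q) P = fr_a f P - fr_a g P"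
    "fr_b (\<lambda>Q. f Q - g Q) P = fr_b f P - fr_b g P"
    "fr_c (\<lambda>Q. f Q - g Q) P = fr_c f P - fr_c g P"
    "fr_d (\<lambda>Q. f Q - g Q) P = fr_d f P - fr_d g P"
    "fr_z (\<lambda>Q. f Q - g Q) P = fr_z f P - fr_z g P"
  and fr_mult: "fr_a (\<lambda>Q. f Q * g Q) P = fr_a f P * g P + f P * fr_a g P"
    "fr_b (\<lambda>Q. f Q * g Q) P = fr_b f P * g P + f P * fr_b g P"
    "fr_c (\<lambda>Q. f Q * g Q) P = fr_c f P * g P + f P * fr_c g P"
    "fr_d (\<lambda>Q. f Q * g Q) P = fr_d f P * g P + f P * fr_d g P"
    "fr_z (\<lambda>Q. f Q * g Q) P = fr_z f P * g P + f P * fr_z g P"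
  unfolding fr_defs partial_diff[OF assms] partial_mult[OF assms] by (simp_all add: algebra_simps)

lemma fr_minus:
  assumes "smooth_on U f" "P \<in> U"
  shows "fr_a (\<lambda>Q. - f Q) P = - fr_a f P" "fr_b (\<lambda>Q. - f Q) P = - fr_b f P"
    "fr_c (\<lambda>Q. - f Q) P = - fr_c f P" "fr_d (\<lambda>Q. - f Q) P = - fr_d f P"
    "fr_z (\<lambda>Q. - f Q) P = - fr_z f P"
  unfolding fr_defs partial_minus[OF assms] by (simp_all add: algebra_simps)

lemma fr_divide:
  assumes "smooth_on U f" "P \<in> U"
  shows "fr_a (\<lambda>Q. f Q / c) P = fr_a f P / c" "fr_b (\<lambda>Q. f Q / c) P = fr_b f P / c"
    "fr_c (\<lambda>Q. f Q / c) P = fr_c f P / c" "fr_d (\<lambda>Q. f Q / c) P = fr_d f P / c"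
    "fr_z (\<lambda>Q. f Q / c) P = fr_z f P / c"
  using fr_cmult[OF assms, of "1 / c"] by simp_all

lemma fr_const:
  "fr_a (\<lambda>Q. c) P = 0" "fr_b (\<lambda>Q. c) P = 0" "fr_c (\<lambda>Q. c) P = 0" "fr_d (\<lambda>Q. c) P = 0"
  "fr_z (\<lambda>Q. c) P = 0"
  by (simp_all add: fr_defs partial_const)

lemma fr_coord:
  "fr_a (\<lambda>Q. Q $ j) P = (if j = 1 then 3 else if j = 3 then 3 * P $ 4 else if j = 4 then 4 else 0)"
  "fr_b (\<lambda>Q. Q $ j) P = (if j = 2 then 1 else if j = 3 then P $ 5 else 0)"
  "fr_c (\<lambda>Q. Q $ j) P = (if j = 5 then 1 else 0)"
  "fr_d (\<lambda>Q. Q $ j) P = (if j = 1 then 1 else if j = 3 then P $ 4 else 0)"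
  "fr_z (\<lambda>Q. Q $ j) P = (if j = 3 then 1 else 0)"
  by (auto simp: fr_defs partial_coord)

lemma partial_power:
  assumes "smooth_on U f" "P \<in> U"
  shows "partial i (\<lambda>Q. f Q ^ n) P = of_nat n * (partial i f P * f P ^ (n - Suc 0))"
  by (rule has_partial_imp_partial[OF has_partial_power[OF smooth_has_partial[OF assms]]])

lemma fr_power:
  assumes "smooth_on U f" "P \<in> U"
  shows "fr_a (\<lambda>Q. f Q ^ n) P = of_nat n * (fr_a f P * f P ^ (n - Suc 0))"
    "fr_b (\<lambda>Q. f Q ^ n) P = of_nat n * (fr_b f P * f P ^ (n - Suc 0))"
    "fr_c (\<lambda>Q. f Q ^ n) P = of_nat n * (fr_c f P * f P ^ (n - Suc 0))"
    "fr_d (\<lambda>Q. f Q ^ n) P = of_nat n * (fr_d f P * f P ^ (n - Suc 0))"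
    "fr_z (\<lambda>Q. f Q ^ n) P = of_nat n * (fr_z f P * f P ^ (n - Suc 0))"
  unfolding fr_defs partial_power[OF assms] by (simp_all add: algebra_simps)

lemma smooth_divide: "open U \<Longrightarrow> smooth_on U f \<Longrightarrow> smooth_on U (\<lambda>Q. f Q / c)"
  using smooth_mult[OF _ smooth_const, of U f "1 / c"] by simp

lemmas smooth_polynomial =
  smooth_const[OF open_UNIV] smooth_coord[OF open_UNIV] smooth_add[OF open_UNIV]
  smooth_diff[OF open_UNIV] smooth_minus[OF open_UNIV] smooth_mult[OF open_UNIV]
  smooth_power[OF open_UNIV] smooth_divide[OF open_UNIV]

lemmas fr_polynomial =
  fr_const fr_coord fr_add[of UNIV] fr_diff[of UNIV] fr_minus[of UNIV] fr_mult[of UNIV]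
  fr_power[of UNIV] fr_divide[of UNIV] smooth_polynomial

lemmas polynomial_simps = field_simps power2_eq_square power3_eq_cube power4_eq_xxxx

text \<open>This polynomial and the next twelve are the values of \<open>contact_form\<close> on the
  given fields, expanded; \<open>ham_H\<close> confirms them.\<close>

definition H_S1 :: "'k::real_or_complex ^ 5 \<Rightarrow> 'k" where
  "H_S1 = (\<lambda>P. 8*P$1*P$2^2 - 3*P$1*P$4*P$5 - 6*P$2^2*P$4 - 2*P$2*P$5^2 + 3*P$3*P$5 + 9/8*P$4^2*P$5)"

definition H_L2 :: "'k::real_or_complex ^ 5 \<Rightarrow> 'k" where
  "H_L2 = (\<lambda>P. 2*P$1^2*P$4 - 2*P$1*P$3 - 9/4*P$1*P$4^2 + 3/2*P$3*P$4 + 9/16*P$4^3 + 1/12*P$5^3)"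

definition H_S3 :: "'k::real_or_complex ^ 5 \<Rightarrow> 'k" where
  "H_S3 = (\<lambda>P. - 2*P$1*P$2 + 3/2*P$2*P$4 + 1/4*P$5^2)"

definition H_L4 :: "'k::real_or_complex ^ 5 \<Rightarrow> 'k" where
  "H_L4 = (\<lambda>P. P$1 - 3/4*P$4)"

definition H_S5 :: "'k::real_or_complex ^ 5 \<Rightarrow> 'k" where
  "H_S5 = (\<lambda>P. - (P$5))"

definition H_L6 :: "'k::real_or_complex ^ 5 \<Rightarrow> 'k" where
  "H_L6 = (\<lambda>P. 1)"

definition H_S7 :: "'k::real_or_complex ^ 5 \<Rightarrow> 'k" where
  "H_S7 = (\<lambda>P. P$2)"

definition H_L8 :: "'k::real_or_complex ^ 5 \<Rightarrow> 'k" where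
  "H_L8 = (\<lambda>P. - (P$4))"

definition H_S9 :: "'k::real_or_complex ^ 5 \<Rightarrow> 'k" where
  "H_S9 = (\<lambda>P. 2*P$2^2 - 3/4*P$4*P$5)"

definition H_L10 :: "'k::real_or_complex ^ 5 \<Rightarrow> 'k" where
  "H_L10 = (\<lambda>P. 2/3*P$2^3 - 3/4*P$2*P$4*P$5 + 3/4*P$3*P$4 - 9/32*P$4^3)"

definition H_S11 :: "'k::real_or_complex ^ 5 \<Rightarrow> 'k" where
  "H_S11 = (\<lambda>P. - (P$2^2*P$5) + 3*P$2*P$3 - 9/8*P$2*P$4^2 - 3/8*P$4*P$5^2)"

definition H_L12 :: "'k::real_or_complex ^ 5 \<Rightarrow> 'k" where
  "H_L12 = (\<lambda>P. - 8/3*P$1*P$2^3 + 3*P$1*P$2*P$4*P$5 - 3*P$1*P$3*P$4 + 9/8*P$1*P$4^3 + 2*P$2^3*P$4 + P$2^2*P$5^2 - 3*P$2*P$3*P$5 - 9/8*P$2*P$4^2*P$5 + 3*P$3^2 - 27/64*P$4^4 - 1/8*P$4*P$5^3)"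

definition H_h1 :: "'k::real_or_complex ^ 5 \<Rightarrow> 'k" where
  "H_h1 = (\<lambda>P. - 3/2*P$1*P$4 + 1/2*P$2*P$5 + 9/8*P$4^2)"

text \<open>Hamiltonian of the weighted Euler field. The field \<open>h2\<close> is its multiple by
  sqrt 3 / 2; leaving that factor out keeps all coefficients rational.\<close>

definition H_E2 :: "'k::real_or_complex ^ 5 \<Rightarrow> 'k" where
  "H_E2 = (\<lambda>P. - (P$1*P$4) - P$2*P$5 + 2*P$3)"

lemma fr_H_S1:
  "fr_a H_S1 = (\<lambda>P. - 12*P$1*P$5 + 9*P$4*P$5)"
  "fr_b H_S1 = (\<lambda>P. 16*P$1*P$2 - 12*P$2*P$4 + P$5^2)"
  "fr_c H_S1 = (\<lambda>P. - 3*P$1*P$4 - 4*P$2*P$5 + 3*P$3 + 9/8*P$4^2)"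
  "fr_d H_S1 = (\<lambda>P. 8*P$2^2)"
  "fr_z H_S1 = (\<lambda>P. 3*P$5)"
  by (rule ext, simp add: H_S1_def fr_polynomial polynomial_simps)+

lemma fr_H_L2:
  "fr_a H_L2 = (\<lambda>P. 8*P$1^2 - 12*P$1*P$4 + 9/2*P$4^2)"
  "fr_b H_L2 = (\<lambda>P. - 2*P$1*P$5 + 3/2*P$4*P$5)"
  "fr_c H_L2 = (\<lambda>P. 1/4*P$5^2)"
  "fr_d H_L2 = (\<lambda>P. 2*P$1*P$4 - 2*P$3 - 3/4*P$4^2)"
  "fr_z H_L2 = (\<lambda>P. - 2*P$1 + 3/2*P$4)"
  by (rule ext, simp add: H_L2_def fr_polynomial polynomial_simps)+

lemma fr_H_S3:
  "fr_a H_S3 = (\<lambda>P. 0)"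
  "fr_b H_S3 = (\<lambda>P. - 2*P$1 + 3/2*P$4)"
  "fr_c H_S3 = (\<lambda>P. 1/2*P$5)"
  "fr_d H_S3 = (\<lambda>P. - 2*P$2)"
  "fr_z H_S3 = (\<lambda>P. 0)"
  by (rule ext, simp add: H_S3_def fr_polynomial polynomial_simps)+

lemma fr_H_L4:
  "fr_a H_L4 = (\<lambda>P. 0)"
  "fr_b H_L4 = (\<lambda>P. 0)"
  "fr_c H_L4 = (\<lambda>P. 0)"
  "fr_d H_L4 = (\<lambda>P. 1)"
  "fr_z H_L4 = (\<lambda>P. 0)"
  by (rule ext, simp add: H_L4_def fr_polynomial polynomial_simps)+

lemma fr_H_S5:
  "fr_a H_S5 = (\<lambda>P. 0)"
  "fr_b H_S5 = (\<lambda>P. 0)"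
  "fr_c H_S5 = (\<lambda>P. - (1))"
  "fr_d H_S5 = (\<lambda>P. 0)"
  "fr_z H_S5 = (\<lambda>P. 0)"
  by (rule ext, simp add: H_S5_def fr_polynomial polynomial_simps)+

lemma fr_H_L6:
  "fr_a H_L6 = (\<lambda>P. 0)"
  "fr_b H_L6 = (\<lambda>P. 0)"
  "fr_c H_L6 = (\<lambda>P. 0)"
  "fr_d H_L6 = (\<lambda>P. 0)"
  "fr_z H_L6 = (\<lambda>P. 0)"
  by (rule ext, simp add: H_L6_def fr_polynomial polynomial_simps)+

lemma fr_H_S7:
  "fr_a H_S7 = (\<lambda>P. 0)"
  "fr_b H_S7 = (\<lambda>P. 1)"
  "fr_c H_S7 = (\<lambda>P. 0)"
  "fr_d H_S7 = (\<lambda>P. 0)"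
  "fr_z H_S7 = (\<lambda>P. 0)"
  by (rule ext, simp add: H_S7_def fr_polynomial polynomial_simps)+

lemma fr_H_L8:
  "fr_a H_L8 = (\<lambda>P. - 4)"
  "fr_b H_L8 = (\<lambda>P. 0)"
  "fr_c H_L8 = (\<lambda>P. 0)"
  "fr_d H_L8 = (\<lambda>P. 0)"
  "fr_z H_L8 = (\<lambda>P. 0)"
  by (rule ext, simp add: H_L8_def fr_polynomial polynomial_simps)+

lemma fr_H_S9:
  "fr_a H_S9 = (\<lambda>P. - 3*P$5)"
  "fr_b H_S9 = (\<lambda>P. 4*P$2)"
  "fr_c H_S9 = (\<lambda>P. - 3/4*P$4)"
  "fr_d H_S9 = (\<lambda>P. 0)"
  "fr_z H_S9 = (\<lambda>P. 0)"
  by (rule ext, simp add: H_S9_def fr_polynomial polynomial_simps)+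

lemma fr_H_L10:
  "fr_a H_L10 = (\<lambda>P. - 3*P$2*P$5 + 3*P$3 - 9/8*P$4^2)"
  "fr_b H_L10 = (\<lambda>P. 2*P$2^2)"
  "fr_c H_L10 = (\<lambda>P. - 3/4*P$2*P$4)"
  "fr_d H_L10 = (\<lambda>P. 3/4*P$4^2)"
  "fr_z H_L10 = (\<lambda>P. 3/4*P$4)"
  by (rule ext, simp add: H_L10_def fr_polynomial polynomial_simps)+

lemma fr_H_S11:
  "fr_a H_S11 = (\<lambda>P. - 3/2*P$5^2)"
  "fr_b H_S11 = (\<lambda>P. P$2*P$5 + 3*P$3 - 9/8*P$4^2)"
  "fr_c H_S11 = (\<lambda>P. - (P$2^2) - 3/4*P$4*P$5)"
  "fr_d H_S11 = (\<lambda>P. 3*P$2*P$4)"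
  "fr_z H_S11 = (\<lambda>P. 3*P$2)"
  by (rule ext, simp add: H_S11_def fr_polynomial polynomial_simps)+

lemma fr_H_L12:
  "fr_a H_L12 = (\<lambda>P. 12*P$1*P$2*P$5 - 12*P$1*P$3 + 9/2*P$1*P$4^2 - 9*P$2*P$4*P$5 + 9*P$3*P$4 - 27/8*P$4^3 - 1/2*P$5^3)"
  "fr_b H_L12 = (\<lambda>P. - 8*P$1*P$2^2 + 6*P$2^2*P$4 - P$2*P$5^2 + 3*P$3*P$5 - 9/8*P$4^2*P$5)"
  "fr_c H_L12 = (\<lambda>P. 3*P$1*P$2*P$4 + 2*P$2^2*P$5 - 3*P$2*P$3 - 9/8*P$2*P$4^2 - 3/8*P$4*P$5^2)"
  "fr_d H_L12 = (\<lambda>P. - 3*P$1*P$4^2 - 8/3*P$2^3 + 3*P$3*P$4 + 9/8*P$4^3)"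
  "fr_z H_L12 = (\<lambda>P. - 3*P$1*P$4 - 3*P$2*P$5 + 6*P$3)"
  by (rule ext, simp add: H_L12_def fr_polynomial polynomial_simps)+

lemma fr_H_h1:
  "fr_a H_h1 = (\<lambda>P. - 6*P$1 + 9/2*P$4)"
  "fr_b H_h1 = (\<lambda>P. 1/2*P$5)"
  "fr_c H_h1 = (\<lambda>P. 1/2*P$2)"
  "fr_d H_h1 = (\<lambda>P. - 3/2*P$4)"
  "fr_z H_h1 = (\<lambda>P. 0)"
  by (rule ext, simp add: H_h1_def fr_polynomial polynomial_simps)+

lemma fr_H_E2:
  "fr_a H_E2 = (\<lambda>P. - 4*P$1 + 3*P$4)"
  "fr_b H_E2 = (\<lambda>P. P$5)"
  "fr_c H_E2 = (\<lambda>P. - (P$2))"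
  "fr_d H_E2 = (\<lambda>P. P$4)"
  "fr_z H_E2 = (\<lambda>P. 2)"
  by (rule ext, simp add: H_E2_def fr_polynomial polynomial_simps)+

lemma det_eqs_H:
  "det_eqs UNIV H_S1" "det_eqs UNIV H_L2" "det_eqs UNIV H_S3" "det_eqs UNIV H_L4" "det_eqs UNIV H_S5" "det_eqs UNIV H_L6" "det_eqs UNIV H_S7" "det_eqs UNIV H_L8" "det_eqs UNIV H_S9" "det_eqs UNIV H_L10" "det_eqs UNIV H_S11" "det_eqs UNIV H_L12" "det_eqs UNIV H_h1" "det_eqs UNIV H_E2"
  unfolding det_eqs_def fr_H_S1 fr_H_L2 fr_H_S3 fr_H_L4 fr_H_S5 fr_H_L6 fr_H_S7 fr_H_L8 fr_H_S9 fr_H_L10 fr_H_S11 fr_H_L12 fr_H_h1 fr_H_E2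
  by (simp_all add: H_S1_def H_L2_def H_S3_def H_L4_def H_S5_def H_L6_def H_S7_def H_L8_def H_S9_def H_L10_def H_S11_def H_L12_def H_h1_def H_E2_def fr_polynomial polynomial_simps)

text \<open>Gives the third component through f and the first two, so that the frame derivatives in
  the tables suffice to evaluate a Hamiltonian field.\<close>

lemma ham_nth_3: "ham f P $ 3 = f P + P $ 4 * ham f P $ 1 + P $ 5 * ham f P $ 2"
  by (simp add: ham_def axis_def)

lemma ham_H:
  "ham H_S1 P = S1 P" "ham H_L2 P = L2 P" "ham H_S3 P = S3 P" "ham H_L4 P = L4 P" "ham H_S5 P = S5 P" "ham H_L6 P = L6 P" "ham H_S7 P = S7 P" "ham H_L8 P = L8 P" "ham H_S9 P = S9 P" "ham H_L10 P = L10 P" "ham H_S11 P = S11 P" "ham H_L12 P = L12 P" "ham H_h1 P = h1 P"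
  "of_real (sqrt 3 / 2) *s ham H_E2 P = h2 P"
  unfolding vec_eq_iff forall_5 vector_smult_component ham_nth_3 ham_nth(1,2,4,5) fr_H_S1 S1_def fr_H_L2 L2_def fr_H_S3 S3_def fr_H_L4 L4_def fr_H_S5 S5_def fr_H_L6 L6_def fr_H_S7 S7_def fr_H_L8 L8_def fr_H_S9 S9_def fr_H_L10 L10_def fr_H_S11 S11_def fr_H_L12 L12_def fr_H_h1 h1_def fr_H_E2 h2_def Let_def
  by (simp_all add: axis_def H_S1_def H_L2_def H_S3_def H_L4_def H_S5_def H_L6_def H_S7_def H_L8_def H_S9_def H_L10_def H_S11_def H_L12_def H_h1_def H_E2_def polynomial_simps)

lemma det_eqs_subset: "det_eqs UNIV g \<Longrightarrow> det_eqs U g"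
  by (auto simp: det_eqs_def intro: smooth_on_subset)

section \<open>Solutions of the determining equations, weight by weight\<close>

definition flat :: "('k::real_or_complex ^ 5) set \<Rightarrow> ('k ^ 5 \<Rightarrow> 'k) \<Rightarrow> bool" where
  "flat U f \<longleftrightarrow> (\<forall>P\<in>U. fr_a f P = 0 \<and> fr_b f P = 0 \<and> fr_c f P = 0 \<and> fr_d f P = 0 \<and> fr_z f P = 0)"

context
  fixes U :: "('k::real_or_complex ^ 5) set" and f :: "'k ^ 5 \<Rightarrow> 'k"
  assumes U: "open U" "connected U" and f: "det_eqs U f"
begin

private lemmas smooth_f = det_eqs_smooth[OF f]
private lemmas smooth_fr_f = smooth_fr[OF U(1) smooth_f]
private lemmas commute = fr_commute[OF U(1)]
private lemmas third = third_derivatives[OF U(1) f]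
private lemmas fourth = fourth_derivatives[OF U(1) f]

private lemma second:
  assumes "P \<in> U"
  shows "fr_a (fr_a f) P = 0" "fr_a (fr_b f) P = 0" "fr_d (fr_d f) P = 0" "fr_c (fr_d f) P = 0"
   "3 * fr_b (fr_b f) P = - 4 * fr_a (fr_c f) P" "4 * fr_c (fr_c f) P = - fr_b (fr_d f) P"
   "12 * fr_b (fr_c f) P = - fr_a (fr_d f) P - 4 * fr_z f P"
  using f assms by (simp_all add: det_eqs_def)

private lemma constI: "smooth_on U g \<Longrightarrow> flat U g \<Longrightarrow> \<exists>c. \<forall>P\<in>U. g P = c"
  using constant_if_fr_zero[OF U, of g] unfolding flat_def by blast

private lemma zero5:
  assumes "\<forall>Q\<in>U. g Q = 0" "P \<in> U"
  shows "fr_a g P = 0" "fr_b g P = 0" "fr_c g P = 0" "fr_d g P = 0" "fr_z g P = 0"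
  using fr_zero[OF U(1) assms(2,1)] by blast+

text \<open>In these names each of a, b, c, d has weight 1 and z has weight 2. Once the listed
  functions of the higher weights vanish, all frame derivatives of those of the present weight
  vanish as well.\<close>

lemma weight4_constant: "\<exists>c. \<forall>P\<in>U. fr_z (fr_z f) P = c"
  by (intro constI smooth_fr U smooth_fr_f) (simp add: flat_def fifth_derivatives[OF U(1) f])

text \<open>When zz vanishes, \<open>fourth_derivatives\<close> and the equations for
  \<open>fr_z f\<close> kill all second frame derivatives of \<open>fr_z f\<close>, so its first
  ones are constant.\<close>

lemma weight3_constant:
  assumes zz: "\<forall>P\<in>U. fr_z (fr_z f) P = 0"
  shows "\<exists>c. \<forall>P\<in>U. fr_z (fr_a f) P = c" "\<exists>c. \<forall>P\<in>U. fr_z (fr_b f) P = c"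
    "\<exists>c. \<forall>P\<in>U. fr_z (fr_c f) P = c" "\<exists>c. \<forall>P\<in>U. fr_z (fr_d f) P = c"
proof -
  let ?g = "fr_z f"
  note g = det_eqs_fr_z[OF U(1) f]
  note sg = det_eqs_smooth[OF g]
  note zg = zero5[OF zz]
  have g2: "fr_a (fr_a ?g) P = 0" "fr_a (fr_b ?g) P = 0" "fr_d (fr_d ?g) P = 0" "fr_c (fr_d ?g) P = 0"
   "fr_a (fr_c ?g) P = 0" "fr_b (fr_d ?g) P = 0" "fr_a (fr_d ?g) P = 0"
   "fr_b (fr_b ?g) P = 0" "fr_c (fr_c ?g) P = 0" "fr_b (fr_c ?g) P = 0" if P: "P \<in> U" for P
  proof -
    show 1: "fr_a (fr_c ?g) P = 0" "fr_b (fr_d ?g) P = 0" "fr_a (fr_d ?g) P = 0"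
      using fr_fr_z[OF U(1) f P] fourth[OF P] zz P by simp_all
    show "fr_a (fr_a ?g) P = 0" "fr_a (fr_b ?g) P = 0" "fr_d (fr_d ?g) P = 0" "fr_c (fr_d ?g) P = 0"
      using g P by (simp_all add: det_eqs_def)
    have "3 * fr_b (fr_b ?g) P = - 4 * fr_a (fr_c ?g) P" "4 * fr_c (fr_c ?g) P = - fr_b (fr_d ?g) P"
      "12 * fr_b (fr_c ?g) P = - fr_a (fr_d ?g) P - 4 * fr_z ?g P"
      using g P by (simp_all add: det_eqs_def)
    then show "fr_b (fr_b ?g) P = 0" "fr_c (fr_c ?g) P = 0" "fr_b (fr_c ?g) P = 0"
      using zz P 1 by simp_all
  qed
  have z: "fr_a (fr_z ?g) P = 0" "fr_b (fr_z ?g) P = 0" "fr_c (fr_z ?g) P = 0" "fr_d (fr_z ?g) P = 0"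
    if "P \<in> U" for P using zg[OF that] by blast+
  have "flat U (fr_a ?g)" "flat U (fr_b ?g)" "flat U (fr_c ?g)" "flat U (fr_d ?g)"
    unfolding flat_def using g2 z commute(1-10)[OF sg] zz by simp_all
  then have "\<exists>c. \<forall>P\<in>U. fr_a ?g P = c" "\<exists>c. \<forall>P\<in>U. fr_b ?g P = c"
    "\<exists>c. \<forall>P\<in>U. fr_c ?g P = c" "\<exists>c. \<forall>P\<in>U. fr_d ?g P = c"
    using constI smooth_fr[OF U(1) sg] by blast+
  then show "\<exists>c. \<forall>P\<in>U. fr_z (fr_a f) P = c" "\<exists>c. \<forall>P\<in>U. fr_z (fr_b f) P = c"
    "\<exists>c. \<forall>P\<in>U. fr_z (fr_c f) P = c" "\<exists>c. \<forall>P\<in>U. fr_z (fr_d f) P = c"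
    using commute(7-10)[OF smooth_f] by simp_all
qed

lemma weight2_constant:
  assumes zz: "\<forall>P\<in>U. fr_z (fr_z f) P = 0" and "\<forall>P\<in>U. fr_z (fr_a f) P = 0"
    "\<forall>P\<in>U. fr_z (fr_b f) P = 0" "\<forall>P\<in>U. fr_z (fr_c f) P = 0" "\<forall>P\<in>U. fr_z (fr_d f) P = 0"
  shows "\<exists>c. \<forall>P\<in>U. fr_z f P = c" "\<exists>c. \<forall>P\<in>U. fr_a (fr_c f) P = c"
    "\<exists>c. \<forall>P\<in>U. fr_b (fr_d f) P = c" "\<exists>c. \<forall>P\<in>U. fr_a (fr_d f) P = c"
proof -
  have "flat U (fr_z f)" unfolding flat_def using assms commute(7-10)[OF smooth_f] by simp
  moreover have "flat U (fr_a (fr_c f))" "flat U (fr_b (fr_d f))" "flat U (fr_a (fr_d f))"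
    unfolding flat_def using assms third fourth by simp_all
  ultimately show "\<exists>c. \<forall>P\<in>U. fr_z f P = c" "\<exists>c. \<forall>P\<in>U. fr_a (fr_c f) P = c"
    "\<exists>c. \<forall>P\<in>U. fr_b (fr_d f) P = c" "\<exists>c. \<forall>P\<in>U. fr_a (fr_d f) P = c"
    using constI[OF smooth_fr(5)[OF U(1) smooth_f]] constI[OF smooth_fr(1)[OF U(1) smooth_fr_f(3)]]
      constI[OF smooth_fr(2)[OF U(1) smooth_fr_f(4)]] constI[OF smooth_fr(1)[OF U(1) smooth_fr_f(4)]] by blast+
qed

lemma weight1_constant:
  assumes z: "\<forall>P\<in>U. fr_z f P = 0" and s: "\<forall>P\<in>U. fr_a (fr_c f) P = 0"
    "\<forall>P\<in>U. fr_b (fr_d f) P = 0" "\<forall>P\<in>U. fr_a (fr_d f) P = 0"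
  shows "\<exists>c. \<forall>P\<in>U. fr_a f P = c" "\<exists>c. \<forall>P\<in>U. fr_b f P = c"
    "\<exists>c. \<forall>P\<in>U. fr_c f P = c" "\<exists>c. \<forall>P\<in>U. fr_d f P = c"
proof -
  have "fr_b (fr_b f) P = 0" "fr_c (fr_c f) P = 0" "fr_b (fr_c f) P = 0" if "P \<in> U" for P
    using second(5-7)[OF that] z s that by simp_all
  then have "flat U (fr_a f)" "flat U (fr_b f)" "flat U (fr_c f)" "flat U (fr_d f)"
    unfolding flat_def using z s second commute(1-6)[OF smooth_f] zero5[OF z] commute(7-10)[OF smooth_f, symmetric] by simp_all
  then show "\<exists>c. \<forall>P\<in>U. fr_a f P = c" "\<exists>c. \<forall>P\<in>U. fr_b f P = c"
    "\<exists>c. \<forall>P\<in>U. fr_c f P = c" "\<exists>c. \<forall>P\<in>U. fr_d f P = c"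
    using constI smooth_fr_f by blast+
qed

lemma weight0_constant:
  assumes "\<forall>P\<in>U. fr_a f P = 0" "\<forall>P\<in>U. fr_b f P = 0" "\<forall>P\<in>U. fr_c f P = 0"
    "\<forall>P\<in>U. fr_d f P = 0" "\<forall>P\<in>U. fr_z f P = 0"
  shows "\<exists>c. \<forall>P\<in>U. f P = c"
  using constI[OF smooth_f] assms unfolding flat_def by blast

end

text \<open>These are the thirteen derivatives normalised in \<open>det_eqs_solution\<close>. The
  factor 1 in \<open>g\<close> matches the shape of \<open>det_eqs_lin\<close>.\<close>

lemma fr_subtract:
  fixes f h :: "'k::real_or_complex ^ 5 \<Rightarrow> 'k" and c :: 'k
  assumes U: "open U" and f: "smooth_on U f" and h: "smooth_on U h" and P: "P \<in> U"
  defines "g \<equiv> \<lambda>P. 1 * f P + c * h P"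
  shows "fr_z (fr_z g) P = fr_z (fr_z f) P + c * fr_z (fr_z h) P"
    "fr_z (fr_a g) P = fr_z (fr_a f) P + c * fr_z (fr_a h) P"
    "fr_z (fr_b g) P = fr_z (fr_b f) P + c * fr_z (fr_b h) P"
    "fr_z (fr_c g) P = fr_z (fr_c f) P + c * fr_z (fr_c h) P"
    "fr_z (fr_d g) P = fr_z (fr_d f) P + c * fr_z (fr_d h) P"
    "fr_a (fr_c g) P = fr_a (fr_c f) P + c * fr_a (fr_c h) P"
    "fr_b (fr_d g) P = fr_b (fr_d f) P + c * fr_b (fr_d h) P"
    "fr_a (fr_d g) P = fr_a (fr_d f) P + c * fr_a (fr_d h) P"
    "fr_a g P = fr_a f P + c * fr_a h P" "fr_b g P = fr_b f P + c * fr_b h P"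
    "fr_c g P = fr_c f P + c * fr_c h P" "fr_d g P = fr_d f P + c * fr_d h P"
    "fr_z g P = fr_z f P + c * fr_z h P"
proof -
  have g: "\<forall>Q\<in>U. g Q = 1 * f Q + c * h Q" by (simp add: g_def)
  have 1: "fr_a g Q = 1 * fr_a f Q + c * fr_a h Q" "fr_b g Q = 1 * fr_b f Q + c * fr_b h Q"
    "fr_c g Q = 1 * fr_c f Q + c * fr_c h Q" "fr_d g Q = 1 * fr_d f Q + c * fr_d h Q"
    "fr_z g Q = 1 * fr_z f Q + c * fr_z h Q" if "Q \<in> U" for Q
    using fr_lin[OF U f h that g] by blast+
  note 2 = 1(1)[THEN ballI[of U]] 1(2)[THEN ballI[of U]] 1(3)[THEN ballI[of U]]
    1(4)[THEN ballI[of U]] 1(5)[THEN ballI[of U]]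
  show "fr_a g P = fr_a f P + c * fr_a h P" "fr_b g P = fr_b f P + c * fr_b h P"
    "fr_c g P = fr_c f P + c * fr_c h P" "fr_d g P = fr_d f P + c * fr_d h P"
    "fr_z g P = fr_z f P + c * fr_z h P"
    using 1[OF P] by simp_all
  note s = smooth_fr[OF U f] and t = smooth_fr[OF U h]
  show "fr_z (fr_z g) P = fr_z (fr_z f) P + c * fr_z (fr_z h) P"
    "fr_z (fr_a g) P = fr_z (fr_a f) P + c * fr_z (fr_a h) P"
    "fr_z (fr_b g) P = fr_z (fr_b f) P + c * fr_z (fr_b h) P"
    "fr_z (fr_c g) P = fr_z (fr_c f) P + c * fr_z (fr_c h) P"
    "fr_z (fr_d g) P = fr_z (fr_d f) P + c * fr_z (fr_d h) P"
    "fr_a (fr_c g) P = fr_a (fr_c f) P + c * fr_a (fr_c h) P"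
    "fr_b (fr_d g) P = fr_b (fr_d f) P + c * fr_b (fr_d h) P"
    "fr_a (fr_d g) P = fr_a (fr_d f) P + c * fr_a (fr_d h) P"
    using fr_lin(1,5)[OF U s(1) t(1) P 2(1)] fr_lin(5)[OF U s(2) t(2) P 2(2)]
      fr_lin(1,5)[OF U s(3) t(3) P 2(3)] fr_lin(1,2,5)[OF U s(4) t(4) P 2(4)]
      fr_lin(5)[OF U s(5) t(5) P 2(5)]
    by simp_all
qed

text \<open>The values in these jet lemmas make the normalisation triangular: a Hamiltonian of some
  weight does not disturb the higher weights that must remain zero, and within its own weight it
  changes a single function. The exception is \<open>H_E2\<close>, which changes both z and
  ad.\<close>

lemma jet_H_L12:
  "fr_z (fr_z H_L12) P = 6"
  unfolding fr_H_L12 by (simp_all add: fr_polynomial)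

lemma jet_H_L10:
  "fr_z (fr_z H_L10) P = 0" "fr_z (fr_a H_L10) P = 3" "fr_z (fr_b H_L10) P = 0" "fr_z (fr_c H_L10) P = 0" "fr_z (fr_d H_L10) P = 0"
  unfolding fr_H_L10 by (simp_all add: fr_polynomial)

lemma jet_H_S11:
  "fr_z (fr_z H_S11) P = 0" "fr_z (fr_a H_S11) P = 0" "fr_z (fr_b H_S11) P = 3" "fr_z (fr_c H_S11) P = 0" "fr_z (fr_d H_S11) P = 0"
  unfolding fr_H_S11 by (simp_all add: fr_polynomial)

lemma jet_H_S1:
  "fr_z (fr_z H_S1) P = 0" "fr_z (fr_a H_S1) P = 0" "fr_z (fr_b H_S1) P = 0" "fr_z (fr_c H_S1) P = 3" "fr_z (fr_d H_S1) P = 0"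
  unfolding fr_H_S1 by (simp_all add: fr_polynomial)

lemma jet_H_L2:
  "fr_z (fr_z H_L2) P = 0" "fr_z (fr_a H_L2) P = 0" "fr_z (fr_b H_L2) P = 0" "fr_z (fr_c H_L2) P = 0" "fr_z (fr_d H_L2) P = - 2"
  unfolding fr_H_L2 by (simp_all add: fr_polynomial)

lemma jet_H_S3:
  "fr_z (fr_z H_S3) P = 0" "fr_z (fr_a H_S3) P = 0" "fr_z (fr_b H_S3) P = 0" "fr_z (fr_c H_S3) P = 0" "fr_z (fr_d H_S3) P = 0" "fr_z H_S3 P = 0" "fr_a (fr_c H_S3) P = 0" "fr_b (fr_d H_S3) P = - 2" "fr_a (fr_d H_S3) P = 0"
  unfolding fr_H_S3 by (simp_all add: fr_polynomial)

lemma jet_H_S9: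
  "fr_z (fr_z H_S9) P = 0" "fr_z (fr_a H_S9) P = 0" "fr_z (fr_b H_S9) P = 0" "fr_z (fr_c H_S9) P = 0" "fr_z (fr_d H_S9) P = 0" "fr_z H_S9 P = 0" "fr_a (fr_c H_S9) P = - 3" "fr_b (fr_d H_S9) P = 0" "fr_a (fr_d H_S9) P = 0"
  unfolding fr_H_S9 by (simp_all add: fr_polynomial)

lemma jet_H_h1:
  "fr_z (fr_z H_h1) P = 0" "fr_z (fr_a H_h1) P = 0" "fr_z (fr_b H_h1) P = 0" "fr_z (fr_c H_h1) P = 0" "fr_z (fr_d H_h1) P = 0" "fr_z H_h1 P = 0" "fr_a (fr_c H_h1) P = 0" "fr_b (fr_d H_h1) P = 0" "fr_a (fr_d H_h1) P = - 6"
  unfolding fr_H_h1 by (simp_all add: fr_polynomial)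

lemma jet_H_E2:
  "fr_z (fr_z H_E2) P = 0" "fr_z (fr_a H_E2) P = 0" "fr_z (fr_b H_E2) P = 0" "fr_z (fr_c H_E2) P = 0" "fr_z (fr_d H_E2) P = 0" "fr_z H_E2 P = 2" "fr_a (fr_c H_E2) P = 0" "fr_b (fr_d H_E2) P = 0" "fr_a (fr_d H_E2) P = 4"
  unfolding fr_H_E2 by (simp_all add: fr_polynomial)

lemma jet_H_L4:
  "fr_z H_L4 P = 0" "fr_a (fr_c H_L4) P = 0" "fr_b (fr_d H_L4) P = 0" "fr_a (fr_d H_L4) P = 0" "fr_a H_L4 P = 0" "fr_b H_L4 P = 0" "fr_c H_L4 P = 0" "fr_d H_L4 P = 1"
  unfolding fr_H_L4 by (simp_all add: fr_polynomial)

lemma jet_H_S5: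
  "fr_z H_S5 P = 0" "fr_a (fr_c H_S5) P = 0" "fr_b (fr_d H_S5) P = 0" "fr_a (fr_d H_S5) P = 0" "fr_a H_S5 P = 0" "fr_b H_S5 P = 0" "fr_c H_S5 P = - (1)" "fr_d H_S5 P = 0"
  unfolding fr_H_S5 by (simp_all add: fr_polynomial)

lemma jet_H_S7:
  "fr_z H_S7 P = 0" "fr_a (fr_c H_S7) P = 0" "fr_b (fr_d H_S7) P = 0" "fr_a (fr_d H_S7) P = 0" "fr_a H_S7 P = 0" "fr_b H_S7 P = 1" "fr_c H_S7 P = 0" "fr_d H_S7 P = 0"
  unfolding fr_H_S7 by (simp_all add: fr_polynomial)

lemma jet_H_L8:
  "fr_z H_L8 P = 0" "fr_a (fr_c H_L8) P = 0" "fr_b (fr_d H_L8) P = 0" "fr_a (fr_d H_L8) P = 0" "fr_a H_L8 P = - 4" "fr_b H_L8 P = 0" "fr_c H_L8 P = 0" "fr_d H_L8 P = 0"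
  unfolding fr_H_L8 by (simp_all add: fr_polynomial)

theorem det_eqs_solution:
  fixes U :: "('k::real_or_complex ^ 5) set"
  assumes U: "open U" "connected U" and f: "det_eqs U f"
  shows "\<exists>cL12 cL10 cS11 cS1 cL2 cS3 cS9 ch1 cE2 cL4 cS5 cS7 cL8 cL6. \<forall>P\<in>U. f P =
    cL12 * H_L12 P + cL10 * H_L10 P + cS11 * H_S11 P + cS1 * H_S1 P + cL2 * H_L2 P + cS3 * H_S3 P + cS9 * H_S9 P + ch1 * H_h1 P + cE2 * H_E2 P + cL4 * H_L4 P + cS5 * H_S5 P + cS7 * H_S7 P + cL8 * H_L8 P + cL6 * H_L6 P"
proof -
  note sub = fr_subtract[OF U(1) det_eqs_smooth det_eqs_smooth[OF det_eqs_subset]]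
  note lin = det_eqs_lin[OF U(1) _ det_eqs_subset]
  obtain kzz where kzz: "\<forall>P\<in>U. fr_z (fr_z f) P = kzz"
    using weight4_constant[OF U f] by blast
  \<comment> \<open>Each coefficient is minus the constant found, divided by the value in the jet
    lemma, here 6.\<close>
  define cL12 where "cL12 = - kzz / 6"
  define f1 where "f1 = (\<lambda>P. 1 * f P + cL12 * H_L12 P)"
  have df1: "det_eqs U f1" unfolding f1_def by (rule lin[OF f det_eqs_H(12)])
  note sf1 = sub[OF f det_eqs_H(12), where c = "cL12", folded f1_def]
  have vzz: "\<forall>P\<in>U. fr_z (fr_z f1) P = 0"
    using kzz
    by (simp_all add: sf1 jet_H_L12 cL12_def field_simps)
  obtain kza kzb kzc kzd where kza: "\<forall>P\<in>U. fr_z (fr_a f1) P = kza"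
    and kzb: "\<forall>P\<in>U. fr_z (fr_b f1) P = kzb"
    and kzc: "\<forall>P\<in>U. fr_z (fr_c f1) P = kzc"
    and kzd: "\<forall>P\<in>U. fr_z (fr_d f1) P = kzd"
    using weight3_constant[OF U df1 vzz] by blast
  define cL10 where "cL10 = - kza / 3"
  define cS11 where "cS11 = - kzb / 3"
  define cS1 where "cS1 = - kzc / 3"
  define cL2 where "cL2 = kzd / 2"
  define f2 where "f2 = (\<lambda>P. 1 * f1 P + cL10 * H_L10 P)"
  have df2: "det_eqs U f2" unfolding f2_def by (rule lin[OF df1 det_eqs_H(10)])
  note sf2 = sub[OF df1 det_eqs_H(10), where c = "cL10", folded f2_def]
  define f3 where "f3 = (\<lambda>P. 1 * f2 P + cS11 * H_S11 P)"
  have df3: "det_eqs U f3" unfolding f3_def by (rule lin[OF df2 det_eqs_H(11)])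
  note sf3 = sub[OF df2 det_eqs_H(11), where c = "cS11", folded f3_def]
  define f4 where "f4 = (\<lambda>P. 1 * f3 P + cS1 * H_S1 P)"
  have df4: "det_eqs U f4" unfolding f4_def by (rule lin[OF df3 det_eqs_H(1)])
  note sf4 = sub[OF df3 det_eqs_H(1), where c = "cS1", folded f4_def]
  define f5 where "f5 = (\<lambda>P. 1 * f4 P + cL2 * H_L2 P)"
  have df5: "det_eqs U f5" unfolding f5_def by (rule lin[OF df4 det_eqs_H(2)])
  note sf5 = sub[OF df4 det_eqs_H(2), where c = "cL2", folded f5_def]
  have vzz: "\<forall>P\<in>U. fr_z (fr_z f5) P = 0"
    and vza: "\<forall>P\<in>U. fr_z (fr_a f5) P = 0"
    and vzb: "\<forall>P\<in>U. fr_z (fr_b f5) P = 0"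
    and vzc: "\<forall>P\<in>U. fr_z (fr_c f5) P = 0"
    and vzd: "\<forall>P\<in>U. fr_z (fr_d f5) P = 0"
    using vzz kza kzb kzc kzd
    by (simp_all add: sf2 sf3 sf4 sf5 jet_H_L10 jet_H_S11 jet_H_S1 jet_H_L2 cL10_def cS11_def cS1_def cL2_def field_simps)
  obtain kz kac kbd kad where kz: "\<forall>P\<in>U. fr_z f5 P = kz"
    and kac: "\<forall>P\<in>U. fr_a (fr_c f5) P = kac"
    and kbd: "\<forall>P\<in>U. fr_b (fr_d f5) P = kbd"
    and kad: "\<forall>P\<in>U. fr_a (fr_d f5) P = kad"
    using weight2_constant[OF U df5 vzz vza vzb vzc vzd] by blast
  define cS3 where "cS3 = kbd / 2"
  define cS9 where "cS9 = kac / 3"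
  \<comment> \<open>\<open>H_E2\<close> will add 4 * cE2 = -2 * kz to ad. The coefficient of
    \<open>H_h1\<close>, whose ad is -6, makes up for it in advance.\<close>
  define ch1 where "ch1 = (kad - 2 * kz) / 6"
  define cE2 where "cE2 = - kz / 2"
  define f6 where "f6 = (\<lambda>P. 1 * f5 P + cS3 * H_S3 P)"
  have df6: "det_eqs U f6" unfolding f6_def by (rule lin[OF df5 det_eqs_H(3)])
  note sf6 = sub[OF df5 det_eqs_H(3), where c = "cS3", folded f6_def]
  define f7 where "f7 = (\<lambda>P. 1 * f6 P + cS9 * H_S9 P)"
  have df7: "det_eqs U f7" unfolding f7_def by (rule lin[OF df6 det_eqs_H(9)])
  note sf7 = sub[OF df6 det_eqs_H(9), where c = "cS9", folded f7_def]
  define f8 where "f8 = (\<lambda>P. 1 * f7 P + ch1 * H_h1 P)"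
  have df8: "det_eqs U f8" unfolding f8_def by (rule lin[OF df7 det_eqs_H(13)])
  note sf8 = sub[OF df7 det_eqs_H(13), where c = "ch1", folded f8_def]
  define f9 where "f9 = (\<lambda>P. 1 * f8 P + cE2 * H_E2 P)"
  have df9: "det_eqs U f9" unfolding f9_def by (rule lin[OF df8 det_eqs_H(14)])
  note sf9 = sub[OF df8 det_eqs_H(14), where c = "cE2", folded f9_def]
  have vzz: "\<forall>P\<in>U. fr_z (fr_z f9) P = 0"
    and vza: "\<forall>P\<in>U. fr_z (fr_a f9) P = 0"
    and vzb: "\<forall>P\<in>U. fr_z (fr_b f9) P = 0"
    and vzc: "\<forall>P\<in>U. fr_z (fr_c f9) P = 0"
    and vzd: "\<forall>P\<in>U. fr_z (fr_d f9) P = 0"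
    and vz: "\<forall>P\<in>U. fr_z f9 P = 0"
    and vac: "\<forall>P\<in>U. fr_a (fr_c f9) P = 0"
    and vbd: "\<forall>P\<in>U. fr_b (fr_d f9) P = 0"
    and vad: "\<forall>P\<in>U. fr_a (fr_d f9) P = 0"
    using vzz vza vzb vzc vzd kz kac kbd kad
    by (simp_all add: sf6 sf7 sf8 sf9 jet_H_S3 jet_H_S9 jet_H_h1 jet_H_E2 cS3_def cS9_def ch1_def cE2_def field_simps)
  obtain ka kb kc kd where ka: "\<forall>P\<in>U. fr_a f9 P = ka"
    and kb: "\<forall>P\<in>U. fr_b f9 P = kb"
    and kc: "\<forall>P\<in>U. fr_c f9 P = kc"
    and kd: "\<forall>P\<in>U. fr_d f9 P = kd"
    using weight1_constant[OF U df9 vz vac vbd vad] by blast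
  define cL4 where "cL4 = - kd / 1"
  define cS5 where "cS5 = kc / 1"
  define cS7 where "cS7 = - kb / 1"
  define cL8 where "cL8 = ka / 4"
  define f10 where "f10 = (\<lambda>P. 1 * f9 P + cL4 * H_L4 P)"
  have df10: "det_eqs U f10" unfolding f10_def by (rule lin[OF df9 det_eqs_H(4)])
  note sf10 = sub[OF df9 det_eqs_H(4), where c = "cL4", folded f10_def]
  define f11 where "f11 = (\<lambda>P. 1 * f10 P + cS5 * H_S5 P)"
  have df11: "det_eqs U f11" unfolding f11_def by (rule lin[OF df10 det_eqs_H(5)])
  note sf11 = sub[OF df10 det_eqs_H(5), where c = "cS5", folded f11_def]
  define f12 where "f12 = (\<lambda>P. 1 * f11 P + cS7 * H_S7 P)"
  have df12: "det_eqs U f12" unfolding f12_def by (rule lin[OF df11 det_eqs_H(7)])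
  note sf12 = sub[OF df11 det_eqs_H(7), where c = "cS7", folded f12_def]
  define f13 where "f13 = (\<lambda>P. 1 * f12 P + cL8 * H_L8 P)"
  have df13: "det_eqs U f13" unfolding f13_def by (rule lin[OF df12 det_eqs_H(8)])
  note sf13 = sub[OF df12 det_eqs_H(8), where c = "cL8", folded f13_def]
  have vz: "\<forall>P\<in>U. fr_z f13 P = 0"
    and vac: "\<forall>P\<in>U. fr_a (fr_c f13) P = 0"
    and vbd: "\<forall>P\<in>U. fr_b (fr_d f13) P = 0"
    and vad: "\<forall>P\<in>U. fr_a (fr_d f13) P = 0"
    and va: "\<forall>P\<in>U. fr_a f13 P = 0"
    and vb: "\<forall>P\<in>U. fr_b f13 P = 0"
    and vc: "\<forall>P\<in>U. fr_c f13 P = 0"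
    and vd: "\<forall>P\<in>U. fr_d f13 P = 0"
    using vz vac vbd vad ka kb kc kd
    by (simp_all add: sf10 sf11 sf12 sf13 jet_H_L4 jet_H_S5 jet_H_S7 jet_H_L8 cL4_def cS5_def cS7_def cL8_def field_simps)
  obtain k where k: "\<forall>P\<in>U. f13 P = k"
    using weight0_constant[OF U df13 va vb vc vd vz] by blast
  \<comment> \<open>Solving for f reverses the signs; the remaining constant k is a multiple of
    \<open>H_L6\<close>, the constant function 1.\<close>
  show ?thesis
    apply (rule exI[of _ "- cL12"])
    apply (rule exI[of _ "- cL10"])
    apply (rule exI[of _ "- cS11"])
    apply (rule exI[of _ "- cS1"])
    apply (rule exI[of _ "- cL2"])
    apply (rule exI[of _ "- cS3"])
    apply (rule exI[of _ "- cS9"])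
    apply (rule exI[of _ "- ch1"])
    apply (rule exI[of _ "- cE2"])
    apply (rule exI[of _ "- cL4"])
    apply (rule exI[of _ "- cS5"])
    apply (rule exI[of _ "- cS7"])
    apply (rule exI[of _ "- cL8"])
    apply (rule exI[of _ k])
    using k unfolding f13_def f12_def f11_def f10_def f9_def f8_def f7_def f6_def f5_def f4_def f3_def f2_def f1_def by (simp add: H_L6_def algebra_simps)
qed

section \<open>Brackets of Hamiltonian fields\<close>

definition ham_field ::
    "('k::real_or_complex ^ 5) set \<Rightarrow> ('k ^ 5 \<Rightarrow> 'k) \<Rightarrow> 'k ^ 5 \<Rightarrow> 'k ^ 5" where
  "ham_field U f = restrict_field U (ham f)"

text \<open>The Lagrange bracket of contact geometry in the frame: the quarter is the inverse of the
  4 in the commutator of a and d, and the last two products belong to the pair b, c.\<close>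

definition lagrange_bracket ::
    "('k::real_or_complex ^ 5 \<Rightarrow> 'k) \<Rightarrow> ('k ^ 5 \<Rightarrow> 'k) \<Rightarrow> 'k ^ 5 \<Rightarrow> 'k" where
  "lagrange_bracket f g = (\<lambda>P. f P * fr_z g P - fr_z f P * g P
     + 1/4 * (fr_d f P * fr_a g P - fr_a f P * fr_d g P) + (fr_b f P * fr_c g P - fr_c f P * fr_b g P))"

lemma vector_field_ham_field: "open U \<Longrightarrow> smooth_on U f \<Longrightarrow> vector_field_on U (ham_field U f)"
  unfolding ham_field_def by (intro vector_field_on_restrict smooth_ham)

lemma ham_field_nth: "P \<in> U \<Longrightarrow> ham_field U f P = ham f P"
  by (simp add: ham_field_def restrict_field_def)

lemma ham_cong:
  assumes "open U" "P \<in> U" "\<And>Q. Q \<in> U \<Longrightarrow> f Q = g Q"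
  shows "ham f P = ham g P"
  using fr_cong[OF assms] partial_cong[OF assms] assms(2,3) by (simp add: ham_def)

lemma ham_field_cong: "open U \<Longrightarrow> (\<And>Q. Q \<in> U \<Longrightarrow> f Q = g Q) \<Longrightarrow> ham_field U f = ham_field U g"
  by (auto simp: ham_field_def restrict_field_def fun_eq_iff intro: ham_cong)

lemma ham_add:
  "smooth_on U f \<Longrightarrow> smooth_on U g \<Longrightarrow> P \<in> U \<Longrightarrow> ham (\<lambda>Q. f Q + g Q) P = ham f P + ham g P"
  unfolding vec_eq_iff forall_5 vector_add_component ham_nth_3 ham_nth(1,2,4,5)
  by (simp add: fr_add[of U] algebra_simps)

lemma ham_cmult:
  "smooth_on U f \<Longrightarrow> P \<in> U \<Longrightarrow> ham (\<lambda>Q. c * f Q) P = c *s ham f P"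
  unfolding vec_eq_iff forall_5 vector_smult_component ham_nth_3 ham_nth(1,2,4,5)
  by (simp add: fr_cmult[of U] algebra_simps)

lemma ham_field_add:
  "smooth_on U f \<Longrightarrow> smooth_on U g \<Longrightarrow> ham_field U (\<lambda>Q. f Q + g Q) = ham_field U f + ham_field U g"
  by (auto simp: ham_field_def restrict_field_def fun_eq_iff ham_add[of U])

lemma ham_field_cmult:
  "smooth_on U f \<Longrightarrow> ham_field U (\<lambda>Q. c * f Q) = field_scale c (ham_field U f)"
  by (auto simp: ham_field_def restrict_field_def field_scale_def fun_eq_iff ham_cmult[of U])

context
  fixes U :: "('k::real_or_complex ^ 5) set" and f g :: "'k ^ 5 \<Rightarrow> 'k"
  assumes U: "open U" and f: "smooth_on U f" and g: "smooth_on U g"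
begin

text \<open>\<open>V f\<close> is differentiation along \<open>ham f\<close>. The Leibniz rule
  leaves products of first derivatives with \<open>fr_z f\<close> or \<open>fr_z g\<close>; they are
  absorbed when the frame operators in \<open>V\<close> are reordered.\<close>

lemma fr_lagrange_bracket:
  assumes P: "P \<in> U"
  defines "V \<equiv> \<lambda>f h. f P * fr_z h P + 1/4 * (fr_d f P * fr_a h P - fr_a f P * fr_d h P)
     + (fr_b f P * fr_c h P - fr_c f P * fr_b h P)"
  shows "fr_a (lagrange_bracket f g) P = V f (fr_a g) - V g (fr_a f)"
    "fr_b (lagrange_bracket f g) P = V f (fr_b g) - V g (fr_b f)"
    "fr_c (lagrange_bracket f g) P = V f (fr_c g) - V g (fr_c f)"
    "fr_d (lagrange_bracket f g) P = V f (fr_d g) - V g (fr_d f)"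
  unfolding lagrange_bracket_def V_def using P f g
  by (simp_all add: fr_add[of U] fr_diff[of U] fr_mult[of U] fr_divide[of U] smooth_intros smooth_fr U
      smooth_divide fr_const fr_commute[OF U f P] fr_commute[OF U g P] field_simps)

lemma lie_bracket_ham_field:
  "lie_bracket U (ham_field U f) (ham_field U g) = ham_field U (lagrange_bracket f g)"
proof
  fix P :: "'k ^ 5"
  let ?V = "\<lambda>f h. f P * fr_z h P + 1/4 * (fr_d f P * fr_a h P - fr_a f P * fr_d h P)
     + (fr_b f P * fr_c h P - fr_c f P * fr_b h P)"
  show "lie_bracket U (ham_field U f) (ham_field U g) P = ham_field U (lagrange_bracket f g) P"
  proof (cases "P \<in> U")
    case P: True
    have V: "dir_deriv (ham_field U f) h P = ?V f h" for f h
      unfolding dir_deriv_def sum_5 ham_field_nth[OF P] ham_nth_3 ham_nth(1,2,4,5)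
      by (simp add: fr_defs field_simps)
    have comp: "lie_bracket U (ham_field U f) (ham_field U g) P $ i
        = ?V f (\<lambda>Q. ham g Q $ i) - ?V g (\<lambda>Q. ham f Q $ i)" for i
      unfolding lie_bracket_nth[OF P] V[symmetric]
      by (intro arg_cong2[where f = "(-)"] dir_deriv_cong[OF U P]) (simp_all add: ham_field_nth)
    note s = smooth_fr[OF U f] smooth_fr[OF U g]
    show ?thesis
      unfolding vec_eq_iff forall_5 comp ham_field_nth[OF P] ham_nth_3 ham_nth(1,2,4,5)
        fr_lagrange_bracket[OF P]
      using P U f g s
      by (simp add: fr_add[of U] fr_diff[of U] fr_mult[of U] fr_divide[of U] fr_minus[of U] fr_coord fr_const
          smooth_intros smooth_divide lagrange_bracket_def field_simps)
  qed (simp add: lie_bracket_outside ham_field_def restrict_field_def)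
qed

end

text \<open>\<open>H_ha\<close> and \<open>H_hb\<close> span the same plane as the Hamiltonians of
  \<open>h1\<close> and \<open>h2\<close>, but form the basis dual to the simple roots: on the root
  vector of m alpha + n beta they have eigenvalues m and n, which removes the irrational
  factor.\<close>

definition H_ha :: "'k::real_or_complex ^ 5 \<Rightarrow> 'k" where
  "H_ha = (\<lambda>P. - 3*P$1*P$4 - P$2*P$5 + 3*P$3 + 9/8*P$4^2)"
definition H_hb :: "'k::real_or_complex ^ 5 \<Rightarrow> 'k" where
  "H_hb = H_E2"

lemma fr_H_ha:
  "fr_a H_ha = (\<lambda>P. - 12*P$1 + 9*P$4)"
  "fr_b H_ha = (\<lambda>P. 2*P$5)"
  "fr_c H_ha = (\<lambda>P. - (P$2))"
  "fr_d H_ha = (\<lambda>P. 0)"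
  "fr_z H_ha = (\<lambda>P. 3)"
  by (rule ext, simp add: H_ha_def fr_polynomial polynomial_simps)+

lemmas fr_H_hb = fr_H_E2[folded H_hb_def]

text \<open>This and the following tables list the brackets above the diagonal, in the order of
  \<open>basis_ham\<close>. Roots add under the bracket, and opposite roots give combinations of
  \<open>H_ha\<close> and \<open>H_hb\<close>.\<close>

lemma lagrange_H_S3:
  "lagrange_bracket H_S3 H_L10 = (\<lambda>P. (- 1/2) * H_S11 P)"
  "lagrange_bracket H_S3 H_S11 = (\<lambda>P. (- 1/2) * H_S1 P)"
  "lagrange_bracket H_S3 H_S1 = (\<lambda>P. 3 * H_L2 P)"
  "lagrange_bracket H_S3 H_L2 = (\<lambda>P. 0)"
  "lagrange_bracket H_S3 H_L12 = (\<lambda>P. 0)"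
  "lagrange_bracket H_S3 H_S9 = (\<lambda>P. (- 1) * H_ha P + 3/2 * H_hb P)"
  "lagrange_bracket H_S3 H_L4 = (\<lambda>P. 0)"
  "lagrange_bracket H_S3 H_S5 = (\<lambda>P. 2 * H_L4 P)"
  "lagrange_bracket H_S3 H_S7 = (\<lambda>P. 1/2 * H_S5 P)"
  "lagrange_bracket H_S3 H_L8 = (\<lambda>P. 2 * H_S7 P)"
  "lagrange_bracket H_S3 H_L6 = (\<lambda>P. 0)"
  "lagrange_bracket H_S3 H_ha = (\<lambda>P. (- 1) * H_S3 P)"
  "lagrange_bracket H_S3 H_hb = (\<lambda>P. 0)"
  unfolding lagrange_bracket_def fr_H_S3 fr_H_L10 fr_H_S11 fr_H_S1 fr_H_L2 fr_H_L12 fr_H_S9 fr_H_L4 fr_H_S5 fr_H_S7 fr_H_L8 fr_H_L6 fr_H_ha fr_H_hb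
  by (rule ext, simp add: H_S3_def H_L10_def H_S11_def H_S1_def H_L2_def H_L12_def H_S9_def H_L4_def H_S5_def H_S7_def H_L8_def H_L6_def H_ha_def H_hb_def H_E2_def polynomial_simps)+

lemma lagrange_H_L10:
  "lagrange_bracket H_L10 H_S11 = (\<lambda>P. 0)"
  "lagrange_bracket H_L10 H_S1 = (\<lambda>P. 0)"
  "lagrange_bracket H_L10 H_L2 = (\<lambda>P. 1/2 * H_L12 P)"
  "lagrange_bracket H_L10 H_L12 = (\<lambda>P. 0)"
  "lagrange_bracket H_L10 H_S9 = (\<lambda>P. 0)"
  "lagrange_bracket H_L10 H_L4 = (\<lambda>P. 3/4 * H_ha P + (- 3/2) * H_hb P)"
  "lagrange_bracket H_L10 H_S5 = (\<lambda>P. (- 1) * H_S9 P)"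
  "lagrange_bracket H_L10 H_S7 = (\<lambda>P. 0)"
  "lagrange_bracket H_L10 H_L8 = (\<lambda>P. 0)"
  "lagrange_bracket H_L10 H_L6 = (\<lambda>P. 3/4 * H_L8 P)"
  "lagrange_bracket H_L10 H_ha = (\<lambda>P. 0)"
  "lagrange_bracket H_L10 H_hb = (\<lambda>P. (- 1) * H_L10 P)"
  unfolding lagrange_bracket_def fr_H_L10 fr_H_S11 fr_H_S1 fr_H_L2 fr_H_L12 fr_H_S9 fr_H_L4 fr_H_S5 fr_H_S7 fr_H_L8 fr_H_L6 fr_H_ha fr_H_hb
  by (rule ext, simp add: H_L10_def H_S11_def H_S1_def H_L2_def H_L12_def H_S9_def H_L4_def H_S5_def H_S7_def H_L8_def H_L6_def H_ha_def H_hb_def H_E2_def polynomial_simps)+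

lemma lagrange_H_S11:
  "lagrange_bracket H_S11 H_S1 = (\<lambda>P. 3 * H_L12 P)"
  "lagrange_bracket H_S11 H_L2 = (\<lambda>P. 0)"
  "lagrange_bracket H_S11 H_L12 = (\<lambda>P. 0)"
  "lagrange_bracket H_S11 H_S9 = (\<lambda>P. (- 3) * H_L10 P)"
  "lagrange_bracket H_S11 H_L4 = (\<lambda>P. 3/2 * H_S3 P)"
  "lagrange_bracket H_S11 H_S5 = (\<lambda>P. 1 * H_ha P + (- 3) * H_hb P)"
  "lagrange_bracket H_S11 H_S7 = (\<lambda>P. (- 1) * H_S9 P)"
  "lagrange_bracket H_S11 H_L8 = (\<lambda>P. 0)"
  "lagrange_bracket H_S11 H_L6 = (\<lambda>P. (- 3) * H_S7 P)"
  "lagrange_bracket H_S11 H_ha = (\<lambda>P. (- 1) * H_S11 P)"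
  "lagrange_bracket H_S11 H_hb = (\<lambda>P. (- 1) * H_S11 P)"
  unfolding lagrange_bracket_def fr_H_S11 fr_H_S1 fr_H_L2 fr_H_L12 fr_H_S9 fr_H_L4 fr_H_S5 fr_H_S7 fr_H_L8 fr_H_L6 fr_H_ha fr_H_hb
  by (rule ext, simp add: H_S11_def H_S1_def H_L2_def H_L12_def H_S9_def H_L4_def H_S5_def H_S7_def H_L8_def H_L6_def H_ha_def H_hb_def H_L10_def H_S3_def H_E2_def polynomial_simps)+

lemma lagrange_H_S1:
  "lagrange_bracket H_S1 H_L2 = (\<lambda>P. 0)"
  "lagrange_bracket H_S1 H_L12 = (\<lambda>P. 0)"
  "lagrange_bracket H_S1 H_S9 = (\<lambda>P. (- 4) * H_S11 P)"
  "lagrange_bracket H_S1 H_L4 = (\<lambda>P. 0)"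
  "lagrange_bracket H_S1 H_S5 = (\<lambda>P. 8 * H_S3 P)"
  "lagrange_bracket H_S1 H_S7 = (\<lambda>P. (- 1) * H_ha P)"
  "lagrange_bracket H_S1 H_L8 = (\<lambda>P. (- 4) * H_S9 P)"
  "lagrange_bracket H_S1 H_L6 = (\<lambda>P. 3 * H_S5 P)"
  "lagrange_bracket H_S1 H_ha = (\<lambda>P. (- 2) * H_S1 P)"
  "lagrange_bracket H_S1 H_hb = (\<lambda>P. (- 1) * H_S1 P)"
  unfolding lagrange_bracket_def fr_H_S1 fr_H_L2 fr_H_L12 fr_H_S9 fr_H_L4 fr_H_S5 fr_H_S7 fr_H_L8 fr_H_L6 fr_H_ha fr_H_hb
  by (rule ext, simp add: H_S1_def H_L2_def H_L12_def H_S9_def H_L4_def H_S5_def H_S7_def H_L8_def H_L6_def H_ha_def H_hb_def H_S11_def H_S3_def H_E2_def polynomial_simps)+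

lemma lagrange_H_L2:
  "lagrange_bracket H_L2 H_L12 = (\<lambda>P. 0)"
  "lagrange_bracket H_L2 H_S9 = (\<lambda>P. 1/2 * H_S1 P)"
  "lagrange_bracket H_L2 H_L4 = (\<lambda>P. 0)"
  "lagrange_bracket H_L2 H_S5 = (\<lambda>P. 0)"
  "lagrange_bracket H_L2 H_S7 = (\<lambda>P. (- 1) * H_S3 P)"
  "lagrange_bracket H_L2 H_L8 = (\<lambda>P. 2 * H_ha P + (- 2) * H_hb P)"
  "lagrange_bracket H_L2 H_L6 = (\<lambda>P. 2 * H_L4 P)"
  "lagrange_bracket H_L2 H_ha = (\<lambda>P. (- 3) * H_L2 P)"
  "lagrange_bracket H_L2 H_hb = (\<lambda>P. (- 1) * H_L2 P)"
  unfolding lagrange_bracket_def fr_H_L2 fr_H_L12 fr_H_S9 fr_H_L4 fr_H_S5 fr_H_S7 fr_H_L8 fr_H_L6 fr_H_ha fr_H_hb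
  by (rule ext, simp add: H_L2_def H_L12_def H_S9_def H_L4_def H_S5_def H_S7_def H_L8_def H_L6_def H_ha_def H_hb_def H_S1_def H_S3_def H_E2_def polynomial_simps)+

lemma lagrange_H_L12:
  "lagrange_bracket H_L12 H_S9 = (\<lambda>P. 0)"
  "lagrange_bracket H_L12 H_L4 = (\<lambda>P. 3/2 * H_L2 P)"
  "lagrange_bracket H_L12 H_S5 = (\<lambda>P. 1 * H_S1 P)"
  "lagrange_bracket H_L12 H_S7 = (\<lambda>P. (- 1) * H_S11 P)"
  "lagrange_bracket H_L12 H_L8 = (\<lambda>P. 4 * H_L10 P)"
  "lagrange_bracket H_L12 H_L6 = (\<lambda>P. (- 3) * H_hb P)"
  "lagrange_bracket H_L12 H_ha = (\<lambda>P. (- 3) * H_L12 P)"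
  "lagrange_bracket H_L12 H_hb = (\<lambda>P. (- 2) * H_L12 P)"
  unfolding lagrange_bracket_def fr_H_L12 fr_H_S9 fr_H_L4 fr_H_S5 fr_H_S7 fr_H_L8 fr_H_L6 fr_H_ha fr_H_hb
  by (rule ext, simp add: H_L12_def H_S9_def H_L4_def H_S5_def H_S7_def H_L8_def H_L6_def H_ha_def H_hb_def H_L2_def H_S1_def H_S11_def H_L10_def H_E2_def polynomial_simps)+

lemma lagrange_H_S9:
  "lagrange_bracket H_S9 H_L4 = (\<lambda>P. (- 3/4) * H_S5 P)"
  "lagrange_bracket H_S9 H_S5 = (\<lambda>P. (- 4) * H_S7 P)"
  "lagrange_bracket H_S9 H_S7 = (\<lambda>P. (- 3/4) * H_L8 P)"
  "lagrange_bracket H_S9 H_L8 = (\<lambda>P. 0)"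
  "lagrange_bracket H_S9 H_L6 = (\<lambda>P. 0)"
  "lagrange_bracket H_S9 H_ha = (\<lambda>P. 1 * H_S9 P)"
  "lagrange_bracket H_S9 H_hb = (\<lambda>P. 0)"
  unfolding lagrange_bracket_def fr_H_S9 fr_H_L4 fr_H_S5 fr_H_S7 fr_H_L8 fr_H_L6 fr_H_ha fr_H_hb
  by (rule ext, simp add: H_S9_def H_L4_def H_S5_def H_S7_def H_L8_def H_L6_def H_ha_def H_hb_def H_E2_def polynomial_simps)+

lemma lagrange_H_L4:
  "lagrange_bracket H_L4 H_S5 = (\<lambda>P. 0)"
  "lagrange_bracket H_L4 H_S7 = (\<lambda>P. 0)"
  "lagrange_bracket H_L4 H_L8 = (\<lambda>P. (- 1) * H_L6 P)"
  "lagrange_bracket H_L4 H_L6 = (\<lambda>P. 0)"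
  "lagrange_bracket H_L4 H_ha = (\<lambda>P. 0)"
  "lagrange_bracket H_L4 H_hb = (\<lambda>P. 1 * H_L4 P)"
  unfolding lagrange_bracket_def fr_H_L4 fr_H_S5 fr_H_S7 fr_H_L8 fr_H_L6 fr_H_ha fr_H_hb
  by (rule ext, simp add: H_L4_def H_S5_def H_S7_def H_L8_def H_L6_def H_ha_def H_hb_def H_E2_def polynomial_simps)+

lemma lagrange_H_S5:
  "lagrange_bracket H_S5 H_S7 = (\<lambda>P. 1 * H_L6 P)"
  "lagrange_bracket H_S5 H_L8 = (\<lambda>P. 0)"
  "lagrange_bracket H_S5 H_L6 = (\<lambda>P. 0)"
  "lagrange_bracket H_S5 H_ha = (\<lambda>P. 1 * H_S5 P)"
  "lagrange_bracket H_S5 H_hb = (\<lambda>P. 1 * H_S5 P)"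
  unfolding lagrange_bracket_def fr_H_S5 fr_H_S7 fr_H_L8 fr_H_L6 fr_H_ha fr_H_hb
  by (rule ext, simp add: H_S5_def H_S7_def H_L8_def H_L6_def H_ha_def H_hb_def H_E2_def polynomial_simps)+

lemma lagrange_H_S7:
  "lagrange_bracket H_S7 H_L8 = (\<lambda>P. 0)"
  "lagrange_bracket H_S7 H_L6 = (\<lambda>P. 0)"
  "lagrange_bracket H_S7 H_ha = (\<lambda>P. 2 * H_S7 P)"
  "lagrange_bracket H_S7 H_hb = (\<lambda>P. 1 * H_S7 P)"
  unfolding lagrange_bracket_def fr_H_S7 fr_H_L8 fr_H_L6 fr_H_ha fr_H_hb
  by (rule ext, simp add: H_S7_def H_L8_def H_L6_def H_ha_def H_hb_def H_E2_def polynomial_simps)+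

lemma lagrange_H_L8:
  "lagrange_bracket H_L8 H_L6 = (\<lambda>P. 0)"
  "lagrange_bracket H_L8 H_ha = (\<lambda>P. 3 * H_L8 P)"
  "lagrange_bracket H_L8 H_hb = (\<lambda>P. 1 * H_L8 P)"
  unfolding lagrange_bracket_def fr_H_L8 fr_H_L6 fr_H_ha fr_H_hb
  by (rule ext, simp add: H_L8_def H_L6_def H_ha_def H_hb_def H_E2_def polynomial_simps)+

lemma lagrange_H_L6:
  "lagrange_bracket H_L6 H_ha = (\<lambda>P. 3 * H_L6 P)"
  "lagrange_bracket H_L6 H_hb = (\<lambda>P. 2 * H_L6 P)"
  unfolding lagrange_bracket_def fr_H_L6 fr_H_ha fr_H_hb
  by (rule ext, simp add: H_L6_def H_ha_def H_hb_def H_E2_def polynomial_simps)+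

lemma lagrange_H_ha:
  "lagrange_bracket H_ha H_hb = (\<lambda>P. 0)"
  unfolding lagrange_bracket_def fr_H_ha fr_H_hb
  by (rule ext, simp add: H_ha_def H_hb_def H_E2_def polynomial_simps)+

section \<open>A criterion for Lie algebras to be split simple of type \<open>G\<^sub>2\<close>\<close>

definition G2_roots :: "(int \<times> int) set" where
  "G2_roots = {(1, 0), (0, 1), (1, 1), (2, 1), (3, 1), (3, 2),
     (-1, 0), (0, -1), (-1, -1), (-2, -1), (-3, -1), (-3, -2)}"

text \<open>The roots in the order of their angles in the plane: consecutive roots differ by a root.\<close>

definition G2_cycle :: "((int \<times> int) \<times> (int \<times> int)) set" where
  "G2_cycle = {((1, 0), (3, 1)), ((3, 1), (2, 1)), ((2, 1), (3, 2)), ((3, 2), (1, 1)),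
     ((1, 1), (0, 1)), ((0, 1), (-1, 0)), ((-1, 0), (-3, -1)), ((-3, -1), (-2, -1)),
     ((-2, -1), (-3, -2)), ((-3, -2), (-1, -1)), ((-1, -1), (0, -1)), ((0, -1), (1, 0))}"

lemma finite_G2_roots [simp]: "finite G2_roots"
  by (simp add: G2_roots_def)

text \<open>The cycle is closed and passes through all twelve roots, so any root may serve as the
  start.\<close>

lemma G2_cycle_all:
  assumes "r0 \<in> G2_roots" "P r0" and step: "\<And>r s. (r, s) \<in> G2_cycle \<Longrightarrow> P r \<Longrightarrow> P s"
  shows "\<forall>r\<in>G2_roots. P r"
proof -
  have "P (1, 0) \<longrightarrow> P (3, 1)" "P (3, 1) \<longrightarrow> P (2, 1)" "P (2, 1) \<longrightarrow> P (3, 2)"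
    "P (3, 2) \<longrightarrow> P (1, 1)" "P (1, 1) \<longrightarrow> P (0, 1)" "P (0, 1) \<longrightarrow> P (-1, 0)"
    "P (-1, 0) \<longrightarrow> P (-3, -1)" "P (-3, -1) \<longrightarrow> P (-2, -1)" "P (-2, -1) \<longrightarrow> P (-3, -2)"
    "P (-3, -2) \<longrightarrow> P (-1, -1)" "P (-1, -1) \<longrightarrow> P (0, -1)" "P (0, -1) \<longrightarrow> P (1, 0)"
    by (rule impI, erule step[rotated], simp add: G2_cycle_def)+
  with assms(1,2) show ?thesis
    unfolding G2_roots_def by (elim insertE emptyE) simp_all
qed

text \<open>Beyond the weights, only twelve brackets along the cycle and two brackets of opposite
  root vectors are prescribed. Linear independence of the fourteen elements is a consequence: the
  weights separate them, and one nonzero root vector makes all of them nonzero.\<close>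

locale split_G2_basis = lie_algebra scale L br
  for scale :: "'k::field_char_0 \<Rightarrow> 'v::ab_group_add \<Rightarrow> 'v" and L and br +
  fixes e :: "int \<times> int \<Rightarrow> 'v" and ha hb :: 'v
  assumes span_basis: "L = span (insert ha (insert hb (e ` G2_roots)))"
    and ha_hb: "br ha hb = 0"
    and ha_e: "r \<in> G2_roots \<Longrightarrow> br ha (e r) = scale (of_int (fst r)) (e r)"
    and hb_e: "r \<in> G2_roots \<Longrightarrow> br hb (e r) = scale (of_int (snd r)) (e r)"
    and cycle: "(r, s) \<in> G2_cycle \<Longrightarrow> \<exists>c. c \<noteq> 0 \<and> br (e (s - r)) (e r) = scale c (e s)"
    and opposite: "\<exists>a b a' b'. a * b' \<noteq> b * a' \<and> br (e (-1, 0)) (e (1, 0)) = scale a ha + scale b hb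
        \<and> br (e (0, -1)) (e (0, 1)) = scale a' ha + scale b' hb"
    and nonzero: "\<exists>r\<in>G2_roots. e r \<noteq> 0"
begin

lemma basis_in_L: "ha \<in> L" "hb \<in> L" "r \<in> G2_roots \<Longrightarrow> e r \<in> L"
proof -
  have "insert ha (insert hb (e ` G2_roots)) \<subseteq> L"
    by (subst span_basis) (rule span_superset)
  then show "ha \<in> L" "hb \<in> L" "r \<in> G2_roots \<Longrightarrow> e r \<in> L" by auto
qed

lemmas L_closed = subspace_add[OF subspace_L] subspace_scale[OF subspace_L] subspace_0[OF subspace_L]
  subspace_diff[OF subspace_L] basis_in_L

lemma L_sum: "(\<And>i. i \<in> A \<Longrightarrow> y i \<in> L) \<Longrightarrow> sum y A \<in> L"
  by (rule subspace_sum[OF subspace_L])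

lemma br_zero_right: "x \<in> L \<Longrightarrow> br x 0 = 0"
  using br_scale_right[of x 0 0] L_closed(3) by simp

lemma br_zero_left: "x \<in> L \<Longrightarrow> br 0 x = 0"
  using br_scale_left[of 0 x 0] L_closed(3) by simp

lemma br_antisym: "x \<in> L \<Longrightarrow> y \<in> L \<Longrightarrow> br y x = - br x y"
proof -
  assume xy: "x \<in> L" "y \<in> L"
  then have "0 = br x y + br y x"
    using br_self[of "x + y"] br_self[of x] br_self[of y] L_closed(1)[of x y]
    by (simp add: br_add_left br_add_right add.commute)
  then show ?thesis by (simp add: eq_neg_iff_add_eq_0 add.commute)
qed

lemma br_sum_right:
  assumes "x \<in> L" "\<And>i. i \<in> A \<Longrightarrow> y i \<in> L"
  shows "br x (sum y A) = (\<Sum>i\<in>A. br x (y i))"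
  using assms(2)
  by (induction A rule: infinite_finite_induct) (auto simp: br_zero_right assms(1) br_add_right L_sum)

text \<open>A subspace invariant under ad h contains the eigencomponents of its elements.
  Subtracting the j-th eigenvalue from ad h removes the j-th component and rescales the others by
  nonzero factors.\<close>

lemma eigenvector_components:
  assumes I: "subspace I" and h: "h \<in> L" "\<And>y. y \<in> I \<Longrightarrow> br h y \<in> I"
    and A: "finite A" "inj_on \<mu> A"
    and y: "\<And>i. i \<in> A \<Longrightarrow> y i \<in> L \<and> br h (y i) = scale (\<mu> i) (y i)"
    and x: "sum y A \<in> I"
  shows "\<forall>i\<in>A. y i \<in> I"
  using A y x
proof (induction A arbitrary: y rule: finite_induct)
  case (insert j A)
  have L: "y i \<in> L" and ev: "br h (y i) = scale (\<mu> i) (y i)" if "i \<in> insert j A" for i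
    using insert.prems(2) that by blast+
  let ?y = "\<lambda>i. scale (\<mu> i - \<mu> j) (y i)"
  have "br h (sum y (insert j A)) - scale (\<mu> j) (sum y (insert j A)) = sum ?y A"
  proof -
    have "br h (sum y (insert j A)) = (\<Sum>i\<in>insert j A. scale (\<mu> i) (y i))"
      using br_sum_right[of h "insert j A" y] h(1) L ev by simp
    then show ?thesis
      using insert.hyps by (simp add: scale_sum_right scale_right_distrib scale_left_diff_distrib sum_subtractf)
  qed
  then have "sum ?y A \<in> I"
    using subspace_diff[OF I h(2)[OF insert.prems(3)] subspace_scale[OF I insert.prems(3)]] by metis
  moreover have "?y i \<in> L \<and> br h (?y i) = scale (\<mu> i) (?y i)" if "i \<in> A" for i
    using that L ev h(1) by (simp add: L_closed br_scale_right scale_left_commute)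
  ultimately have *: "\<forall>i\<in>A. ?y i \<in> I"
    using insert.IH[of ?y] insert.prems(1) by simp
  have A: "y i \<in> I" if "i \<in> A" for i
  proof -
    have "\<mu> i \<noteq> \<mu> j" using insert.hyps insert.prems(1) that by (auto simp: inj_on_def)
    then have "y i = scale (inverse (\<mu> i - \<mu> j)) (?y i)" by simp
    with * that show ?thesis using subspace_scale[OF I] by metis
  qed
  have "y j = sum y (insert j A) - sum y A" using insert.hyps by simp
  moreover have "sum y A \<in> I" using subspace_sum[OF I, of A y] A by blast
  ultimately have "y j \<in> I" using subspace_diff[OF I insert.prems(3)] by simp
  with A show ?case by blast
qed simp

text \<open>If one root vector were zero, the nonzero structure constants along the cycle would make
  every other one zero.\<close>

lemma e_nonzero: "r \<in> G2_roots \<Longrightarrow> e r \<noteq> 0"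
proof -
  obtain r0 where r0: "r0 \<in> G2_roots" "e r0 \<noteq> 0" using nonzero by blast
  have step: "e r = 0 \<longrightarrow> e s = 0" if "(r, s) \<in> G2_cycle" for r s
  proof -
    have "s - r \<in> G2_roots" using that by (auto simp: G2_cycle_def G2_roots_def)
    then show ?thesis
      using cycle[OF that] br_zero_right[OF basis_in_L(3)[OF \<open>s - r \<in> G2_roots\<close>]] by auto
  qed
  assume "r \<in> G2_roots"
  show ?thesis
  proof
    assume "e r = 0"
    from G2_cycle_all[of r "\<lambda>r. e r = 0", OF \<open>r \<in> G2_roots\<close> this] step r0 show False by blast
  qed
qed

definition comb :: "'k \<Rightarrow> 'k \<Rightarrow> (int \<times> int \<Rightarrow> 'k) \<Rightarrow> 'v" where
  "comb u v c = scale u ha + scale v hb + (\<Sum>r\<in>G2_roots. scale (c r) (e r))"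

lemma comb_in_L: "comb u v c \<in> L"
  unfolding comb_def by (intro L_closed L_sum)

lemma comb_exists: "x \<in> L \<Longrightarrow> \<exists>u v c. x = comb u v c"
proof -
  assume "x \<in> L"
  then have "x \<in> span (insert ha (insert hb (e ` G2_roots)))" using span_basis by simp
  then obtain u v where uv: "x - scale u ha - scale v hb \<in> span (e ` G2_roots)"
    by (metis span_breakdown_eq)
  have "span (e ` G2_roots) = {y. \<exists>c. y = (\<Sum>r\<in>G2_roots. scale (c r) (e r))}" (is "_ = ?S")
  proof
    have "subspace ?S"
    proof (rule subspaceI)
      show "0 \<in> ?S" by (auto intro!: exI[of _ "\<lambda>_. 0"])
      fix a b assume "a \<in> ?S" "b \<in> ?S"
      then obtain c d where "a = (\<Sum>r\<in>G2_roots. scale (c r) (e r))" "b = (\<Sum>r\<in>G2_roots. scale (d r) (e r))"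
        by blast
      then show "a + b \<in> ?S"
        by (auto intro!: exI[of _ "\<lambda>r. c r + d r"] simp: scale_left_distrib sum.distrib)
    next
      fix k a assume "a \<in> ?S"
      then obtain c where "a = (\<Sum>r\<in>G2_roots. scale (c r) (e r))" by blast
      then show "scale k a \<in> ?S"
        by (auto intro!: exI[of _ "\<lambda>r. k * c r"] simp: scale_sum_right)
    qed
    moreover have "e ` G2_roots \<subseteq> ?S"
    proof
      fix y assume "y \<in> e ` G2_roots"
      then obtain s where s: "s \<in> G2_roots" "y = e s" by blast
      have "(\<Sum>r\<in>G2_roots. scale (if r = s then 1 else 0) (e r)) = (\<Sum>r\<in>G2_roots. if r = s then e r else 0)"
        by (rule sum.cong) auto
      with s have "y = (\<Sum>r\<in>G2_roots. scale (if r = s then 1 else 0) (e r))"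
        by simp
      then show "y \<in> ?S" by (intro CollectI exI)
    qed
    ultimately show "span (e ` G2_roots) \<subseteq> ?S" by (simp only: span_minimal)
    show "?S \<subseteq> span (e ` G2_roots)"
      by clarify (intro span_sum span_scale span_base imageI)
  qed
  with uv have "x - scale u ha - scale v hb \<in> {y. \<exists>c. y = (\<Sum>r\<in>G2_roots. scale (c r) (e r))}"
    by (simp only:)
  then obtain c where "x - scale u ha - scale v hb = (\<Sum>r\<in>G2_roots. scale (c r) (e r))"
    by (elim CollectE exE)
  then have "x = comb u v c" unfolding comb_def by (simp add: diff_eq_eq add_ac)
  then show ?thesis by (intro exI)
qed

lemma br_eigen_comb:
  assumes h: "h \<in> L" "br h ha = 0" "br h hb = 0"
    and f: "\<And>r. r \<in> G2_roots \<Longrightarrow> br h (e r) = scale (f r) (e r)"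
  shows "br h (comb u v c) = comb 0 0 (\<lambda>r. f r * c r)"
proof -
  let ?s = "\<Sum>r\<in>G2_roots. scale (c r) (e r)"
  have s: "?s \<in> L" by (intro L_sum L_closed)
  have "br h ?s = (\<Sum>r\<in>G2_roots. br h (scale (c r) (e r)))"
    by (rule br_sum_right[OF h(1)]) (intro L_closed)
  also have "\<dots> = (\<Sum>r\<in>G2_roots. scale (f r * c r) (e r))"
  proof (rule sum.cong[OF refl])
    fix r assume r: "r \<in> G2_roots"
    show "br h (scale (c r) (e r)) = scale (f r * c r) (e r)"
      unfolding br_scale_right[OF h(1) basis_in_L(3)[OF r]] f[OF r] scale_scale mult.commute[of "c r"] ..
  qed
  finally have sum: "br h ?s = (\<Sum>r\<in>G2_roots. scale (f r * c r) (e r))" .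
  have "br h (scale u ha + scale v hb + ?s) = br h (scale u ha) + br h (scale v hb) + br h ?s"
    using h(1) s by (simp only: br_add_right L_closed)
  also have "\<dots> = br h ?s"
    by (simp only: br_scale_right h basis_in_L(1,2) scale_zero_right add_0_left)
  finally show ?thesis
    unfolding comb_def sum by simp
qed

lemma br_hb_ha: "br hb ha = 0"
  using br_antisym[OF basis_in_L(1,2)] ha_hb by simp

lemma br_ha_comb: "br ha (comb u v c) = comb 0 0 (\<lambda>r. of_int (fst r) * c r)"
  by (rule br_eigen_comb[OF basis_in_L(1) br_self[OF basis_in_L(1)] ha_hb ha_e])

lemma br_hb_comb: "br hb (comb u v c) = comb 0 0 (\<lambda>r. of_int (snd r) * c r)"
  by (rule br_eigen_comb[OF basis_in_L(2) br_hb_ha br_self[OF basis_in_L(2)] hb_e])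

lemma comb_scale: "scale k (comb u v c) = comb (k * u) (k * v) (\<lambda>r. k * c r)"
  unfolding comb_def by (simp add: scale_right_distrib scale_sum_right)

lemma comb_diff: "comb u v c - comb u' v' c' = comb (u - u') (v - v') (\<lambda>r. c r - c' r)"
  unfolding comb_def by (simp add: scale_left_diff_distrib sum_subtractf algebra_simps)

lemma br_h_e: "r \<in> G2_roots \<Longrightarrow> br (scale u ha + scale v hb) (e r) =
    scale (u * of_int (fst r) + v * of_int (snd r)) (e r)"
proof -
  assume r: "r \<in> G2_roots"
  have "br (scale u ha + scale v hb) (e r) = br (scale u ha) (e r) + br (scale v hb) (e r)"
    by (rule br_add_left) (intro L_closed r)+
  also have "br (scale u ha) (e r) = scale u (br ha (e r))"
    by (rule br_scale_left) (intro L_closed r)+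
  also have "br (scale v hb) (e r) = scale v (br hb (e r))"
    by (rule br_scale_left) (intro L_closed r)+
  finally show ?thesis
    unfolding ha_e[OF r] hb_e[OF r] scale_scale scale_left_distrib .
qed

text \<open>The element \<open>10 ha + hb\<close> is regular: its eigenvalues on the root vectors are distinct and
  nonzero.\<close>

lemma comb_components:
  assumes I: "subspace I" and h: "br (scale 10 ha + hb) ` I \<subseteq> I" and x: "comb u v c \<in> I"
  shows "scale u ha + scale v hb \<in> I" "\<forall>r\<in>G2_roots. scale (c r) (e r) \<in> I"
proof -
  let ?\<mu> = "\<lambda>r :: int \<times> int. of_int (10 * fst r + snd r) :: 'k"
  \<comment> \<open>The index (0, 0) carries the Cartan part, which has eigenvalue 0; the roots have
    the distinct eigenvalues 10 m + n.\<close>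
  let ?y = "\<lambda>r. if r = (0, 0) then scale u ha + scale v hb else scale (c r) (e r)"
  have 0: "(0, 0) \<notin> G2_roots" by (simp add: G2_roots_def)
  have sum: "sum ?y (insert (0, 0) G2_roots) = comb u v c"
  proof -
    have "sum ?y G2_roots = (\<Sum>r\<in>G2_roots. scale (c r) (e r))"
      by (rule sum.cong) (use 0 in auto)
    then show ?thesis using 0 by (simp add: comb_def)
  qed
  have "\<forall>i\<in>insert (0, 0) G2_roots. ?y i \<in> I"
  proof (rule eigenvector_components[where h = "scale 10 ha + hb" and \<mu> = ?\<mu>])
    show "inj_on ?\<mu> (insert (0, 0) G2_roots)"
      unfolding inj_on_def of_int_eq_iff by (auto simp: G2_roots_def)
    show "?y i \<in> L \<and> br (scale 10 ha + hb) (?y i) = scale (?\<mu> i) (?y i)" if "i \<in> insert (0, 0) G2_roots" for i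
    proof (cases "i = (0, 0)")
      case True
      have "br hb ha = 0" using br_antisym[of ha hb] ha_hb basis_in_L by simp
      with True show ?thesis
        by (simp add: L_closed br_add_left br_add_right br_scale_left br_scale_right br_self ha_hb)
    next
      case False
      with that have "i \<in> G2_roots" by simp
      with False br_h_e[of i 10 1] show ?thesis
        by (simp add: L_closed br_scale_right scale_left_commute)
    qed
  qed (use I h x sum in \<open>auto intro!: L_closed\<close>)
  then have *: "?y i \<in> I" if "i \<in> insert (0, 0) G2_roots" for i
    using that by blast
  show "scale u ha + scale v hb \<in> I" using *[of "(0, 0)"] by simp
  show "\<forall>r\<in>G2_roots. scale (c r) (e r) \<in> I"
  proof
    fix r assume r: "r \<in> G2_roots"
    then have "r \<noteq> (0, 0)" using 0 by blast
    then show "scale (c r) (e r) \<in> I" using *[of r] r by simp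
  qed
qed

lemma ha_hb_independent: "scale u ha + scale v hb = 0 \<Longrightarrow> u = 0 \<and> v = 0"
proof -
  assume 0: "scale u ha + scale v hb = 0"
  have r: "(1, 0) \<in> G2_roots" "(0, 1) \<in> G2_roots" by (simp_all add: G2_roots_def)
  have "scale u (e (1, 0)) = 0" "scale v (e (0, 1)) = 0"
    using br_h_e[OF r(1), of u v] br_h_e[OF r(2), of u v]
    unfolding 0 by (simp_all add: br_zero_left basis_in_L r)
  then show ?thesis using e_nonzero[OF r(1)] e_nonzero[OF r(2)] by simp
qed

text \<open>The zero subspace is invariant, so splitting into eigencomponents there amounts to
  linear independence.\<close>

lemma comb_zero: "comb u v c = 0 \<Longrightarrow> u = 0 \<and> v = 0 \<and> (\<forall>r\<in>G2_roots. c r = 0)"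
proof -
  assume "comb u v c = 0"
  moreover have "br (scale 10 ha + hb) ` {0} \<subseteq> {0}"
    using br_zero_right[of "scale 10 ha + hb"] by (simp add: L_closed)
  ultimately have "scale u ha + scale v hb \<in> {0}" "\<forall>r\<in>G2_roots. scale (c r) (e r) \<in> {0}"
    using comb_components[OF subspace_single_0, of u v c] by simp_all
  with ha_hb_independent[of u v] e_nonzero show ?thesis by auto
qed

lemma comb_eq: "comb u v c = comb u' v' c' \<Longrightarrow> u = u' \<and> v = v' \<and> (\<forall>r\<in>G2_roots. c r = c' r)"
proof -
  assume "comb u v c = comb u' v' c'"
  then have "comb u v c - comb u' v' c' = 0" by simp
  then have "comb (u - u') (v - v') (\<lambda>r. c r - c' r) = 0"
    by (simp only: comb_diff)
  from comb_zero[OF this] show ?thesis by simp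
qed

lemma simple_G2: simple
  unfolding simple_def
proof (intro conjI allI impI)
  have r: "(1, 0) \<in> G2_roots" by (simp add: G2_roots_def)
  show "\<exists>x\<in>L. \<exists>y\<in>L. br x y \<noteq> 0"
    using ha_e[OF r] e_nonzero[OF r] basis_in_L r by (intro bexI[of _ ha] bexI[of _ "e (1, 0)"]) auto
  fix I assume "lie_ideal I"
  then have I: "subspace I" "I \<subseteq> L" and ideal: "\<And>x y. x \<in> L \<Longrightarrow> y \<in> I \<Longrightarrow> br x y \<in> I"
    by (auto simp: lie_ideal_def)
  show "I = {0} \<or> I = L"
  proof (rule disjCI)
    assume "I \<noteq> L"
    show "I = {0}"
    proof (rule ccontr)
      assume "I \<noteq> {0}"
      then obtain x where x: "x \<in> I" "x \<noteq> 0" using subspace_0[OF I(1)] by blast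
      obtain u v c where xc: "x = comb u v c" using comb_exists I(2) x(1) by blast
      have comp: "scale u ha + scale v hb \<in> I" "\<forall>r\<in>G2_roots. scale (c r) (e r) \<in> I"
        using comb_components[OF I(1) image_subsetI, of u v c] ideal[of "scale 10 ha + hb"] x(1) xc
        by (simp_all add: L_closed)
      \<comment> \<open>Either x has a nonzero root component, which lies in I, or x is in the
        Cartan part; in the latter case a root not vanishing on x brings its root vector into
        I.\<close>
      have "\<exists>r\<in>G2_roots. e r \<in> I"
      proof (cases "\<exists>r\<in>G2_roots. c r \<noteq> 0")
        case True
        then obtain r where r: "r \<in> G2_roots" "c r \<noteq> 0" by blast
        then have "e r = scale (inverse (c r)) (scale (c r) (e r))" by simp
        with comp(2) r(1) show ?thesis using subspace_scale[OF I(1)] by metis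
      next
        case False
        then have "x = scale u ha + scale v hb" using xc by (simp add: comb_def)
        then have "u \<noteq> 0 \<or> v \<noteq> 0" using x(2) by auto
        then obtain r where r: "r \<in> G2_roots" "u * of_int (fst r) + v * of_int (snd r) \<noteq> 0"
        proof
          assume "u \<noteq> 0" then show ?thesis by (intro that[of "(1, 0)"]) (auto simp: G2_roots_def)
        next
          assume "v \<noteq> 0" then show ?thesis by (intro that[of "(0, 1)"]) (auto simp: G2_roots_def)
        qed
        let ?k = "u * of_int (fst r) + v * of_int (snd r)"
        have "br (e r) (scale u ha + scale v hb) \<in> I" using ideal basis_in_L(3)[OF r(1)] comp(1) by blast
        moreover have "br (e r) (scale u ha + scale v hb) = - scale ?k (e r)"
          using br_antisym[of "scale u ha + scale v hb" "e r"] br_h_e[OF r(1)] r(1) by (simp add: L_closed)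
        ultimately have "scale ?k (e r) \<in> I" using subspace_neg[OF I(1)] by (metis minus_minus)
        moreover have "e r = scale (inverse ?k) (scale ?k (e r))" using r(2) by simp
        ultimately show ?thesis using r(1) subspace_scale[OF I(1)] by metis
      qed
      then obtain r0 where r0: "r0 \<in> G2_roots" "e r0 \<in> I" by blast
      have all: "\<forall>r\<in>G2_roots. e r \<in> I"
      proof (rule G2_cycle_all[OF r0(1), of "\<lambda>r. e r \<in> I", OF r0(2)])
        fix r s assume rs: "(r, s) \<in> G2_cycle" and "e r \<in> I"
        obtain k where k: "k \<noteq> 0" "br (e (s - r)) (e r) = scale k (e s)" using cycle[OF rs] by blast
        have "s - r \<in> G2_roots" using rs by (auto simp: G2_cycle_def G2_roots_def)
        then have "scale k (e s) \<in> I" using k ideal basis_in_L(3) \<open>e r \<in> I\<close> by metis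
        moreover have "e s = scale (inverse k) (scale k (e s))" using k by simp
        ultimately show "e s \<in> I" using subspace_scale[OF I(1)] by metis
      qed
      obtain a b a' b' where ab: "a * b' \<noteq> b * a'" "br (e (-1, 0)) (e (1, 0)) = scale a ha + scale b hb"
        "br (e (0, -1)) (e (0, 1)) = scale a' ha + scale b' hb"
        using opposite by blast
      have r: "(1, 0) \<in> G2_roots" "(0, 1) \<in> G2_roots" "(-1, 0) \<in> G2_roots" "(0, -1) \<in> G2_roots"
        by (simp_all add: G2_roots_def)
      let ?p = "scale a ha + scale b hb" and ?q = "scale a' ha + scale b' hb"
      have pq: "?p \<in> I" "?q \<in> I"
        using ideal[OF basis_in_L(3)[OF r(3)], of "e (1, 0)"] ideal[OF basis_in_L(3)[OF r(4)], of "e (0, 1)"]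
          all r ab(2,3) by auto
      let ?d = "a * b' - b * a'"
      \<comment> \<open>Cramer's rule for the two brackets of opposite root vectors.\<close>
      have "scale (inverse ?d) (scale b' ?p - scale b ?q) = ha"
        "scale (inverse ?d) (scale a ?q - scale a' ?p) = hb"
      proof -
        have "scale b' ?p - scale b ?q = scale ?d ha" "scale a ?q - scale a' ?p = scale ?d hb"
          by (simp_all add: scale_right_distrib scale_left_diff_distrib mult.commute)
        then show "scale (inverse ?d) (scale b' ?p - scale b ?q) = ha"
          "scale (inverse ?d) (scale a ?q - scale a' ?p) = hb"
          using ab(1) by simp_all
      qed
      then have "ha \<in> I" "hb \<in> I"
        using subspace_scale[OF I(1) subspace_diff[OF I(1) subspace_scale[OF I(1) pq(1)] subspace_scale[OF I(1) pq(2)]], of "inverse ?d" b' b]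
          subspace_scale[OF I(1) subspace_diff[OF I(1) subspace_scale[OF I(1) pq(2)] subspace_scale[OF I(1) pq(1)]], of "inverse ?d" a a']
        by simp_all
      then have "L \<subseteq> I"
        unfolding span_basis using all I(1) by (intro span_minimal) auto
      with \<open>I \<noteq> L\<close> I(2) show False by blast
    qed
  qed
qed

section \<open>The Cartan subalgebra and its roots\<close>

definition H where "H = {scale u ha + scale v hb | u v. True}"

lemma comb_H: "scale u ha + scale v hb = comb u v (\<lambda>_. 0)"
  by (simp add: comb_def)

lemma subspace_H: "subspace H"
proof (rule subspaceI)
  show "0 \<in> H" unfolding H_def by (auto intro!: exI[of _ 0])
  fix x y assume "x \<in> H" "y \<in> H"
  then obtain u v u' v' where "x = scale u ha + scale v hb" "y = scale u' ha + scale v' hb"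
    unfolding H_def by blast
  then have "x + y = scale (u + u') ha + scale (v + v') hb"
    by (simp add: scale_left_distrib algebra_simps)
  then show "x + y \<in> H" unfolding H_def by blast
next
  fix k x assume "x \<in> H"
  then obtain u v where "x = scale u ha + scale v hb" unfolding H_def by blast
  then have "scale k x = scale (k * u) ha + scale (k * v) hb"
    by (simp add: scale_right_distrib)
  then show "scale k x \<in> H" unfolding H_def by blast
qed

lemma H_sub: "H \<subseteq> L"
  unfolding H_def by (auto intro!: L_closed)

lemma br_H: "h \<in> H \<Longrightarrow> h' \<in> H \<Longrightarrow> br h h' = 0"
proof -
  assume "h \<in> H" "h' \<in> H"
  then obtain u v u' v' where h: "h = scale u ha + scale v hb" "h' = comb u' v' (\<lambda>_. 0)"
    unfolding H_def comb_H by blast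
  have "comb 0 0 (\<lambda>_. 0) = 0" by (simp add: comb_def)
  then show ?thesis
    unfolding h(1) by (simp add: br_add_left br_scale_left L_closed comb_in_L h(2) br_ha_comb br_hb_comb)
qed

lemma in_H: "ha \<in> H" "hb \<in> H"
proof -
  have "ha = scale 1 ha + scale 0 hb" "hb = scale 0 ha + scale 1 hb" by simp_all
  then show "ha \<in> H" "hb \<in> H" unfolding H_def by blast+
qed

lemma cartan_H: "cartan_subalgebra H"
  unfolding cartan_subalgebra_def
proof (intro conjI)
  show "subalgebra H"
    unfolding subalgebra_def using subspace_H H_sub br_H subspace_0[OF subspace_H] by auto
  have "{br x y | x y. x \<in> H \<and> y \<in> H} \<subseteq> {0}" using br_H by auto
  then have "bracket_span H H \<subseteq> {0}"
    unfolding bracket_span_def by (rule span_minimal[OF _ subspace_single_0])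
  moreover have "0 \<in> bracket_span H H" unfolding bracket_span_def by (rule span_zero)
  ultimately have "bracket_span H H = {0}" by blast
  then have "(bracket_span H ^^ 1) H = {0}" by simp
  then show "nilpotent H" unfolding nilpotent_def by blast
  show "normalizer H = H"
  proof
    show "H \<subseteq> normalizer H"
      unfolding normalizer_def using H_sub br_H subspace_0[OF subspace_H] by auto
    show "normalizer H \<subseteq> H"
    proof
      fix x assume "x \<in> normalizer H"
      then have x: "x \<in> L" "br x ha \<in> H" "br x hb \<in> H" unfolding normalizer_def using in_H by auto
      obtain u v c where xc: "x = comb u v c" using comb_exists x(1) by blast
      \<comment> \<open>Bracketing with \<open>ha\<close> or \<open>hb\<close> multiplies each root
        coefficient by a coordinate of the root. If the result lies in \<open>H\<close>, these
        products vanish, and every root has a nonzero coordinate.\<close>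
      have *: "of_int k * c r = 0"
        if h: "h \<in> L" "br x h \<in> H" "br h x = comb 0 0 (\<lambda>r. of_int (f r) * c r)" "r \<in> G2_roots" "k = f r"
        for f k r h
      proof -
        have "br h x \<in> H" using br_antisym[OF x(1) h(1)] h(2) subspace_neg[OF subspace_H] by auto
        then obtain u' v' where "comb 0 0 (\<lambda>r. of_int (f r) * c r) = comb u' v' (\<lambda>_. 0)"
          unfolding h(3) H_def comb_H by blast
        from comb_eq[OF this] h(4,5) show ?thesis by auto
      qed
      have "c r = 0" if r: "r \<in> G2_roots" for r
        using *[OF basis_in_L(1) x(2) br_ha_comb[of u v c, folded xc] r refl]
          *[OF basis_in_L(2) x(3) br_hb_comb[of u v c, folded xc] r refl] r
        by (auto simp: G2_roots_def)
      then have "x = scale u ha + scale v hb" unfolding xc comb_def by simp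
      then show "x \<in> H" unfolding H_def by blast
    qed
  qed
qed

lemma splitting_H: "splitting H"
  unfolding splitting_def
proof
  fix h assume h: "h \<in> H"
  then obtain u v where uv: "h = scale u ha + scale v hb" unfolding H_def by blast
  let ?E = "{v \<in> L. \<exists>c. br h v = scale c v}"
  have "insert ha (insert hb (e ` G2_roots)) \<subseteq> ?E"
  proof -
    have "ha \<in> ?E" "hb \<in> ?E"
      using br_H[OF h in_H(1)] br_H[OF h in_H(2)] basis_in_L by (auto intro!: exI[of _ 0])
    moreover have "e r \<in> ?E" if "r \<in> G2_roots" for r
      using br_h_e[OF that, of u v] basis_in_L(3)[OF that] unfolding uv by blast
    ultimately show ?thesis by blast
  qed
  then have "L \<subseteq> span ?E" by (subst span_basis) (rule span_mono)
  moreover have "span ?E \<subseteq> L" using subspace_L by (intro span_minimal) auto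
  ultimately show "span ?E = L" by blast
qed

text \<open>Coordinates with respect to \<open>ha\<close> and \<open>hb\<close>. As these are dual
  to the simple roots, the two coordinate functionals are the simple roots themselves.\<close>

definition root_a :: "'v \<Rightarrow> 'k" where
  "root_a h = (if h \<in> H then THE u. \<exists>v. h = scale u ha + scale v hb else 0)"
definition root_b :: "'v \<Rightarrow> 'k" where
  "root_b h = (if h \<in> H then THE v. \<exists>u. h = scale u ha + scale v hb else 0)"

lemma root_eval: "root_a (scale u ha + scale v hb) = u" "root_b (scale u ha + scale v hb) = v"
proof -
  have H: "scale u ha + scale v hb \<in> H" unfolding H_def by blast
  have eq: "u' = u \<and> v' = v" if "scale u ha + scale v hb = scale u' ha + scale v' hb" for u' v'
    using comb_eq[of u v "\<lambda>_. 0" u' v' "\<lambda>_. 0"] that unfolding comb_H by simp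
  show "root_a (scale u ha + scale v hb) = u"
    unfolding root_a_def using H by (simp, intro the_equality) (use eq in blast)+
  show "root_b (scale u ha + scale v hb) = v"
    unfolding root_b_def using H by (simp, intro the_equality) (use eq in blast)+
qed

lemma root_outside: "h \<notin> H \<Longrightarrow> root_a h = 0" "h \<notin> H \<Longrightarrow> root_b h = 0"
  by (simp_all add: root_a_def root_b_def)

lemma root_ha_hb: "root_a ha = 1" "root_b ha = 0" "root_a hb = 0" "root_b hb = 1"
  using root_eval[of 1 0] root_eval[of 0 1] by simp_all

lemma dual_comb: "(\<lambda>h. a * root_a h + b * root_b h) \<in> dual H"
proof -
  have "a * root_a (x + y) + b * root_b (x + y) = a * root_a x + b * root_b x + (a * root_a y + b * root_b y)"
    if "x \<in> H" "y \<in> H" for x y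
  proof -
    from that obtain u v u' v' where xy: "x = scale u ha + scale v hb" "y = scale u' ha + scale v' hb"
      unfolding H_def by blast
    have s: "x + y = scale (u + u') ha + scale (v + v') hb"
      unfolding xy by (simp add: scale_left_distrib algebra_simps)
    show ?thesis unfolding s unfolding xy root_eval by (simp add: algebra_simps)
  qed
  moreover have "a * root_a (scale c x) + b * root_b (scale c x) = c * (a * root_a x + b * root_b x)"
    if "x \<in> H" for x c
  proof -
    from that obtain u v where x: "x = scale u ha + scale v hb" unfolding H_def by blast
    have s: "scale c x = scale (c * u) ha + scale (c * v) hb"
      unfolding x by (simp add: scale_right_distrib)
    show ?thesis unfolding s unfolding x root_eval by (simp add: algebra_simps)
  qed
  ultimately show ?thesis unfolding dual_def by (auto simp: root_outside)
qed

lemma dual_H: "dual H = {\<lambda>h. a * root_a h + b * root_b h | a b. True}"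
proof
  show "dual H \<subseteq> {\<lambda>h. a * root_a h + b * root_b h | a b. True}"
  proof
    fix f assume f: "f \<in> dual H"
    have "f h = f ha * root_a h + f hb * root_b h" for h
    proof (cases "h \<in> H")
      case True
      then obtain u v where h: "h = scale u ha + scale v hb" unfolding H_def by blast
      have "f h = u * f ha + v * f hb"
        using f in_H subspace_scale[OF subspace_H] unfolding dual_def h by auto
      then show ?thesis unfolding h root_eval by (simp add: algebra_simps)
    next
      case False
      then show ?thesis using f by (simp add: dual_def root_outside)
    qed
    then show "f \<in> {\<lambda>h. a * root_a h + b * root_b h | a b. True}" by auto
  qed
qed (use dual_comb in auto)

lemma roots_H: "roots H = {\<lambda>h. of_int m * root_a h + of_int n * root_b h | m n :: int. (m, n) \<in> G2_roots}"
proof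
  show "{\<lambda>h. of_int m * root_a h + of_int n * root_b h | m n :: int. (m, n) \<in> G2_roots} \<subseteq> roots H"
  proof clarify
    fix m n :: int assume r: "(m, n) \<in> G2_roots"
    let ?f = "\<lambda>h. of_int m * root_a h + of_int n * root_b h"
    have "m \<noteq> 0 \<or> n \<noteq> 0" using r by (auto simp: G2_roots_def)
    then have "?f ha \<noteq> 0 \<or> ?f hb \<noteq> 0" by (simp add: root_ha_hb)
    moreover have "br h (e (m, n)) = scale (?f h) (e (m, n))" if "h \<in> H" for h
    proof -
      from that obtain u v where h: "h = scale u ha + scale v hb" unfolding H_def by blast
      show ?thesis unfolding h root_eval using br_h_e[OF r, of u v] by (simp add: mult.commute)
    qed
    then have "e (m, n) \<in> root_space H ?f"
      unfolding root_space_def using basis_in_L(3)[OF r] by blast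
    then have "root_space H ?f \<noteq> {0}" using e_nonzero[OF r] by blast
    ultimately show "?f \<in> roots H" unfolding roots_def using dual_comb in_H by blast
  qed
  show "roots H \<subseteq> {\<lambda>h. of_int m * root_a h + of_int n * root_b h | m n :: int. (m, n) \<in> G2_roots}"
  proof
    fix f assume f: "f \<in> roots H"
    then obtain a b where ab: "f = (\<lambda>h. a * root_a h + b * root_b h)"
      unfolding roots_def dual_H by blast
    have "0 \<in> root_space H f"
      unfolding root_space_def using L_closed(3) H_sub br_zero_right by auto
    with f obtain x where x: "x \<in> root_space H f" "x \<noteq> 0" unfolding roots_def by blast
    then have xL: "x \<in> L" and ev: "br ha x = scale a x" "br hb x = scale b x"
      using in_H by (auto simp: root_space_def ab root_ha_hb)
    obtain u v c where xc: "x = comb u v c" using comb_exists xL by blast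
    \<comment> \<open>Comparison of basis coordinates: a nonzero functional leaves no Cartan part in
      x, and wherever \<open>c r\<close> is nonzero, a and b are the coordinates of r.\<close>
    have 1: "a * u = 0" "a * v = 0" "\<forall>r\<in>G2_roots. of_int (fst r) * c r = a * c r"
      using comb_eq[OF ev(1)[unfolded xc br_ha_comb comb_scale]] by auto
    have 2: "b * u = 0" "b * v = 0" "\<forall>r\<in>G2_roots. of_int (snd r) * c r = b * c r"
      using comb_eq[OF ev(2)[unfolded xc br_hb_comb comb_scale]] by auto
    have "a \<noteq> 0 \<or> b \<noteq> 0" using f unfolding roots_def ab by auto
    with 1 2 have uv: "u = 0" "v = 0" by auto
    have "\<exists>r\<in>G2_roots. c r \<noteq> 0"
    proof (rule ccontr)
      assume "\<not> ?thesis"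
      then have "x = 0" unfolding xc comb_def uv by simp
      with x(2) show False by simp
    qed
    then obtain r where r: "r \<in> G2_roots" "c r \<noteq> 0" by blast
    then have "a = of_int (fst r)" "b = of_int (snd r)" using 1(3) 2(3) by auto
    then show "f \<in> {\<lambda>h. of_int m * root_a h + of_int n * root_b h | m n :: int. (m, n) \<in> G2_roots}"
      unfolding ab using r(1) by (cases r) auto
  qed
qed

lemma roots_of_type_G2_H: "roots_of_type_G2 H"
  unfolding roots_of_type_G2_def
proof (intro bexI conjI allI impI)
  show "dual H = {\<lambda>h. a * root_a h + b * root_b h | a b. True}" by (rule dual_H)
  show "roots H = {\<lambda>h. of_int m * root_a h + of_int n * root_b h | m n :: int.
       (m, n) \<in> {(1, 0), (0, 1), (1, 1), (2, 1), (3, 1), (3, 2),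
                  (-1, 0), (0, -1), (-1, -1), (-2, -1), (-3, -1), (-3, -2)}}"
    using roots_H unfolding G2_roots_def .
  show "root_a \<in> dual H" "root_b \<in> dual H" using dual_comb[of 1 0] dual_comb[of 0 1] by simp_all
  fix a b assume 0: "\<forall>h. a * root_a h + b * root_b h = 0"
  show "a = 0" "b = 0" using 0[rule_format, of ha] 0[rule_format, of hb] by (simp_all add: root_ha_hb)
qed

theorem split_simple_G2: "split_simple_G2"
  unfolding split_simple_G2_def finite_dimensional_def
  using simple_G2 cartan_H splitting_H roots_of_type_G2_H span_basis
  by (intro conjI exI[of _ "insert ha (insert hb (e ` G2_roots))"] exI[of _ H]) auto

theorem dim_L: "dim L = 14"
proof -
  let ?B = "insert ha (insert hb (e ` G2_roots))"
  have s: "e r = comb 0 0 (\<lambda>s. if s = r then 1 else 0)" if "r \<in> G2_roots" for r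
  proof -
    have "(\<Sum>s\<in>G2_roots. scale (if s = r then 1 else 0) (e s)) = (\<Sum>s\<in>G2_roots. if s = r then e s else 0)"
      by (rule sum.cong) auto
    with that show ?thesis by (simp add: comb_def)
  qed
  have h: "ha = comb 1 0 (\<lambda>_. 0)" "hb = comb 0 1 (\<lambda>_. 0)" by (simp_all add: comb_def)
  have inj: "inj_on e G2_roots"
  proof
    fix r t assume "r \<in> G2_roots" "t \<in> G2_roots" "e r = e t"
    from comb_eq[OF this(3)[unfolded s[OF this(1)] s[OF this(2)]]] this show "r = t"
      by (metis zero_neq_one)
  qed
  have ne: "ha \<noteq> hb" "ha \<notin> e ` G2_roots" "hb \<notin> e ` G2_roots"
  proof -
    show "ha \<noteq> hb" using comb_eq h by (metis zero_neq_one)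
    show "ha \<notin> e ` G2_roots" "hb \<notin> e ` G2_roots" using comb_eq h s by (metis imageE zero_neq_one)+
  qed
  have "card G2_roots = 12" by (simp add: G2_roots_def)
  then have card: "card ?B = 14" using ne card_image[OF inj] by simp
  have "independent ?B"
  proof (rule independent_if_scalars_zero)
    fix f x assume 0: "(\<Sum>x\<in>?B. scale (f x) x) = 0" and x: "x \<in> ?B"
    have "(\<Sum>x\<in>?B. scale (f x) x) = comb (f ha) (f hb) (\<lambda>r. f (e r))"
      using ne by (simp add: comb_def sum.reindex[OF inj] add.assoc)
    with 0 have "comb (f ha) (f hb) (\<lambda>r. f (e r)) = 0" by simp
    from comb_zero[OF this] x show "f x = 0" by auto
  qed simp
  then show ?thesis using dim_span_eq_card_independent card span_basis by metis
qed

end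

section \<open>The symmetry algebra\<close>

lemma symmetry_algebra_eq:
  assumes U: "open U"
  shows "symmetry_algebra U contact_form Upsilon = ham_field U ` {f. det_eqs U f}"
proof
  show "symmetry_algebra U contact_form Upsilon \<subseteq> ham_field U ` {f. det_eqs U f}"
  proof
    fix X assume X: "X \<in> symmetry_algebra U contact_form Upsilon"
    then have "vector_field_on U X" unfolding symmetry_algebra_def by blast
    moreover note symmetry_imp_ham[OF U X]
    ultimately have "X = ham_field U (\<lambda>P. contact_form P (X P))" "det_eqs U (\<lambda>P. contact_form P (X P))"
      by (auto simp: fun_eq_iff ham_field_def restrict_field_def vector_field_on_def)
    then show "X \<in> ham_field U ` {f. det_eqs U f}" by blast
  qed
  show "ham_field U ` {f. det_eqs U f} \<subseteq> symmetry_algebra U contact_form Upsilon"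
    by (auto intro!: ham_in_symmetry_algebra[OF U vector_field_ham_field[OF U]] dest: det_eqs_smooth
        simp: ham_field_nth)
qed

lemma subspace_symmetry_algebra:
  fixes U :: "('k::real_or_complex ^ 5) set"
  assumes U: "open U"
  shows "field_vs.subspace (symmetry_algebra U contact_form Upsilon)"
  unfolding symmetry_algebra_eq[OF U]
proof (rule field_vs.subspaceI)
  have zero: "(0 :: 'k ^ 5 \<Rightarrow> 'k ^ 5) = ham_field U (\<lambda>P. 0)"
    by (auto simp: fun_eq_iff ham_field_def restrict_field_def ham_def partial_const fr_const)
  show "(0 :: 'k ^ 5 \<Rightarrow> 'k ^ 5) \<in> ham_field U ` {f. det_eqs U f}"
    unfolding zero using det_eqs_lin[OF U det_eqs_subset[OF det_eqs_H(6)] det_eqs_subset[OF det_eqs_H(6)], of 0 0]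
    by simp
  fix X Y :: "'k ^ 5 \<Rightarrow> 'k ^ 5" and c
  assume "X \<in> ham_field U ` {f. det_eqs U f}"
  then obtain f where f: "det_eqs U f" "X = ham_field U f" by blast
  have "det_eqs U (\<lambda>P. c * f P)" using det_eqs_lin[OF U f(1) f(1), of c 0] by simp
  then show "field_scale c X \<in> ham_field U ` {f. det_eqs U f}"
    unfolding f(2) ham_field_cmult[OF det_eqs_smooth[OF f(1)], symmetric] by blast
  assume "Y \<in> ham_field U ` {f. det_eqs U f}"
  then obtain g where g: "det_eqs U g" "Y = ham_field U g" by blast
  have "det_eqs U (\<lambda>P. f P + g P)" using det_eqs_lin[OF U f(1) g(1), of 1 1] by simp
  then show "X + Y \<in> ham_field U ` {f. det_eqs U f}"
    unfolding f(2) g(2) ham_field_add[OF det_eqs_smooth[OF f(1)] det_eqs_smooth[OF g(1)], symmetric]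
    by blast
qed

lemmas smooth_H = det_eqs_H[THEN det_eqs_smooth]

lemma H_ha_eq: "H_ha = (\<lambda>P. H_h1 P + 3/2 * H_hb P)"
  by (rule ext) (simp add: H_ha_def H_hb_def H_h1_def H_E2_def polynomial_simps)

lemma smooth_H_ha_hb: "smooth_on UNIV H_ha" "smooth_on UNIV H_hb"
  unfolding H_ha_eq H_hb_def by (intro smooth_polynomial smooth_H)+

lemmas smooth_H_on = smooth_H[THEN smooth_on_subset, OF subset_UNIV]
  smooth_H_ha_hb[THEN smooth_on_subset, OF subset_UNIV]

definition root_ham :: "int \<times> int \<Rightarrow> 'k::real_or_complex ^ 5 \<Rightarrow> 'k" where
  "root_ham r = (if r = (1, 0) then H_S3 else if r = (0, 1) then H_L10 else if r = (1, 1) then H_S11 else if r = (2, 1) then H_S1 else if r = (3, 1) then H_L2 else if r = (3, 2) then H_L12 else if r = (-1, 0) then H_S9 else if r = (0, -1) then H_L4 else if r = (-1, -1) then H_S5 else if r = (-2, -1) then H_S7 else if r = (-3, -1) then H_L8 else H_L6)"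

lemma root_ham_simps:
  "root_ham (1, 0) = H_S3"
  "root_ham (0, 1) = H_L10"
  "root_ham (1, 1) = H_S11"
  "root_ham (2, 1) = H_S1"
  "root_ham (3, 1) = H_L2"
  "root_ham (3, 2) = H_L12"
  "root_ham (-1, 0) = H_S9"
  "root_ham (0, -1) = H_L4"
  "root_ham (-1, -1) = H_S5"
  "root_ham (-2, -1) = H_S7"
  "root_ham (-3, -1) = H_L8"
  "root_ham (-3, -2) = H_L6"
  by (simp_all add: root_ham_def)

definition basis_ham :: "('k::real_or_complex ^ 5 \<Rightarrow> 'k) list" where
  "basis_ham = [H_S3, H_L10, H_S11, H_S1, H_L2, H_L12, H_S9, H_L4, H_S5, H_S7, H_L8, H_L6, H_ha, H_hb]"

lemma set_basis_ham: "set basis_ham = insert H_ha (insert H_hb (root_ham ` G2_roots))"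
  by (auto simp: basis_ham_def G2_roots_def root_ham_simps)

lemma smooth_basis_ham: "f \<in> set basis_ham \<Longrightarrow> smooth_on U f"
  unfolding basis_ham_def by (auto intro: smooth_H_on)

text \<open>Extends the bracket table above the diagonal to all pairs; symmetry of \<open>R\<close>
  comes from antisymmetry of the bracket.\<close>

lemma sorted_wrt_all:
  assumes "sorted_wrt R xs" "\<And>x. R x x" "\<And>x y. R x y \<Longrightarrow> R y x"
  shows "\<forall>x\<in>set xs. \<forall>y\<in>set xs. R x y"
  using assms(1) by (induction xs) (auto intro: assms(2,3))

lemma lagrange_bracket_antisym:
  "lagrange_bracket g f = (\<lambda>P. - 1 * lagrange_bracket f g P)" "lagrange_bracket f f = (\<lambda>P. 0)"
  by (simp_all add: lagrange_bracket_def fun_eq_iff algebra_simps)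

text \<open>Membership in a span of fields, expressed for Hamiltonians. Smoothness is included
  because \<open>ham_field\<close> is linear on smooth functions.\<close>

definition ham_span :: "('k::real_or_complex ^ 5) set \<Rightarrow> ('k ^ 5 \<Rightarrow> 'k ^ 5) set \<Rightarrow> ('k ^ 5 \<Rightarrow> 'k) set" where
  "ham_span U S = {f. smooth_on U f \<and> ham_field U f \<in> field_vs.span S}"

lemma ham_span_add: "open U \<Longrightarrow> f \<in> ham_span U S \<Longrightarrow> g \<in> ham_span U S \<Longrightarrow> (\<lambda>P. f P + g P) \<in> ham_span U S"
  by (simp add: ham_span_def ham_field_add field_vs.span_add smooth_add)

lemma ham_span_cmult: "open U \<Longrightarrow> f \<in> ham_span U S \<Longrightarrow> (\<lambda>P. c * f P) \<in> ham_span U S"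
  by (simp add: ham_span_def ham_field_cmult field_vs.span_scale smooth_mult smooth_const)

lemma ham_span_zero: "open U \<Longrightarrow> f \<in> ham_span U S \<Longrightarrow> (\<lambda>P. 0) \<in> ham_span U S"
  using ham_span_cmult[of U f S 0] by simp

lemma ham_span_basis: "f \<in> set basis_ham \<Longrightarrow> f \<in> ham_span U (ham_field U ` set basis_ham)"
  by (simp add: ham_span_def smooth_basis_ham field_vs.span_base)

lemma lagrange_bracket_basis:
  assumes U: "open U"
  shows "\<forall>f\<in>set basis_ham. \<forall>g\<in>set basis_ham. lagrange_bracket f g \<in> ham_span U (ham_field U ` set basis_ham)"
proof -
  define M where "M = ham_span U (ham_field U ` set (basis_ham :: ('a ^ 5 \<Rightarrow> 'a) list))"
  have H: "H_S3 \<in> M" "H_L10 \<in> M" "H_S11 \<in> M" "H_S1 \<in> M" "H_L2 \<in> M" "H_L12 \<in> M" "H_S9 \<in> M" "H_L4 \<in> M" "H_S5 \<in> M" "H_S7 \<in> M" "H_L8 \<in> M" "H_L6 \<in> M" "H_ha \<in> M" "H_hb \<in> M"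
    unfolding M_def by (rule ham_span_basis, simp add: basis_ham_def)+
  have add: "(\<lambda>P. f P + g P) \<in> M" if "f \<in> M" "g \<in> M" for f g
    using that ham_span_add[OF U] unfolding M_def by blast
  have cmult: "(\<lambda>P. c * f P) \<in> M" if "f \<in> M" for f c
    using that ham_span_cmult[OF U] unfolding M_def by blast
  have zero: "(\<lambda>P. 0) \<in> M"
    using H(1) ham_span_zero[OF U] unfolding M_def by blast
  note intros = add cmult zero H
  show ?thesis
    unfolding M_def[symmetric]
  proof (rule sorted_wrt_all)
  show "sorted_wrt (\<lambda>f g. lagrange_bracket f g \<in> M) basis_ham"
    unfolding basis_ham_def sorted_wrt.simps list.set ball_simps
      lagrange_H_S3 lagrange_H_L10 lagrange_H_S11 lagrange_H_S1 lagrange_H_L2 lagrange_H_L12 lagrange_H_S9 lagrange_H_L4 lagrange_H_S5 lagrange_H_S7 lagrange_H_L8 lagrange_H_L6 lagrange_H_ha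
    by (intro conjI TrueI intros)
  show "lagrange_bracket f f \<in> M" for f
    unfolding lagrange_bracket_antisym(2) by (intro intros)
  show "lagrange_bracket g f \<in> M" if "lagrange_bracket f g \<in> M" for f g
    unfolding lagrange_bracket_antisym(1)[of g f] using that by (intro intros)
  qed
qed

text \<open>Closure is extended from the basis to its span, first in the left argument, then in the
  right one. Bilinearity holds for smooth fields, so the subspaces in these inductions carry
  \<open>vector_field_on\<close> along.\<close>

lemma bracket_in_span:
  fixes U :: "('k::real_or_complex ^ 5) set"
  assumes U: "open U"
  defines "S \<equiv> ham_field U ` set basis_ham"
  assumes X: "X \<in> field_vs.span S" and Y: "Y \<in> field_vs.span S"
  shows "vector_field_on U X" "lie_bracket U X Y \<in> field_vs.span S"
proof -
  have S: "vector_field_on U Z" if "Z \<in> S" for Z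
    using that smooth_basis_ham vector_field_ham_field[OF U] unfolding S_def by auto
  have sub: "field_vs.subspace {Z. vector_field_on U Z}"
    by (rule field_vs.subspaceI)
      (auto intro: vector_field_on_zero[OF U] vector_field_on_add[OF U] vector_field_on_scale[OF U])
  have V: "vector_field_on U Z" if "Z \<in> field_vs.span S" for Z
    using field_vs.span_minimal[OF _ sub, of S] S that by blast
  show "vector_field_on U X" by (rule V[OF X])
  have base: "lie_bracket U A B \<in> field_vs.span S" if A: "A \<in> S" and B: "B \<in> S" for A B
  proof -
    obtain f g where fg: "f \<in> set basis_ham" "A = ham_field U f" "g \<in> set basis_ham" "B = ham_field U g"
      using A B unfolding S_def by blast
    show ?thesis
      unfolding fg lie_bracket_ham_field[OF U smooth_basis_ham[OF fg(1)] smooth_basis_ham[OF fg(3)]]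
      using lagrange_bracket_basis[OF U] fg(1,3) unfolding ham_span_def S_def by blast
  qed
  have left: "lie_bracket U A B \<in> field_vs.span S" if A: "A \<in> field_vs.span S" and B: "B \<in> S" for A B
  proof -
    have "field_vs.subspace {A. vector_field_on U A \<and> lie_bracket U A B \<in> field_vs.span S}"
    proof (rule field_vs.subspaceI)
      have "lie_bracket U 0 B = 0"
        using lie_bracket_scale_left[OF U vector_field_on_zero[OF U] S[OF B], of 0] by simp
      then show "0 \<in> {A. vector_field_on U A \<and> lie_bracket U A B \<in> field_vs.span S}"
        by (simp add: vector_field_on_zero[OF U] field_vs.span_zero)
    qed (use U S[OF B] in \<open>auto simp: lie_bracket_add_left lie_bracket_scale_left
        intro: vector_field_on_add vector_field_on_scale field_vs.span_add field_vs.span_scale\<close>)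
    from field_vs.span_minimal[OF _ this, of S] S base[OF _ B] A show ?thesis by blast
  qed
  have "field_vs.subspace {B. vector_field_on U B \<and> lie_bracket U X B \<in> field_vs.span S}"
  proof (rule field_vs.subspaceI)
    have "lie_bracket U X 0 = 0"
      using lie_bracket_scale_right[OF U V[OF X] vector_field_on_zero[OF U], of 0] by simp
    then show "0 \<in> {B. vector_field_on U B \<and> lie_bracket U X B \<in> field_vs.span S}"
      by (simp add: vector_field_on_zero[OF U] field_vs.span_zero)
  qed (use U V[OF X] in \<open>auto simp: lie_bracket_add_right lie_bracket_scale_right
      intro: vector_field_on_add vector_field_on_scale field_vs.span_add field_vs.span_scale\<close>)
  from field_vs.span_minimal[OF _ this, of S] S left[OF X] Y show "lie_bracket U X Y \<in> field_vs.span S" by blast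
qed

lemma symmetry_algebra_span:
  fixes U :: "('k::real_or_complex ^ 5) set"
  assumes U: "open U" "connected U"
  shows "symmetry_algebra U contact_form Upsilon = field_vs.span (ham_field U ` set basis_ham)"
proof
  let ?S = "ham_field U ` set basis_ham"
  let ?M = "ham_span U ?S"
  have H: "H_S3 \<in> ?M" "H_L10 \<in> ?M" "H_S11 \<in> ?M" "H_S1 \<in> ?M" "H_L2 \<in> ?M" "H_L12 \<in> ?M" "H_S9 \<in> ?M" "H_L4 \<in> ?M" "H_S5 \<in> ?M" "H_S7 \<in> ?M" "H_L8 \<in> ?M" "H_L6 \<in> ?M" "H_ha \<in> ?M" "H_hb \<in> ?M"
    by (intro ham_span_basis; simp add: basis_ham_def)+
  note intros = ham_span_add[OF U(1)] ham_span_cmult[OF U(1)] H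
  have E2: "H_E2 \<in> ?M" using H(14) unfolding H_hb_def .
  have "(H_h1 :: 'k ^ 5 \<Rightarrow> 'k) = (\<lambda>P. H_ha P + (- 3/2) * H_hb P)" by (simp add: H_ha_eq fun_eq_iff)
  moreover have "(\<lambda>P. H_ha P + (- 3/2) * H_hb P) \<in> ?M" by (intro intros)
  ultimately have h1: "H_h1 \<in> ?M" by metis
  show "symmetry_algebra U contact_form Upsilon \<subseteq> field_vs.span ?S"
  proof
    fix X assume "X \<in> symmetry_algebra U contact_form Upsilon"
    then obtain f where f: "det_eqs U f" "X = ham_field U f"
      unfolding symmetry_algebra_eq[OF U(1)] by blast
    obtain cL12 cL10 cS11 cS1 cL2 cS3 cS9 ch1 cE2 cL4 cS5 cS7 cL8 cL6 where
      c: "\<forall>P\<in>U. f P = cL12 * H_L12 P + cL10 * H_L10 P + cS11 * H_S11 P + cS1 * H_S1 P + cL2 * H_L2 P + cS3 * H_S3 P + cS9 * H_S9 P + ch1 * H_h1 P + cE2 * H_E2 P + cL4 * H_L4 P + cS5 * H_S5 P + cS7 * H_S7 P + cL8 * H_L8 P + cL6 * H_L6 P"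
      using det_eqs_solution[OF U f(1)] by blast
    have "X = ham_field U (\<lambda>P. cL12 * H_L12 P + cL10 * H_L10 P + cS11 * H_S11 P + cS1 * H_S1 P + cL2 * H_L2 P + cS3 * H_S3 P + cS9 * H_S9 P + ch1 * H_h1 P + cE2 * H_E2 P + cL4 * H_L4 P + cS5 * H_S5 P + cS7 * H_S7 P + cL8 * H_L8 P + cL6 * H_L6 P)"
      unfolding f(2) by (rule ham_field_cong[OF U(1)]) (rule c[rule_format])
    moreover have "(\<lambda>P. cL12 * H_L12 P + cL10 * H_L10 P + cS11 * H_S11 P + cS1 * H_S1 P + cL2 * H_L2 P + cS3 * H_S3 P + cS9 * H_S9 P + ch1 * H_h1 P + cE2 * H_E2 P + cL4 * H_L4 P + cS5 * H_S5 P + cS7 * H_S7 P + cL8 * H_L8 P + cL6 * H_L6 P) \<in> ?M"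
      by (intro intros E2 h1)
    ultimately show "X \<in> field_vs.span ?S" by (simp add: ham_span_def)
  qed
  have "det_eqs U H_ha"
    using det_eqs_lin[OF U(1) det_eqs_subset[OF det_eqs_H(13)] det_eqs_subset[OF det_eqs_H(14)], of 1 "3/2"]
    unfolding H_ha_eq H_hb_def by simp
  then have "det_eqs U f" if "f \<in> set basis_ham" for f
    using that det_eqs_subset[OF det_eqs_H(14), of U] det_eqs_H[THEN det_eqs_subset, of U]
    unfolding basis_ham_def H_hb_def by auto
  then show "field_vs.span ?S \<subseteq> symmetry_algebra U contact_form Upsilon"
    by (intro field_vs.span_minimal subspace_symmetry_algebra U) (auto simp: symmetry_algebra_eq[OF U(1)])
qed

lemma restrict_field_eq:
  "restrict_field U S1 = ham_field U H_S1" "restrict_field U L2 = ham_field U H_L2" "restrict_field U S3 = ham_field U H_S3" "restrict_field U L4 = ham_field U H_L4" "restrict_field U S5 = ham_field U H_S5" "restrict_field U L6 = ham_field U H_L6" "restrict_field U S7 = ham_field U H_S7" "restrict_field U L8 = ham_field U H_L8" "restrict_field U S9 = ham_field U H_S9" "restrict_field U L10 = ham_field U H_L10" "restrict_field U S11 = ham_field U H_S11" "restrict_field U L12 = ham_field U H_L12" "restrict_field U h1 = ham_field U H_h1"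
  "restrict_field U h2 = field_scale (of_real (sqrt 3 / 2)) (ham_field U H_E2)"
proof -
  show "restrict_field U h2 = field_scale (of_real (sqrt 3 / 2)) (ham_field U H_E2)"
  proof
    fix P show "restrict_field U h2 P = field_scale (of_real (sqrt 3 / 2)) (ham_field U H_E2) P"
      unfolding restrict_field_def ham_field_def field_scale_def ham_H(14)[symmetric] by simp
  qed
qed (simp_all add: fun_eq_iff restrict_field_def ham_field_def ham_H(1-13))

text \<open>The bases differ only in the Cartan plane: \<open>h2\<close> is a nonzero multiple of
  the field of \<open>H_hb\<close>, and the field of \<open>H_ha\<close> is that of
  \<open>H_h1\<close> plus 3/2 times that of \<open>H_hb\<close>.\<close>

lemma span_fields:
  fixes U :: "('k::real_or_complex ^ 5) set"
  assumes U: "open U"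
  shows "field_vs.span (ham_field U ` set basis_ham) = field_vs.span (restrict_field U `
    {S1, L2, S3, L4, S5, L6, S7, L8, S9, L10, S11, L12, h1, h2})"
proof -
  let ?S = "ham_field U ` set basis_ham"
  let ?R = "restrict_field U ` {S1, L2, S3, L4, S5, L6, S7, L8, S9, L10, S11, L12, h1, h2}"
  let ?k = "of_real (sqrt 3 / 2) :: 'k"
  have k: "?k \<noteq> 0" by simp
  have R: "ham_field U H_S1 \<in> field_vs.span ?R" "ham_field U H_L2 \<in> field_vs.span ?R" "ham_field U H_S3 \<in> field_vs.span ?R" "ham_field U H_L4 \<in> field_vs.span ?R" "ham_field U H_S5 \<in> field_vs.span ?R" "ham_field U H_L6 \<in> field_vs.span ?R" "ham_field U H_S7 \<in> field_vs.span ?R" "ham_field U H_L8 \<in> field_vs.span ?R" "ham_field U H_S9 \<in> field_vs.span ?R" "ham_field U H_L10 \<in> field_vs.span ?R" "ham_field U H_S11 \<in> field_vs.span ?R" "ham_field U H_L12 \<in> field_vs.span ?R" "ham_field U H_h1 \<in> field_vs.span ?R"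
    unfolding restrict_field_eq(1-13)[symmetric] by (rule field_vs.span_base, simp)+
  have "field_scale (inverse ?k) (restrict_field U h2) \<in> field_vs.span ?R"
    by (intro field_vs.span_scale field_vs.span_base) simp
  then have hb: "ham_field U H_hb \<in> field_vs.span ?R"
    unfolding restrict_field_eq(14) H_hb_def using k by simp
  have ha_eq: "ham_field U H_ha = ham_field U H_h1 + field_scale (3/2) (ham_field U H_hb)"
    unfolding H_ha_eq using U
    by (simp add: ham_field_add ham_field_cmult smooth_H_on smooth_mult smooth_const del: times_divide_eq_left)
  have ha: "ham_field U H_ha \<in> field_vs.span ?R"
    unfolding ha_eq by (intro field_vs.span_add field_vs.span_scale R hb)
  have "?S \<subseteq> field_vs.span ?R"
    using R ha hb unfolding basis_ham_def by simp
  moreover have "?R \<subseteq> field_vs.span ?S"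
  proof -
    have S: "ham_field U H_S3 \<in> field_vs.span ?S" "ham_field U H_L10 \<in> field_vs.span ?S" "ham_field U H_S11 \<in> field_vs.span ?S" "ham_field U H_S1 \<in> field_vs.span ?S" "ham_field U H_L2 \<in> field_vs.span ?S" "ham_field U H_L12 \<in> field_vs.span ?S" "ham_field U H_S9 \<in> field_vs.span ?S" "ham_field U H_L4 \<in> field_vs.span ?S" "ham_field U H_S5 \<in> field_vs.span ?S" "ham_field U H_S7 \<in> field_vs.span ?S" "ham_field U H_L8 \<in> field_vs.span ?S" "ham_field U H_L6 \<in> field_vs.span ?S" "ham_field U H_ha \<in> field_vs.span ?S" "ham_field U H_hb \<in> field_vs.span ?S"
      by (rule field_vs.span_base, simp add: basis_ham_def)+
    have "ham_field U H_h1 = ham_field U H_ha - field_scale (3/2) (ham_field U H_hb)"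
      unfolding ha_eq by simp
    then have "ham_field U H_h1 \<in> field_vs.span ?S"
      by (simp only:) (intro field_vs.span_diff field_vs.span_scale S)
    moreover have "field_scale ?k (ham_field U H_E2) \<in> field_vs.span ?S"
      using S(14) unfolding H_hb_def by (rule field_vs.span_scale)
    ultimately show ?thesis using S unfolding image_insert image_empty restrict_field_eq by simp
  qed
  ultimately show ?thesis by (simp add: field_vs.span_eq)
qed

lemma lie_bracket_eqI:
  assumes "open U" "f \<in> set basis_ham" "g \<in> set basis_ham" "h \<in> set basis_ham"
    and "lagrange_bracket f g = (\<lambda>P. c * h P)"
  shows "lie_bracket U (ham_field U f) (ham_field U g) = field_scale c (ham_field U h)"
  unfolding lie_bracket_ham_field[OF assms(1) smooth_basis_ham[OF assms(2)] smooth_basis_ham[OF assms(3)]]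
    assms(5) by (rule ham_field_cmult[OF smooth_basis_ham[OF assms(4)]])

lemma lagrange_weights:
  "r \<in> G2_roots \<Longrightarrow> lagrange_bracket H_ha (root_ham r) = (\<lambda>P. of_int (fst r) * root_ham r P)"
  "r \<in> G2_roots \<Longrightarrow> lagrange_bracket H_hb (root_ham r) = (\<lambda>P. of_int (snd r) * root_ham r P)"
  unfolding G2_roots_def
  by (elim insertE emptyE; simp only: root_ham_simps fst_conv snd_conv
      lagrange_bracket_antisym(1)[of H_ha] lagrange_bracket_antisym(1)[of H_hb]
      lagrange_H_S3 lagrange_H_L10 lagrange_H_S11 lagrange_H_S1 lagrange_H_L2 lagrange_H_L12 lagrange_H_S9 lagrange_H_L4 lagrange_H_S5 lagrange_H_S7 lagrange_H_L8 lagrange_H_L6 lagrange_H_ha; simp)+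

text \<open>The witnesses are read off the bracket tables, with a change of sign where a table lists
  the two Hamiltonians in the opposite order.\<close>

lemma lagrange_cycle:
  assumes "(r, s) \<in> G2_cycle"
  shows "\<exists>c. c \<noteq> 0 \<and> lagrange_bracket (root_ham (s - r)) (root_ham r) = (\<lambda>P. c * root_ham s P :: 'k::real_or_complex)"
  using assms unfolding G2_cycle_def
proof (elim insertE emptyE)
  assume "(r, s) = ((1, 0), (3, 1))"
  then show ?thesis
    by (intro exI[of _ "(- 3)"]) (simp add: root_ham_simps lagrange_bracket_antisym(1)[of H_S1 H_S3] lagrange_H_S3)
next
  assume "(r, s) = ((3, 1), (2, 1))"
  then show ?thesis
    by (intro exI[of _ "(- 1/2)"]) (simp add: root_ham_simps lagrange_bracket_antisym(1)[of H_S9 H_L2] lagrange_H_L2)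
next
  assume "(r, s) = ((2, 1), (3, 2))"
  then show ?thesis
    by (intro exI[of _ "3"]) (simp add: root_ham_simps lagrange_H_S11)
next
  assume "(r, s) = ((3, 2), (1, 1))"
  then show ?thesis
    by (intro exI[of _ "1"]) (simp add: root_ham_simps lagrange_bracket_antisym(1)[of H_S7 H_L12] lagrange_H_L12)
next
  assume "(r, s) = ((1, 1), (0, 1))"
  then show ?thesis
    by (intro exI[of _ "3"]) (simp add: root_ham_simps lagrange_bracket_antisym(1)[of H_S9 H_S11] lagrange_H_S11)
next
  assume "(r, s) = ((0, 1), (-1, 0))"
  then show ?thesis
    by (intro exI[of _ "1"]) (simp add: root_ham_simps lagrange_bracket_antisym(1)[of H_S5 H_L10] lagrange_H_L10)
next
  assume "(r, s) = ((-1, 0), (-3, -1))"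
  then show ?thesis
    by (intro exI[of _ "3/4"]) (simp add: root_ham_simps lagrange_bracket_antisym(1)[of H_S7 H_S9] lagrange_H_S9)
next
  assume "(r, s) = ((-3, -1), (-2, -1))"
  then show ?thesis
    by (intro exI[of _ "2"]) (simp add: root_ham_simps lagrange_H_S3)
next
  assume "(r, s) = ((-2, -1), (-3, -2))"
  then show ?thesis
    by (intro exI[of _ "1"]) (simp add: root_ham_simps lagrange_H_S5)
next
  assume "(r, s) = ((-3, -2), (-1, -1))"
  then show ?thesis
    by (intro exI[of _ "3"]) (simp add: root_ham_simps lagrange_H_S1)
next
  assume "(r, s) = ((-1, -1), (0, -1))"
  then show ?thesis
    by (intro exI[of _ "2"]) (simp add: root_ham_simps lagrange_H_S3)
next
  assume "(r, s) = ((0, -1), (1, 0))"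
  then show ?thesis
    by (intro exI[of _ "3/2"]) (simp add: root_ham_simps lagrange_H_S11)
qed

lemma lagrange_opposite:
  "lagrange_bracket H_S9 H_S3 = (\<lambda>P. 1 * H_ha P + (- 3/2) * H_hb P)"
  "lagrange_bracket H_L4 H_L10 = (\<lambda>P. (- 3/4) * H_ha P + 3/2 * H_hb P)"
  unfolding lagrange_bracket_antisym(1)[of H_S9 H_S3] lagrange_bracket_antisym(1)[of H_L4 H_L10]
    lagrange_H_S3 lagrange_H_L10
  by (simp_all add: fun_eq_iff algebra_simps)

theorem symmetry_algebra_G2:
  fixes U :: "('k::real_or_complex ^ 5) set"
  assumes U: "open U" "connected U" "U \<noteq> {}"
  defines "\<g> \<equiv> symmetry_algebra U contact_form Upsilon"
  shows "lie_algebra field_scale \<g> (lie_bracket U)"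
    and "lie_algebra.split_simple_G2 field_scale \<g> (lie_bracket U)"
    and "vector_space.dim field_scale \<g> = 14"
    and "\<g> = module.span field_scale (restrict_field U `
      {S1, L2, S3, L4, S5, L6, S7, L8, S9, L10, S11, L12, h1, h2})"
proof -
  have span: "\<g> = field_vs.span (ham_field U ` set basis_ham)"
    unfolding \<g>_def by (rule symmetry_algebra_span[OF U(1,2)])
  show lie: "lie_algebra field_scale \<g> (lie_bracket U)"
    unfolding span by (rule lie_algebra_of_fields[OF U(1)])
      (use bracket_in_span[OF U(1)] in \<open>auto simp: field_vs.subspace_span\<close>)
  have root: "root_ham r \<in> set basis_ham" if "r \<in> G2_roots" for r
    using that unfolding set_basis_ham by blast
  have hab: "H_ha \<in> set basis_ham" "H_hb \<in> set basis_ham"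
    unfolding set_basis_ham by simp_all
  have "split_G2_basis field_scale \<g> (lie_bracket U) (\<lambda>r. ham_field U (root_ham r)) (ham_field U H_ha) (ham_field U H_hb)"
  proof (intro split_G2_basis.intro lie split_G2_basis_axioms.intro)
    show "\<g> = field_vs.span (insert (ham_field U H_ha) (insert (ham_field U H_hb)
        ((\<lambda>r. ham_field U (root_ham r)) ` G2_roots)))"
      unfolding span set_basis_ham by (simp add: image_image)
    show "lie_bracket U (ham_field U H_ha) (ham_field U H_hb) = 0"
      using lie_bracket_eqI[OF U(1) hab hab(1), of 0] lagrange_H_ha by simp
    fix r assume r: "r \<in> G2_roots"
    show "lie_bracket U (ham_field U H_ha) (ham_field U (root_ham r))
        = field_scale (of_int (fst r)) (ham_field U (root_ham r))"
      by (rule lie_bracket_eqI[OF U(1) hab(1) root[OF r] root[OF r] lagrange_weights(1)[OF r]])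
    show "lie_bracket U (ham_field U H_hb) (ham_field U (root_ham r))
        = field_scale (of_int (snd r)) (ham_field U (root_ham r))"
      by (rule lie_bracket_eqI[OF U(1) hab(2) root[OF r] root[OF r] lagrange_weights(2)[OF r]])
  next
    fix r s assume rs: "(r, s) \<in> G2_cycle"
    then have "s - r \<in> G2_roots" "r \<in> G2_roots" "s \<in> G2_roots"
      by (auto simp: G2_cycle_def G2_roots_def)
    note m = this[THEN root]
    obtain c :: 'k where c: "c \<noteq> 0" "lagrange_bracket (root_ham (s - r)) (root_ham r) = (\<lambda>P. c * root_ham s P)"
      using lagrange_cycle[OF rs] by blast
    with lie_bracket_eqI[OF U(1) m c(2)]
    show "\<exists>c. c \<noteq> 0 \<and> lie_bracket U (ham_field U (root_ham (s - r))) (ham_field U (root_ham r))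
        = field_scale c (ham_field U (root_ham s))" by blast
  next
    have op: "lie_bracket U (ham_field U f) (ham_field U g) = field_scale a (ham_field U H_ha) + field_scale b (ham_field U H_hb)"
      if "f \<in> set basis_ham" "g \<in> set basis_ham" "lagrange_bracket f g = (\<lambda>P. a * H_ha P + b * H_hb P)" for f g a b
    proof -
      note s = hab[THEN smooth_basis_ham, of U]
      have "smooth_on U (\<lambda>P. a * H_ha P)" "smooth_on U (\<lambda>P. b * H_hb P)"
        by (intro smooth_intros U(1) s)+
      then show ?thesis
        unfolding lie_bracket_ham_field[OF U(1) that(1,2)[THEN smooth_basis_ham]] that(3)
        by (simp only: ham_field_add ham_field_cmult s)
    qed
    have m: "H_S9 \<in> set basis_ham" "H_S3 \<in> set basis_ham" "H_L4 \<in> set basis_ham" "H_L10 \<in> set basis_ham"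
      by (simp_all add: basis_ham_def)
    show "\<exists>a b a' b'. a * b' \<noteq> b * a' \<and>
        lie_bracket U (ham_field U (root_ham (-1, 0))) (ham_field U (root_ham (1, 0)))
          = field_scale a (ham_field U H_ha) + field_scale b (ham_field U H_hb) \<and>
        lie_bracket U (ham_field U (root_ham (0, -1))) (ham_field U (root_ham (0, 1)))
          = field_scale a' (ham_field U H_ha) + field_scale b' (ham_field U H_hb)"
      \<comment> \<open>The two products are 3/2 and 9/8, so the elements are independent.\<close>
      unfolding root_ham_simps op[OF m(1,2) lagrange_opposite(1)] op[OF m(3,4) lagrange_opposite(2)]
      by (rule exI[of _ "1"], rule exI[of _ "(- 3/2)"], rule exI[of _ "(- 3/4)"], rule exI[of _ "3/2"]) simp
    \<comment> \<open>Nonemptiness of \<open>U\<close> enters here: the restricted field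
      \<open>S5\<close> equals \<open>D_y\<close> at P.\<close>
    obtain P where P: "P \<in> U" using U(3) by blast
    have "ham_field U (root_ham (-1, -1)) P = D_y"
      using P by (simp add: root_ham_simps ham_field_nth ham_H S5_def)
    also have "\<dots> \<noteq> (0 :: 'k ^ 5)" by (simp add: axis_eq_0_iff)
    finally have "ham_field U (root_ham (-1, -1)) \<noteq> 0" by auto
    then show "\<exists>r\<in>G2_roots. ham_field U (root_ham r) \<noteq> 0"
      by (intro bexI[of _ "(-1, -1)"]) (simp_all add: G2_roots_def)
  qed
  then interpret G: split_G2_basis field_scale \<g> "lie_bracket U" "\<lambda>r. ham_field U (root_ham r)"
    "ham_field U H_ha" "ham_field U H_hb" .
  show "lie_algebra.split_simple_G2 field_scale \<g> (lie_bracket U)" by (rule G.split_simple_G2)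
  show "vector_space.dim field_scale \<g> = 14" by (rule G.dim_L)
  show "\<g> = module.span field_scale (restrict_field U `
      {S1, L2, S3, L4, S5, L6, S7, L8, S9, L10, S11, L12, h1, h2})"
    unfolding span by (rule span_fields[OF U(1)])
qed

section \<open>The solution of Noth's equation\<close>

text \<open>
  In terms of \<open>u = s\<^sup>1\<^sup>/\<^sup>3\<close> the solution is \<open>t = 2u/(u\<^sup>3 + 2)\<close>, \<open>H = - 4u\<^sup>2/(u\<^sup>3 + 2)\<close>, so
  \<open>dt/du = (4 - 4u\<^sup>3)/(u\<^sup>3 + 2)\<^sup>2\<close>.  The function \<open>g\<close> is the inverse of \<open>u \<mapsto> t\<close>.
\<close>

text \<open>The numerators of the derivatives of order 2 to 6 of the solution, as functions of \<open>u\<close>.\<close>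

definition noth2 :: "'k::field \<Rightarrow> 'k" where
  "noth2 u = - 16"
definition noth3 :: "'k::field \<Rightarrow> 'k" where
  "noth3 u = 192*u^5 - 1920*u^2"
definition noth4 :: "'k::field \<Rightarrow> 'k" where
  "noth4 u = - (3840*u^10) + 46080*u^7 - 322560*u^4 - 30720*u"
definition noth5 :: "'k::field \<Rightarrow> 'k" where
  "noth5 u = 107520*u^15 - 1505280*u^12 + 10752000*u^9 - 69918720*u^6 - 17571840*u^3 - 245760"
definition noth6 :: "'k::field \<Rightarrow> 'k" where
  "noth6 u = - (3870720*u^20) + 61931520*u^17 - 495452160*u^14 + 2694021120*u^11 - 18734284800*u^8 - 8422686720*u^5 - 495452160*u^2"

lemmas noth_defs = noth2_def noth3_def noth4_def noth5_def noth6_def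

text \<open>Only the derivative of \<open>g\<close> is recorded, the reciprocal of dt/du. Noth's
  equation does not contain t explicitly; the relation between t and \<open>g t\<close> is added as
  a hypothesis where the forms omega, which involve t, are computed.\<close>

locale noth_parameter =
  fixes N T :: "'k::real_or_complex set" and g :: "'k \<Rightarrow> 'k"
  assumes open_T: "open T" and g_in: "t \<in> T \<Longrightarrow> g t \<in> N"
    and deriv_g: "t \<in> T \<Longrightarrow> (g has_field_derivative (g t ^ 3 + 2)^2 / (4 - 4 * g t ^ 3)) (at t)"
    and N_ne: "u \<in> N \<Longrightarrow> 4 - 4 * u ^ 3 \<noteq> 0 \<and> u ^ 3 + 2 \<noteq> 0"
begin

lemma deriv_comp:
  assumes F: "\<forall>t\<in>T. F t = \<phi> (g t)" and t: "t \<in> T" and \<phi>: "(\<phi> has_field_derivative D) (at (g t))"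
  shows "(F has_field_derivative D * ((g t ^ 3 + 2)^2 / (4 - 4 * g t ^ 3))) (at t)"
  by (rule has_field_derivative_transform_within_open[OF DERIV_chain2[OF \<phi> deriv_g[OF t]] open_T t])
     (use F in auto)

text \<open>With E = u^3 + 2 and D = 4 - 4 u^3 one has E' = 3 u^2, D' = -12 u^2 and du/dt = E^2 / D.
  Differentiation in t therefore preserves the shape p E^m / D^j, and only the polynomial p has to
  be followed.\<close>

lemma deriv_step:
  assumes F: "\<forall>t\<in>T. F t = p (g t) * (g t ^ 3 + 2) ^ m / (4 - 4 * g t ^ 3) ^ j"
    and p: "\<And>u. (p has_field_derivative p' u) (at u)"
    and q: "\<And>u. q u = p' u * (u^3 + 2) * (4 - 4 * u^3) + 3 * of_nat m * u^2 * p u * (4 - 4 * u^3)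
      + 12 * of_nat j * u^2 * p u * (u^3 + 2)"
    and t: "t \<in> T"
  shows "(F has_field_derivative q (g t) * (g t ^ 3 + 2) ^ (m + 1) / (4 - 4 * g t ^ 3) ^ (j + 2)) (at t)"
proof -
  let ?\<phi> = "\<lambda>u. p u * (u^3 + 2) ^ m / (4 - 4 * u^3) ^ j"
  let ?u = "g t"
  have ne: "4 - 4 * ?u^3 \<noteq> 0" "?u^3 + 2 \<noteq> 0" using N_ne[OF g_in[OF t]] by auto
  let ?D = "(p' ?u * (?u^3 + 2) ^ m + of_nat m * (?u^3 + 2) ^ (m - 1) * (3 * ?u^2) * p ?u) / (4 - 4 * ?u^3) ^ j
      + p ?u * (?u^3 + 2) ^ m * (of_nat j * 12 * ?u^2) / (4 - 4 * ?u^3) ^ (j + 1)"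
  have d: "(?\<phi> has_field_derivative ?D) (at ?u)"
  proof -
    have d: "((\<lambda>u. p u * (u^3 + 2) ^ m * inverse (4 - 4 * u^3) ^ j) has_field_derivative
        (p' ?u * (?u^3 + 2) ^ m + of_nat m * (?u^3 + 2) ^ (m - 1) * (3 * ?u^2) * p ?u) * inverse (4 - 4 * ?u^3) ^ j
        + of_nat j * (inverse (4 - 4 * ?u^3) ^ (j - 1) * (inverse (4 - 4 * ?u^3) ^ 2 * (12 * ?u^2))) * (p ?u * (?u^3 + 2) ^ m)) (at ?u)"
      by (rule derivative_eq_intros p refl | use ne in \<open>simp; fail\<close>)+
        (simp add: power2_eq_square algebra_simps)
    \<comment> \<open>The power rule produces the exponent j - 1, truncated at 0; for j = 0 the
      factor \<open>of_nat j\<close> vanishes.\<close>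
    have X: "of_nat j * (inverse (4 - 4 * ?u^3) ^ (j - 1) * (inverse (4 - 4 * ?u^3) ^ 2 * (12 * ?u^2)))
        = of_nat j * 12 * ?u^2 / (4 - 4 * ?u^3) ^ (j + 1)"
      using ne by (cases j) (simp_all add: power2_eq_square divide_simps)
    from d show ?thesis
      unfolding X by (simp only: divide_inverse power_inverse mult_ac)
  qed
  have "?D * ((?u^3 + 2)^2 / (4 - 4 * ?u^3)) = q ?u * (?u^3 + 2) ^ (m + 1) / (4 - 4 * ?u^3) ^ (j + 2)"
  proof -
    define E D where "E = ?u^3 + 2" and "D = 4 - 4 * ?u^3"
    have ED: "E \<noteq> 0" "D \<noteq> 0" using ne by (simp_all add: E_def D_def)
    have m: "of_nat m * E ^ (m - 1) * E = of_nat m * E ^ m" by (cases m) simp_all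
    have q': "q ?u = p' ?u * E * D + 3 * of_nat m * ?u^2 * p ?u * D + 12 * of_nat j * ?u^2 * p ?u * E"
      using q[of ?u] unfolding E_def D_def .
    have "((p' ?u * E ^ m + of_nat m * E ^ (m - 1) * (3 * ?u^2) * p ?u) / D ^ j
      + p ?u * E ^ m * (of_nat j * 12 * ?u^2) / D ^ (j + 1)) * (E^2 / D)
      = ((p' ?u * E ^ m * E + (of_nat m * E ^ (m - 1) * E) * (3 * ?u^2) * p ?u) * D
      + p ?u * E ^ m * E * (of_nat j * 12 * ?u^2)) * E / D ^ (j + 2)"
      using ED by (simp add: divide_simps power2_eq_square) (simp add: algebra_simps)
    also have "\<dots> = q ?u * E ^ (m + 1) / D ^ (j + 2)"
      unfolding m q' using ED by (simp add: divide_simps) (simp add: algebra_simps)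
    finally show ?thesis unfolding E_def D_def .
  qed
  with deriv_comp[OF F t d] show ?thesis by simp
qed

definition sol :: "'k \<Rightarrow> 'k" where "sol t = - (4 * g t ^ 2 / (g t ^ 3 + 2))"
text \<open>In the variable w = u^3 + 2 the integral of H dt is 8/w^2 - 16/(3w). The integration
  constant 0 gives the coefficient 4/(3(s - 1)) in \<open>omega2\<close>.\<close>

definition integral_sol :: "'k \<Rightarrow> 'k" where
  "integral_sol t = - (8 * (2 * g t ^ 3 + 1) / (3 * (g t ^ 3 + 2)^2))"

lemma deriv_sol:
  assumes t: "t \<in> T"
  shows "(sol has_field_derivative 4 * g t * (g t ^ 3 - 4) / (4 - 4 * g t ^ 3)) (at t)"
proof -
  let ?u = "g t"
  have ne: "4 - 4 * ?u^3 \<noteq> 0" "?u^3 + 2 \<noteq> 0" using N_ne[OF g_in[OF t]] by auto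
  have d: "((\<lambda>u. - (4 * u ^ 2 / (u^3 + 2))) has_field_derivative
      - ((8 * ?u * (?u^3 + 2) - 4 * ?u^2 * (3 * ?u^2)) / (?u^3 + 2)^2)) (at ?u)"
    using ne by (auto intro!: derivative_eq_intros simp: power2_eq_square)
  have "- ((8 * ?u * (?u^3 + 2) - 4 * ?u^2 * (3 * ?u^2)) / (?u^3 + 2)^2) * ((?u^3 + 2)^2 / (4 - 4 * ?u^3))
      = 4 * ?u * (?u^3 - 4) / (4 - 4 * ?u^3)"
  proof -
    have "- ((8 * u * E - 4 * u^2 * (3 * u^2)) / E^2) * (E^2 / D) = - (8 * u * E - 12 * u^4) / D" if "E \<noteq> 0" for u E D :: 'k
      using that by (simp add: power2_eq_square power4_eq_xxxx)
    moreover have "- (8 * ?u * (?u^3 + 2) - 12 * ?u^4) = 4 * ?u * (?u^3 - 4)" by algebra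
    ultimately show ?thesis using ne by metis
  qed
  with deriv_comp[of sol, OF _ t d] show ?thesis by (simp add: sol_def)
qed

lemma deriv_integral_sol:
  assumes t: "t \<in> T"
  shows "(integral_sol has_field_derivative sol t) (at t)"
proof -
  let ?u = "g t"
  have ne: "4 - 4 * ?u^3 \<noteq> 0" "?u^3 + 2 \<noteq> 0" using N_ne[OF g_in[OF t]] by auto
  have d: "((\<lambda>u. - (8 * (2 * u ^ 3 + 1) / (3 * (u^3 + 2)^2))) has_field_derivative
      - ((48 * ?u^2 * (3 * (?u^3 + 2)^2) - 8 * (2 * ?u^3 + 1) * (18 * ?u^2 * (?u^3 + 2))) / (3 * (?u^3 + 2)^2)^2)) (at ?u)"
    using ne by (auto intro!: derivative_eq_intros simp: power2_eq_square)
  have "- ((48 * ?u^2 * (3 * (?u^3 + 2)^2) - 8 * (2 * ?u^3 + 1) * (18 * ?u^2 * (?u^3 + 2))) / (3 * (?u^3 + 2)^2)^2)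
      * ((?u^3 + 2)^2 / (4 - 4 * ?u^3)) = sol t"
  proof -
    have "48 * ?u^2 * (3 * (?u^3 + 2)^2) - 8 * (2 * ?u^3 + 1) * (18 * ?u^2 * (?u^3 + 2))
        = 36 * ?u^2 * (?u^3 + 2) * (4 - 4 * ?u^3)" by algebra
    moreover have "- (36 * u^2 * E * D / (3 * E^2)^2) * (E^2 / D) = - (4 * u^2 / E)" if "E \<noteq> 0" "D \<noteq> 0" for u E D :: 'k
      using that by (simp add: power2_eq_square)
    ultimately show ?thesis using ne unfolding sol_def by metis
  qed
  with deriv_comp[of integral_sol, OF _ t d] show ?thesis by (simp add: integral_sol_def)
qed

text \<open>Every derivative keeps a shape to which \<open>deriv_step\<close> applies again;
  differentiability to all orders follows.\<close>

lemma higher_deriv_sol: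
  "\<exists>p m j. \<forall>t\<in>T. (deriv ^^ Suc n) sol t = poly p (g t) * (g t ^ 3 + 2) ^ m / (4 - 4 * g t ^ 3) ^ j"
proof (induction n)
  case 0
  show ?case
    by (rule exI[of _ "[:0, -16, 0, 0, 4:]"], rule exI[of _ 0], rule exI[of _ 1])
       (simp add: DERIV_imp_deriv[OF deriv_sol] algebra_simps power3_eq_cube)
next
  case (Suc n)
  then obtain p m j where F: "\<forall>t\<in>T. (deriv ^^ Suc n) sol t = poly p (g t) * (g t ^ 3 + 2) ^ m / (4 - 4 * g t ^ 3) ^ j"
    by blast
  let ?q = "pderiv p * [:2, 0, 0, 1:] * [:4, 0, 0, -4:] + smult (3 * of_nat m) ([:0, 0, 1:] * p * [:4, 0, 0, -4:])
    + smult (12 * of_nat j) ([:0, 0, 1:] * p * [:2, 0, 0, 1:])"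
  have "poly ?q u = poly (pderiv p) u * (u^3 + 2) * (4 - 4 * u^3) + 3 * of_nat m * u^2 * poly p u * (4 - 4 * u^3)
      + 12 * of_nat j * u^2 * poly p u * (u^3 + 2)" for u
    by (simp add: power2_eq_square power3_eq_cube algebra_simps)
  from DERIV_imp_deriv[OF deriv_step[OF F poly_DERIV this]]
  show ?case by (intro exI[of _ ?q] exI[of _ "m + 1"] exI[of _ "j + 2"]) simp
qed

lemma smooth_sol:
  assumes t: "t \<in> T"
  shows "(deriv ^^ n) sol field_differentiable at t"
proof (cases n)
  case 0
  then show ?thesis using deriv_sol[OF t] by (auto simp: field_differentiable_def)
next
  case (Suc n')
  obtain p m j where F: "\<forall>t\<in>T. (deriv ^^ Suc n') sol t = poly p (g t) * (g t ^ 3 + 2) ^ m / (4 - 4 * g t ^ 3) ^ j"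
    using higher_deriv_sol by blast
  from deriv_step[OF F poly_DERIV refl t] show ?thesis
    unfolding Suc field_differentiable_def by blast
qed

text \<open>From here on the derivative of order n is \<open>noth\<close>n times E^(n+2) / D^(2n-1),
  with E = u^3 + 2 and D = 4 - 4 u^3.\<close>

lemma deriv_sol_2: "\<forall>t\<in>T. (deriv ^^ 2) sol t = noth2 (g t) * (g t ^ 3 + 2) ^ 4 / (4 - 4 * g t ^ 3) ^ 3"
proof -
  have 1: "\<forall>t\<in>T. deriv sol t = (4 * g t ^ 4 - 16 * g t) * (g t ^ 3 + 2) ^ 0 / (4 - 4 * g t ^ 3) ^ 1"
    by (simp add: DERIV_imp_deriv[OF deriv_sol] algebra_simps power3_eq_cube power4_eq_xxxx)
  \<comment> \<open>The numerator produced by the recursion is -16 E^3; its cube joins the factor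
    E^1.\<close>
  have "(deriv sol has_field_derivative (- 16 * (g t ^ 3 + 2) ^ 3) * (g t ^ 3 + 2) ^ (0 + 1) / (4 - 4 * g t ^ 3) ^ (1 + 2)) (at t)"
    if t: "t \<in> T" for t
  proof (rule deriv_step[where p = "\<lambda>u. 4 * u^4 - 16 * u" and q = "\<lambda>u. - 16 * (u ^ 3 + 2) ^ 3", OF 1 _ _ t])
    show "((\<lambda>u. 4 * u^4 - 16 * u) has_field_derivative 16 * u^3 - 16) (at u)" for u :: 'k
      by (auto intro!: derivative_eq_intros)
  qed (unfold of_nat_0 of_nat_1, algebra)
  from DERIV_imp_deriv[OF this] show ?thesis
    by (simp add: eval_nat_numeral noth2_def)
qed

lemma deriv_sol_3: "\<forall>t\<in>T. (deriv ^^ 3) sol t = noth3 (g t) * (g t ^ 3 + 2) ^ 5 / (4 - 4 * g t ^ 3) ^ 5"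
proof -
  have "((deriv ^^ 2) sol has_field_derivative noth3 (g t) * (g t ^ 3 + 2) ^ (4 + 1) / (4 - 4 * g t ^ 3) ^ (3 + 2)) (at t)"
    if t: "t \<in> T" for t
  proof (rule deriv_step[OF deriv_sol_2 _ _ t])
    show "(noth2 has_field_derivative 0) (at u)" for u :: 'k
      unfolding noth_defs by (auto intro!: derivative_eq_intros)
  qed (unfold noth_defs of_nat_numeral, algebra)
  from DERIV_imp_deriv[OF this] show ?thesis
    by (simp add: eval_nat_numeral)
qed

lemma deriv_sol_4: "\<forall>t\<in>T. (deriv ^^ 4) sol t = noth4 (g t) * (g t ^ 3 + 2) ^ 6 / (4 - 4 * g t ^ 3) ^ 7"
proof -
  have "((deriv ^^ 3) sol has_field_derivative noth4 (g t) * (g t ^ 3 + 2) ^ (5 + 1) / (4 - 4 * g t ^ 3) ^ (5 + 2)) (at t)"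
    if t: "t \<in> T" for t
  proof (rule deriv_step[OF deriv_sol_3 _ _ t])
    show "(noth3 has_field_derivative 960*u^4 - 3840*u) (at u)" for u :: 'k
      unfolding noth_defs by (auto intro!: derivative_eq_intros)
  qed (unfold noth_defs of_nat_numeral, algebra)
  from DERIV_imp_deriv[OF this] show ?thesis
    by (simp add: eval_nat_numeral)
qed

lemma deriv_sol_5: "\<forall>t\<in>T. (deriv ^^ 5) sol t = noth5 (g t) * (g t ^ 3 + 2) ^ 7 / (4 - 4 * g t ^ 3) ^ 9"
proof -
  have "((deriv ^^ 4) sol has_field_derivative noth5 (g t) * (g t ^ 3 + 2) ^ (6 + 1) / (4 - 4 * g t ^ 3) ^ (7 + 2)) (at t)"
    if t: "t \<in> T" for t
  proof (rule deriv_step[OF deriv_sol_4 _ _ t])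
    show "(noth4 has_field_derivative - (38400*u^9) + 322560*u^6 - 1290240*u^3 - 30720) (at u)" for u :: 'k
      unfolding noth_defs by (auto intro!: derivative_eq_intros)
  qed (unfold noth_defs of_nat_numeral, algebra)
  from DERIV_imp_deriv[OF this] show ?thesis
    by (simp add: eval_nat_numeral)
qed

lemma deriv_sol_6: "\<forall>t\<in>T. (deriv ^^ 6) sol t = noth6 (g t) * (g t ^ 3 + 2) ^ 8 / (4 - 4 * g t ^ 3) ^ 11"
proof -
  have "((deriv ^^ 5) sol has_field_derivative noth6 (g t) * (g t ^ 3 + 2) ^ (7 + 1) / (4 - 4 * g t ^ 3) ^ (9 + 2)) (at t)"
    if t: "t \<in> T" for t
  proof (rule deriv_step[OF deriv_sol_5 _ _ t])
    show "(noth5 has_field_derivative 1612800*u^14 - 18063360*u^11 + 96768000*u^8 - 419512320*u^5 - 52715520*u^2) (at u)" for u :: 'k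
      unfolding noth_defs by (auto intro!: derivative_eq_intros)
  qed (unfold noth_defs of_nat_numeral, algebra)
  from DERIV_imp_deriv[OF this] show ?thesis
    by (simp add: eval_nat_numeral)
qed

lemma noth_sol: "noth_solution_on T sol"
  unfolding noth_solution_on_def Let_def
proof (intro conjI ballI allI)
  fix t assume t: "t \<in> T"
  show "(deriv ^^ n) sol field_differentiable at t" for n by (rule smooth_sol[OF t])
  define u E D where "u = g t" and "E = u^3 + 2" and "D = inverse (4 - 4 * u^3)"
  have d: "(deriv ^^ 2) sol t = noth2 u * (E^4 * D^3)" "(deriv ^^ 3) sol t = noth3 u * (E^5 * D^5)" "(deriv ^^ 4) sol t = noth4 u * (E^6 * D^7)" "(deriv ^^ 5) sol t = noth5 u * (E^7 * D^9)" "(deriv ^^ 6) sol t = noth6 u * (E^8 * D^11)"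
    using t deriv_sol_2 deriv_sol_3 deriv_sol_4 deriv_sol_5 deriv_sol_6 unfolding E_def D_def u_def
    by (simp_all add: divide_inverse power_inverse mult.assoc)
  \<comment> \<open>Each term of Noth's equation is a product of four derivatives with orders adding
    up to 12, so all share the factor E^(12+8) D^(24-4). A polynomial identity in u remains.\<close>
  have "10 * (a2 * (E^4 * D^3))^3 * (a6 * (E^8 * D^11)) - 70 * (a2 * (E^4 * D^3))^2 * (a3 * (E^5 * D^5)) * (a5 * (E^7 * D^9))
      - 49 * (a2 * (E^4 * D^3))^2 * (a4 * (E^6 * D^7))^2
      + 280 * (a2 * (E^4 * D^3)) * (a3 * (E^5 * D^5))^2 * (a4 * (E^6 * D^7)) - 175 * (a3 * (E^5 * D^5))^4
    = (10 * a2^3 * a6 - 70 * a2^2 * a3 * a5 - 49 * a2^2 * a4^2 + 280 * a2 * a3^2 * a4 - 175 * a3^4) * (E^20 * D^20)"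
    for a2 a3 a4 a5 a6
    by algebra
  moreover have "10 * noth2 u^3 * noth6 u - 70 * noth2 u^2 * noth3 u * noth5 u - 49 * noth2 u^2 * noth4 u^2
      + 280 * noth2 u * noth3 u^2 * noth4 u - 175 * noth3 u^4 = 0"
    unfolding noth_defs by algebra
  ultimately show "10 * (deriv ^^ 2) sol t ^ 3 * (deriv ^^ 6) sol t - 70 * (deriv ^^ 2) sol t ^ 2 * (deriv ^^ 3) sol t * (deriv ^^ 5) sol t
      - 49 * (deriv ^^ 2) sol t ^ 2 * (deriv ^^ 4) sol t ^ 2
      + 280 * (deriv ^^ 2) sol t * (deriv ^^ 3) sol t ^ 2 * (deriv ^^ 4) sol t - 175 * (deriv ^^ 3) sol t ^ 4 = 0"
    unfolding d by (metis mult_zero_left)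
qed

end

context noth_parameter
begin

lemma omegas:
  assumes t: "t \<in> T" and gt: "t = 2 * g t / (g t ^ 3 + 2)"
  defines "s \<equiv> g t ^ 3"
  shows "omega2 sol integral_sol t v = dp v + 4 / (3 * (s - 1)) * dx v - 2 * g t ^ 2 / (s - 1) * dy v"
    "omega3 sol t v = dq v - 2 * g t ^ 2 / (s - 1) * dx v - g t * (s - 4) / (s - 1) * dy v"
    "omega4 t v = dy v - 2 * g t / (s + 2) * dx v"
proof -
  define u where "u = g t"
  have ne: "s - 1 \<noteq> 0" "s + 2 \<noteq> 0" using N_ne[OF g_in[OF t]] by (auto simp: s_def)
  have u3: "u ^ 3 = s" by (simp add: u_def s_def)
  have H: "sol t = - (4 * u ^ 2 / (s + 2))" by (simp add: sol_def u_def s_def)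
  have D: "deriv sol t = - (u * (s - 4) / (s - 1))"
  proof -
    have "deriv sol t = 4 * u * (s - 4) / (4 - 4 * s)"
      using DERIV_imp_deriv[OF deriv_sol[OF t]] by (simp add: u_def s_def)
    also have "\<dots> = - (u * (s - 4)) / (s - 1)"
    proof -
      have "4 - 4 * s \<noteq> 0" using ne(1) by auto
      from frac_eq_eq[OF this ne(1), of "4 * u * (s - 4)" "- (u * (s - 4))"]
      show ?thesis by (simp add: algebra_simps)
    qed
    finally show ?thesis by simp
  qed
  have I: "integral_sol t = - (8 * (2 * s + 1) / (3 * (s + 2) ^ 2))"
    by (simp add: integral_sol_def s_def)
  have t: "t = 2 * u / (s + 2)" using gt by (simp add: u_def s_def)
  have B: "sol t - t * deriv sol t = - (2 * u ^ 2 / (s - 1))"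
  proof -
    have "sol t - t * deriv sol t = - (4 * u ^ 2 / (s + 2)) + 2 * u ^ 2 * (s - 4) / ((s + 2) * (s - 1))"
      unfolding H D unfolding t by (simp add: power2_eq_square)
    also have "\<dots> = - (2 * u ^ 2 / (s - 1))"
      using ne by (simp add: divide_simps) (simp add: algebra_simps)
    finally show ?thesis .
  qed
  have A: "t ^ 2 * deriv sol t - 2 * t * sol t + 2 * integral_sol t = 4 / (3 * (s - 1))"
  proof -
    have "t ^ 2 * deriv sol t - 2 * t * sol t + 2 * integral_sol t
        = - (4 * u^3 * (s - 4) / ((s + 2)^2 * (s - 1))) + 16 * u^3 / (s + 2)^2 - 16 * (2 * s + 1) / (3 * (s + 2) ^ 2)"
      unfolding H D I unfolding t by (simp add: power2_eq_square power3_eq_cube mult_ac)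
    also have "\<dots> = 4 / (3 * (s - 1))"
      unfolding u3 using ne by (simp add: divide_simps) (simp add: algebra_simps power2_eq_square)
    finally show ?thesis .
  qed
  show "omega2 sol integral_sol t v = dp v + 4 / (3 * (s - 1)) * dx v - 2 * g t ^ 2 / (s - 1) * dy v"
    unfolding omega2_def A B u_def[symmetric] by simp
  show "omega3 sol t v = dq v - 2 * g t ^ 2 / (s - 1) * dx v - g t * (s - 4) / (s - 1) * dy v"
    unfolding omega3_def B unfolding D u_def[symmetric] by simp
  show "omega4 t v = dy v - 2 * g t / (s + 2) * dx v"
    unfolding omega4_def using t by (simp add: u_def)
qed

text \<open>On the locus (dx, dy, dp, dq) is proportional to (u^3 + 2, 2u, 8/3, 4u^2), with frame
  coordinates (2/3, 2u, 4u^2, u^3). The associated binary cubic is (X + 2uY)^3 / 3, a perfect cube,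
  so its discriminant vanishes; the proof checks this by expansion.\<close>

lemma vanishes_on_locus_sol:
  assumes gt: "\<And>t. t \<in> T \<Longrightarrow> t = 2 * g t / (g t ^ 3 + 2)"
  shows "vanishes_on_locus T sol integral_sol Upsilon"
  unfolding vanishes_on_locus_def
proof (intro ballI allI impI; elim conjE)
  fix t P and v :: "'k ^ 5"
  assume t: "t \<in> T" and 0: "omega2 sol integral_sol t v = 0" "omega3 sol t v = 0" "omega4 t v = 0"
  define u s x where "u = g t" and "s = u ^ 3" and "x = dx v / (s + 2)"
  have ne: "s - 1 \<noteq> 0" "s + 2 \<noteq> 0" using N_ne[OF g_in[OF t]] by (auto simp: s_def u_def)
  note om = omegas[OF t gt[OF t], folded u_def, folded s_def]
  have dx: "dx v = x * (s + 2)" using ne by (simp add: x_def)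
  have dy: "dy v = x * (2 * u)"
  proof -
    have "dy v = 2 * u / (s + 2) * dx v" using 0(3) unfolding om by simp
    also have "\<dots> = x * (2 * u)" unfolding dx using ne(2) by simp
    finally show ?thesis .
  qed
  have dp: "dp v = x * (8 / 3)"
  proof -
    have "dp v = 2 * u ^ 2 / (s - 1) * dy v - 4 / (3 * (s - 1)) * dx v"
      using 0(1) unfolding om by (simp add: algebra_simps)
    also have "\<dots> = x * (4 * u ^ 3 / (s - 1) - 4 * (s + 2) / (3 * (s - 1)))"
      unfolding dx dy by (simp add: algebra_simps power2_eq_square power3_eq_cube)
    also have "4 * u ^ 3 / (s - 1) - 4 * (s + 2) / (3 * (s - 1)) = 8 / 3"
      unfolding s_def[symmetric] using ne(1) by (simp add: divide_simps) (simp add: algebra_simps)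
    finally show ?thesis .
  qed
  have dq: "dq v = x * (4 * u ^ 2)"
  proof -
    have "dq v = 2 * u ^ 2 / (s - 1) * dx v + u * (s - 4) / (s - 1) * dy v"
      using 0(2) unfolding om by (simp add: algebra_simps)
    also have "\<dots> = x * (2 * u ^ 2 * (s + 2) / (s - 1) + 2 * u ^ 2 * (s - 4) / (s - 1))"
      unfolding dx dy by (simp add: algebra_simps power2_eq_square)
    also have "2 * u ^ 2 * (s + 2) / (s - 1) + 2 * u ^ 2 * (s - 4) / (s - 1) = 4 * u ^ 2"
      using ne(1) by (simp add: divide_simps) (simp add: algebra_simps)
    finally show ?thesis .
  qed
  have "27 * Upsilon P v = 0"
    unfolding Upsilon_def dx dy dp dq s_def
    by (simp add: algebra_simps power2_eq_square power3_eq_cube power4_eq_xxxx)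
  then show "Upsilon P v = 0" by simp
qed

end

text \<open>\<open>u \<mapsto> 2u/(u\<^sup>3 + 2)\<close> takes the same value at \<open>u \<noteq> w\<close> only if \<open>uw(u + w) = 2\<close>,
  which fails near the diagonal where \<open>u\<^sup>3 \<noteq> 1\<close>.\<close>

lemma noth_parameter_exists:
  fixes G :: "'k::real_or_complex set"
  assumes G: "open G" "u0 \<in> G" and ne: "\<And>u. u \<in> G \<Longrightarrow> 4 - 4 * u ^ 3 \<noteq> 0 \<and> u ^ 3 + 2 \<noteq> 0"
  obtains N T g where "open N" "u0 \<in> N" "N \<subseteq> G" "noth_parameter N T g"
    "T = (\<lambda>u. 2 * u / (u ^ 3 + 2)) ` N" "\<And>u. u \<in> N \<Longrightarrow> g (2 * u / (u ^ 3 + 2)) = u"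
proof -
  let ?\<tau> = "\<lambda>u :: 'k. 2 * u / (u ^ 3 + 2)"
  let ?W = "{p :: 'k \<times> 'k. fst p * snd p * (fst p + snd p) \<noteq> 2}"
  have "open ?W" by (intro open_Collect_neq continuous_intros)
  moreover have "(u0, u0) \<in> ?W"
  proof -
    have "u0 ^ 3 \<noteq> 1" using ne[OF G(2)] by auto
    moreover have "u0 * u0 * (u0 + u0) = 2 * u0 ^ 3" by (simp add: power3_eq_cube algebra_simps)
    ultimately show ?thesis by simp
  qed
  ultimately obtain A B where AB: "open A" "open B" "u0 \<in> A" "u0 \<in> B" "A \<times> B \<subseteq> ?W"
    by (auto elim!: open_prod_elim)
  define N where "N = A \<inter> B \<inter> G"
  have N: "open N" "u0 \<in> N" "N \<subseteq> G" using AB G by (auto simp: N_def)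
  have inj: "inj_on ?\<tau> N"
  proof
    fix u w assume uw: "u \<in> N" "w \<in> N" "?\<tau> u = ?\<tau> w"
    have nz: "u ^ 3 + 2 \<noteq> 0" "w ^ 3 + 2 \<noteq> 0" using ne uw N(3) by blast+
    have "(u, w) \<in> ?W" using AB(5) uw unfolding N_def by blast
    then have 2: "u * w * (u + w) - 2 \<noteq> 0" by simp
    have "2 * u * (w ^ 3 + 2) = 2 * w * (u ^ 3 + 2)"
      using uw(3) nz by (simp add: frac_eq_eq)
    \<comment> \<open>Equality of the two values factors into the diagonal and the curve excluded by
      \<open>?W\<close>.\<close>
    then have "2 * ((u - w) * (u * w * (u + w) - 2)) = 0" by algebra
    with 2 show "u = w" by simp
  qed
  have cont: "continuous_on N ?\<tau>"
    using ne N(3) by (auto intro!: continuous_intros)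
  define g where "g = inv_into N ?\<tau>"
  have g: "g (?\<tau> u) = u" if "u \<in> N" for u
    unfolding g_def using inv_into_f_f[OF inj that] .
  have "noth_parameter N (?\<tau> ` N) g"
  proof
    \<comment> \<open>Invariance of domain treats the real and the complex case alike.\<close>
    show "open (?\<tau> ` N)" by (rule invariance_of_domain[OF cont N(1) inj])
    fix t assume "t \<in> ?\<tau> ` N"
    then obtain u where u: "u \<in> N" "t = ?\<tau> u" by blast
    have gu: "g t = u" using g u by simp
    then show "g t \<in> N" using u by simp
    have nz: "4 - 4 * u ^ 3 \<noteq> 0" "u ^ 3 + 2 \<noteq> 0" using ne u(1) N(3) by blast+
    let ?d = "(4 - 4 * u ^ 3) / (u ^ 3 + 2) ^ 2"
    have "(?\<tau> has_field_derivative (2 * (u ^ 3 + 2) - 2 * u * (3 * u ^ 2)) / (u ^ 3 + 2) ^ 2) (at u)"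
      using nz by (auto intro!: derivative_eq_intros simp: power2_eq_square)
    moreover have "2 * (u ^ 3 + 2) - 2 * u * (3 * u ^ 2) = 4 - 4 * u ^ 3"
      by (simp add: power2_eq_square power3_eq_cube)
    ultimately have d: "(?\<tau> has_derivative (*) ?d) (at u)"
      unfolding has_field_derivative_def by simp
    have "(g has_derivative (*) ((u ^ 3 + 2) ^ 2 / (4 - 4 * u ^ 3))) (at (?\<tau> u))"
      by (rule has_derivative_inverse_strong[OF N(1) u(1) cont g d]) (use nz in \<open>auto simp: fun_eq_iff\<close>)
    then show "(g has_field_derivative (g t ^ 3 + 2) ^ 2 / (4 - 4 * g t ^ 3)) (at t)"
      unfolding has_field_derivative_def gu unfolding u(2) .
  qed (use ne N(3) in blast)
  from that[OF N this refl g] show thesis by blast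
qed

lemma noth_structure:
  fixes S :: "'k::real_or_complex set"
  assumes S: "open S" "S \<inter> {0, 1, -2} = {}" and r: "continuous_on S r" "\<forall>s\<in>S. r s ^ 3 = s" and s0: "s0 \<in> S"
  shows "\<exists>V T H I. open V \<and> s0 \<in> V \<and> V \<subseteq> S \<and> open T \<and>
           (\<lambda>s. 2 * r s / (s + 2)) ` V = T \<and>
           (\<forall>s\<in>V. H (2 * r s / (s + 2)) = - (4 * r s ^ 2 / (s + 2))) \<and>
           noth_solution_on T H \<and>
           (\<forall>t\<in>T. (I has_field_derivative H t) (at t)) \<and>
           (\<forall>s\<in>V. \<forall>v. let t = 2 * r s / (s + 2) in
              omega2 H I t v = dp v + 4 / (3 * (s - 1)) * dx v - 2 * r s ^ 2 / (s - 1) * dy v \<and>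
              omega3 H t v = dq v - 2 * r s ^ 2 / (s - 1) * dx v - r s * (s - 4) / (s - 1) * dy v \<and>
              omega4 t v = dy v - 2 * r s / (s + 2) * dx v) \<and>
           vanishes_on_locus T H I (Upsilon :: 'k ^ 5 \<Rightarrow> 'k ^ 5 \<Rightarrow> 'k)"
proof -
  \<comment> \<open>Cubing is a left inverse of the branch \<open>r\<close>, so its image is open
    and can serve as a domain for the parameter u.\<close>
  have "inj_on r S" by (rule inj_on_inverseI[where g = "\<lambda>u. u ^ 3"]) (use r(2) in blast)
  then have G: "open (r ` S)" using invariance_of_domain r(1) S(1) by blast
  have ne: "4 - 4 * u ^ 3 \<noteq> 0 \<and> u ^ 3 + 2 \<noteq> 0" if "u \<in> r ` S" for u
  proof -
    from that obtain s where "s \<in> S" "u = r s" by blast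
    then have s: "s \<in> S" "u ^ 3 = s" using r(2) by blast+
    then have "s \<noteq> 1" "s \<noteq> - 2" using S(2) by auto
    then show ?thesis unfolding s(2) by (auto simp: add_eq_0_iff2)
  qed
  obtain N T g where N: "open N" "r s0 \<in> N" "N \<subseteq> r ` S" and np: "noth_parameter N T g"
    and T: "T = (\<lambda>u. 2 * u / (u ^ 3 + 2)) ` N" and g: "\<And>u. u \<in> N \<Longrightarrow> g (2 * u / (u ^ 3 + 2)) = u"
    using noth_parameter_exists[OF G imageI[OF s0] ne] by blast
  interpret noth_parameter N T g by (rule np)
  define V where "V = S \<inter> r -` N"
  have V: "open V" "s0 \<in> V" "V \<subseteq> S"
    using continuous_open_preimage[OF r(1) S(1) N(1)] s0 N(2) by (auto simp: V_def)
  have r3: "r s ^ 3 = s" if "s \<in> V" for s using r(2) V(3) that by blast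
  have \<tau>: "2 * r s / (s + 2) \<in> T" "g (2 * r s / (s + 2)) = r s" if "s \<in> V" for s
    using that g[of "r s"] r3[OF that] by (auto simp: T V_def intro!: image_eqI[of _ _ "r s"])
  have img: "(\<lambda>s. 2 * r s / (s + 2)) ` V = T"
  proof
    show "T \<subseteq> (\<lambda>s. 2 * r s / (s + 2)) ` V"
    proof
      fix t assume "t \<in> T"
      then obtain u where u: "u \<in> N" "t = 2 * u / (u ^ 3 + 2)" unfolding T by blast
      then obtain s where s: "s \<in> S" "u = r s" using N(3) by blast
      then have "s \<in> V" "t = 2 * r s / (s + 2)" using u r(2) by (auto simp: V_def)
      then show "t \<in> (\<lambda>s. 2 * r s / (s + 2)) ` V" by blast
    qed
  qed (use \<tau>(1) in blast)
  have gt: "t = 2 * g t / (g t ^ 3 + 2)" if "t \<in> T" for t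
    using that g unfolding T by auto
  have sol: "sol (2 * r s / (s + 2)) = - (4 * r s ^ 2 / (s + 2))" if "s \<in> V" for s
    unfolding sol_def \<tau>(2)[OF that] r3[OF that] ..
  have om: "let t = 2 * r s / (s + 2) in
      omega2 sol integral_sol t v = dp v + 4 / (3 * (s - 1)) * dx v - 2 * r s ^ 2 / (s - 1) * dy v \<and>
      omega3 sol t v = dq v - 2 * r s ^ 2 / (s - 1) * dx v - r s * (s - 4) / (s - 1) * dy v \<and>
      omega4 t v = dy v - 2 * r s / (s + 2) * dx v" if "s \<in> V" for s v
    using omegas[OF \<tau>(1)[OF that] gt[OF \<tau>(1)[OF that]], of v]
    unfolding Let_def \<tau>(2)[OF that] r3[OF that] by (intro conjI)
  show ?thesis
    using V open_T img sol noth_sol deriv_integral_sol om vanishes_on_locus_sol[OF gt]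
    by (intro exI[of _ V] exI[of _ T] exI[of _ sol] exI[of _ integral_sol]) simp
qed

theorem theorem4p1:
  fixes U :: "('k::real_or_complex ^ 5) set"
  assumes "open U" and "connected U" and "U \<noteq> {}"
  shows
    "\<comment> \<open>the structure is associated to the parametrized solution of Noth's equation;
         r is a branch of the cube root near the parameter value s0\<close>
     (\<forall>(S :: 'k set) r s0. open S \<and> S \<inter> {0, 1, -2} = {} \<and> continuous_on S r \<and>
          (\<forall>s\<in>S. r s ^ 3 = s) \<and> s0 \<in> S \<longrightarrow>
        (\<exists>V T H I. open V \<and> s0 \<in> V \<and> V \<subseteq> S \<and> open T \<and>
           (\<lambda>s. 2 * r s / (s + 2)) ` V = T \<and>
           (\<forall>s\<in>V. H (2 * r s / (s + 2)) = - (4 * r s ^ 2 / (s + 2))) \<and>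
           noth_solution_on T H \<and>
           (\<forall>t\<in>T. (I has_field_derivative H t) (at t)) \<and>
           (\<forall>s\<in>V. \<forall>v. let t = 2 * r s / (s + 2) in
              omega2 H I t v = dp v + 4 / (3 * (s - 1)) * dx v - 2 * r s ^ 2 / (s - 1) * dy v \<and>
              omega3 H t v = dq v - 2 * r s ^ 2 / (s - 1) * dx v - r s * (s - 4) / (s - 1) * dy v \<and>
              omega4 t v = dy v - 2 * r s / (s + 2) * dx v) \<and>
           vanishes_on_locus T H I (Upsilon :: 'k ^ 5 \<Rightarrow> 'k ^ 5 \<Rightarrow> 'k)))
     \<and> (let \<g> = symmetry_algebra U contact_form Upsilon in
          lie_algebra field_scale \<g> (lie_bracket U) \<and>
          lie_algebra.split_simple_G2 field_scale \<g> (lie_bracket U) \<and>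
          vector_space.dim field_scale \<g> = 14 \<and>
          \<g> = module.span field_scale (restrict_field U `
                {S1, L2, S3, L4, S5, L6, S7, L8, S9, L10, S11, L12, h1, h2}))"
  unfolding Let_def[of "symmetry_algebra U contact_form Upsilon"]
  by (intro conjI allI impI symmetry_algebra_G2[OF assms]; elim conjE; rule noth_structure)

end
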